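(* Let $X$ be an infinite Polish zero-dimensional space. Then $C_p(X)\bumpeq C_p(X)\times C_p(X)$; in particular the spaces $C_p(X)$ and $C_p(X)\times C_p(X)$ are uniformly homeomorphic.
   Context: For a Tychonoff space $X$, $C_p(X)$ is the space of all continuous real-valued functions on $X$ with the topology of pointwise convergence, equipped also with the supremum extended norm $\|f\|=\sup_{x\in X}|f(x)|\in[0,\infty]$. An extended norm on a real vector space $E$ is a function $\|\cdot\|:E\to[0,\infty]$ with $\|x\|=0$ iff $x=0$, $\|ax\|=|a|\|x\|$ (with $0\cdot\infty=0$), and $\|x+y\|\le\|x\|+\|y\|$. A product of linear topological spaces with extended norms carries the product topology and the extended norm given by the supremum of the extended norms of the coordinates. A uniform homeomorphism between topological vector spaces is a bijection that is uniformly continuous together with its inverse, with respect to the natural (additive) uniformities: $u:E\to F$ is uniformly continuous if for each neighborhood $U$ of $0$ in $F$ there is a neighborhood $V$ of $0$ in $E$ such that $f-g\in V$ implies $u(f)-u(g)\in U$. For linear topological spaces $E,F$ with extended norms $\|\cdot\|_1,\|\cdot\|_2$ (not necessarily related to the topologies), $E\bumpeq F$ means: for every $\varepsilon>0$ there is a uniform homeomorphism $u_\varepsilon:E\to F$ (with respect to the topologies) such that $(1+\varepsilon)^{-1}\|f\|_1\le\|u_\varepsilon(f)\|_2\le\|f\|_1$ for every $f\in E$. *)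

theory Defs
  imports "HOL-Analysis.Analysis" "HOL-Library.Function_Algebras"
begin

section \<open>Linear topological spaces with extended norms\<close>

text \<open>
  A linear topological space is given as a linear subspace \<open>E\<close> of a type of class
  \<^class>\<open>real_vector\<close> that carries a topology, and has the subspace topology
  \<^term>\<open>top_of_set E\<close>. The vector operations are only required to be continuous on \<open>E\<close>.
\<close>

definition linear_topological_space :: "'b::{real_vector,topological_space} set \<Rightarrow> bool" where
  "linear_topological_space E \<longleftrightarrow>
     subspace E \<and>
     continuous_on (E \<times> E) (\<lambda>(f, g). f + g) \<and>
     continuous_on (UNIV \<times> E) (\<lambda>(a::real, f). a *\<^sub>R f)"

text \<open>In \<^typ>\<open>ennreal\<close> we have \<open>0 * \<infinity> = 0\<close>, as required in the homogeneity axiom.\<close>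

definition extended_norm_on :: "'b::real_vector set \<Rightarrow> ('b \<Rightarrow> ennreal) \<Rightarrow> bool" where
  "extended_norm_on E N \<longleftrightarrow>
     (\<forall>f\<in>E. N f = 0 \<longleftrightarrow> f = 0) \<and>
     (\<forall>a. \<forall>f\<in>E. N (a *\<^sub>R f) = ennreal \<bar>a\<bar> * N f) \<and>
     (\<forall>f\<in>E. \<forall>g\<in>E. N (f + g) \<le> N f + N g)"

definition prod_ext_norm :: "('b \<Rightarrow> ennreal) \<Rightarrow> ('c \<Rightarrow> ennreal) \<Rightarrow> 'b \<times> 'c \<Rightarrow> ennreal" where
  "prod_ext_norm M N = (\<lambda>(f, g). sup (M f) (N g))"

definition zero_neighbourhood :: "'b::{zero,topological_space} set \<Rightarrow> 'b set \<Rightarrow> bool" where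
  "zero_neighbourhood E U \<longleftrightarrow> U \<subseteq> E \<and> (\<exists>W. openin (top_of_set E) W \<and> 0 \<in> W \<and> W \<subseteq> U)"

definition uniformly_continuous_lts ::
  "'b::{ab_group_add,topological_space} set \<Rightarrow> 'c::{ab_group_add,topological_space} set
     \<Rightarrow> ('b \<Rightarrow> 'c) \<Rightarrow> bool" where
  "uniformly_continuous_lts E F u \<longleftrightarrow>
     (\<forall>U. zero_neighbourhood F U \<longrightarrow>
       (\<exists>V. zero_neighbourhood E V \<and>
         (\<forall>f\<in>E. \<forall>g\<in>E. f - g \<in> V \<longrightarrow> u f - u g \<in> U)))"

definition uniform_homeomorphism ::
  "'b::{ab_group_add,topological_space} set \<Rightarrow> 'c::{ab_group_add,topological_space} set
     \<Rightarrow> ('b \<Rightarrow> 'c) \<Rightarrow> bool" where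
  "uniform_homeomorphism E F u \<longleftrightarrow>
     bij_betw u E F \<and> uniformly_continuous_lts E F u \<and>
     uniformly_continuous_lts F E (inv_into E u)"

definition uniformly_homeomorphic ::
  "'b::{ab_group_add,topological_space} set \<Rightarrow> 'c::{ab_group_add,topological_space} set \<Rightarrow> bool"
  where
  "uniformly_homeomorphic E F \<longleftrightarrow> (\<exists>u. uniform_homeomorphism E F u)"

text \<open>The relation \<open>E \<bumpeq> F\<close>, where \<open>M\<close> and \<open>N\<close> are the extended norms of \<open>E\<close> and \<open>F\<close>.\<close>

definition bumpeq ::
  "'b::{ab_group_add,topological_space} set \<Rightarrow> ('b \<Rightarrow> ennreal)
     \<Rightarrow> 'c::{ab_group_add,topological_space} set \<Rightarrow> ('c \<Rightarrow> ennreal) \<Rightarrow> bool" where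
  "bumpeq E M F N \<longleftrightarrow>
     (\<forall>\<epsilon>::real. \<epsilon> > 0 \<longrightarrow>
       (\<exists>u. uniform_homeomorphism E F u \<and>
         (\<forall>f\<in>E. ennreal (inverse (1 + \<epsilon>)) * M f \<le> N (u f) \<and> N (u f) \<le> M f)))"


section \<open>Function spaces\<close>

instantiation "fun" :: (type, real_vector) real_vector
begin

definition scaleR_fun_def: "a *\<^sub>R f = (\<lambda>x. a *\<^sub>R f x)"

instance
  by standard (simp_all add: scaleR_fun_def fun_eq_iff algebra_simps)

end

lemma scaleR_fun_apply [simp]: "(a *\<^sub>R f) x = a *\<^sub>R f x"
  by (simp add: scaleR_fun_def)

text \<open>
  A real function on \<^term>\<open>topspace X\<close> is represented by its extension by \<open>0\<close> to the whole type.
  The topology on \<^typ>\<open>'a \<Rightarrow> real\<close> is the product topology, so \<open>Cp X\<close> has the topology of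
  pointwise convergence on \<^term>\<open>topspace X\<close>.
\<close>

definition Cp :: "'a topology \<Rightarrow> ('a \<Rightarrow> real) set" where
  "Cp X = {f. continuous_map X euclideanreal f \<and> (\<forall>x. x \<notin> topspace X \<longrightarrow> f x = 0)}"

definition sup_norm :: "'a topology \<Rightarrow> ('a \<Rightarrow> real) \<Rightarrow> ennreal" where
  "sup_norm X f = (SUP x\<in>topspace X. ennreal \<bar>f x\<bar>)"

lemma linear_topological_space_Cp: "linear_topological_space (Cp X)"
proof -
  have "subspace (Cp X)"
    unfolding subspace_def Cp_def
    by (auto simp: plus_fun_def scaleR_fun_def zero_fun_def
        intro!: continuous_map_add continuous_map_real_mult)
  moreover have "continuous_on (Cp X \<times> Cp X) (\<lambda>(f, g). f + g)"
    unfolding case_prod_unfold plus_fun_def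
    by (intro continuous_on_coordinatewise_then_product continuous_on_add)
       (rule continuous_on_product_then_coordinatewise, intro continuous_intros)+
  moreover have "continuous_on (UNIV \<times> Cp X) (\<lambda>(a::real, f). a *\<^sub>R f)"
    unfolding case_prod_unfold scaleR_fun_def
    by (intro continuous_on_coordinatewise_then_product continuous_on_scaleR)
       (intro continuous_intros continuous_on_product_then_coordinatewise[OF continuous_on_snd[OF continuous_on_id]])+
  ultimately show ?thesis
    by (simp add: linear_topological_space_def)
qed

lemma extended_norm_on_Cp: "extended_norm_on (Cp X) (sup_norm X)"
  unfolding extended_norm_on_def
proof (intro conjI ballI allI)
  fix f assume f: "f \<in> Cp X"
  have "sup_norm X f = 0 \<longleftrightarrow> (\<forall>x\<in>topspace X. f x = 0)"
    by (simp add: sup_norm_def SUP_eq_iff flip: bot_ennreal)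
       (auto simp: bot_ennreal)
  with f show "sup_norm X f = 0 \<longleftrightarrow> f = 0"
    by (auto simp: Cp_def fun_eq_iff)
next
  fix a f assume "f \<in> Cp X"
  show "sup_norm X (a *\<^sub>R f) = ennreal \<bar>a\<bar> * sup_norm X f"
    by (simp add: sup_norm_def SUP_mult_left_ennreal abs_mult ennreal_mult)
next
  fix f g assume "f \<in> Cp X" "g \<in> Cp X"
  show "sup_norm X (f + g) \<le> sup_norm X f + sup_norm X g"
    unfolding sup_norm_def
  proof (rule SUP_least)
    fix x assume x: "x \<in> topspace X"
    have "ennreal \<bar>(f + g) x\<bar> \<le> ennreal \<bar>f x\<bar> + ennreal \<bar>g x\<bar>"
      by (simp add: abs_triangle_ineq flip: ennreal_plus)
    also have "\<dots> \<le> (SUP x\<in>topspace X. ennreal \<bar>f x\<bar>) + (SUP x\<in>topspace X. ennreal \<bar>g x\<bar>)"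
      using x by (intro add_mono SUP_upper)
    finally show "ennreal \<bar>(f + g) x\<bar> \<le> \<dots>" .
  qed
qed

lemma linear_topological_space_Times:
  assumes "linear_topological_space E" "linear_topological_space F"
  shows "linear_topological_space (E \<times> F)"
proof -
  have sub: "subspace E" "subspace F"
    and add: "continuous_on (E \<times> E) (\<lambda>p. fst p + snd p)" "continuous_on (F \<times> F) (\<lambda>p. fst p + snd p)"
    and scale: "continuous_on (UNIV \<times> E) (\<lambda>p. (fst p :: real) *\<^sub>R snd p)"
               "continuous_on (UNIV \<times> F) (\<lambda>p. (fst p :: real) *\<^sub>R snd p)"
    using assms by (auto simp: linear_topological_space_def case_prod_unfold)
  have "subspace (E \<times> F)"
    using sub by (rule subspace_Times)
  moreover have "continuous_on ((E \<times> F) \<times> (E \<times> F)) (\<lambda>(f, g). f + g)"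
    unfolding case_prod_unfold plus_prod_def
    by (intro continuous_on_Pair
          continuous_on_compose2[OF add(1), of _ "\<lambda>p. (fst (fst p), fst (snd p))", simplified]
          continuous_on_compose2[OF add(2), of _ "\<lambda>p. (snd (fst p), snd (snd p))", simplified])
       (auto intro!: continuous_intros)
  moreover have "continuous_on (UNIV \<times> (E \<times> F)) (\<lambda>(a::real, f). a *\<^sub>R f)"
    unfolding case_prod_unfold scaleR_prod_def
    by (intro continuous_on_Pair
          continuous_on_compose2[OF scale(1), of _ "\<lambda>p. (fst p, fst (snd p))", simplified]
          continuous_on_compose2[OF scale(2), of _ "\<lambda>p. (fst p, snd (snd p))", simplified])
       (auto intro!: continuous_intros)
  ultimately show ?thesis
    by (simp add: linear_topological_space_def)
qed

lemma ennreal_mult_sup: "(c::ennreal) * sup a b = sup (c * a) (c * b)"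
  by (cases "a \<le> b") (simp_all add: sup_absorb1 sup_absorb2 mult_left_mono)

lemma extended_norm_on_Times:
  assumes M: "extended_norm_on E M" and N: "extended_norm_on F N"
  shows "extended_norm_on (E \<times> F) (prod_ext_norm M N)"
  unfolding extended_norm_on_def
proof (intro conjI ballI allI)
  fix p assume "p \<in> E \<times> F"
  then show "prod_ext_norm M N p = 0 \<longleftrightarrow> p = 0"
    using M N
    by (auto simp: prod_ext_norm_def extended_norm_on_def zero_prod_def sup_eq_bot_iff
        simp flip: bot_ennreal)
next
  fix a p assume "p \<in> E \<times> F"
  then show "prod_ext_norm M N (a *\<^sub>R p) = ennreal \<bar>a\<bar> * prod_ext_norm M N p"
    using M N by (auto simp: prod_ext_norm_def extended_norm_on_def ennreal_mult_sup)
next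
  fix p q assume "p \<in> E \<times> F" "q \<in> E \<times> F"
  then have "M (fst p + fst q) \<le> M (fst p) + M (fst q)" "N (snd p + snd q) \<le> N (snd p) + N (snd q)"
    using M N by (auto simp: extended_norm_on_def)
  then show "prod_ext_norm M N (p + q) \<le> prod_ext_norm M N p + prod_ext_norm M N q"
    unfolding prod_ext_norm_def case_prod_unfold fst_add snd_add
    by (intro sup_least) (auto elim!: order_trans intro!: add_mono)
qed


section \<open>Polish and zero-dimensional spaces\<close>

definition Polish_space :: "'a topology \<Rightarrow> bool" where
  "Polish_space X \<longleftrightarrow> separable_space X \<and> completely_metrizable_space X"

definition zero_dimensional_space :: "'a topology \<Rightarrow> bool" where
  "zero_dimensional_space X \<longleftrightarrow>
     (\<exists>\<B>. (\<forall>V\<in>\<B>. openin X V \<and> closedin X V) \<and>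
          (\<forall>U x. openin X U \<and> x \<in> U \<longrightarrow> (\<exists>V\<in>\<B>. x \<in> V \<and> V \<subseteq> U)))"

end

theory Submission
  imports Defs
begin

text \<open>
  The idea is to compare spaces of continuous functions by decomposing them, with distortion of the
  norm arbitrarily close to 1. Write \<open>E \<simeq> F\<close> if for every \<open>c > 1\<close> there is a bijection between the
  function spaces \<open>E\<close> and \<open>F\<close> that, together with its inverse, is uniformly continuous for pointwise
  convergence and multiplies suprema by at most \<open>c\<close>. The aim is \<open>Cp X \<simeq> Cp X \<oplus> Cp X\<close>; we then say that
  \<open>Cp X\<close> is squarable. Call a set \<^emph>\<open>good\<close> if it is finite or its function space is squarable.

  If \<open>K\<close> is a closed set with a retraction \<open>r\<close> onto it, then a function \<open>f\<close> corresponds to the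
  pair of its restriction to \<open>K\<close> and a function vanishing on \<open>K\<close>. The linear choice \<open>f - f \<circ> r\<close> for
  the second component can double the norm. The nonlinear choice \<open>x \<mapsto> shear L (f (r x)) (f x)\<close>, where
  \<open>shear L a\<close> is a homeomorphism of the line sending \<open>a\<close> to \<open>0\<close>, does not:
  \<open>max \<bar>a\<bar> \<bar>shear L a b\<bar>\<close> and \<open>max \<bar>a\<bar> \<bar>b\<bar>\<close> agree up to a factor that tends to 1 as \<open>L\<close> grows.
  This is \<open>Cp_on_retract_decomposition\<close>. In a zero-dimensional Polish space every nonempty closed
  set is a retract.

  Functions vanishing on \<open>K\<close> are easy to handle when the complement of \<open>K\<close> is partitioned into clopen
  pieces that shrink towards \<open>K\<close>: continuity at \<open>K\<close> then only depends on the norms of the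
  restrictions to the pieces. Since the maps used have distortion at most \<open>c\<close> on every piece, they may
  be applied piece by piece (\<open>squarable_Cp_vanishing\<close>). Hence a set with good closed \<open>K\<close> and
  squarable pieces is good. Finite pieces obstruct this, and the remedy is to add their
  points to \<open>K\<close> (\<open>good_with_exceptional_points\<close>).

  These tools make a global argument possible without any transfinite induction. Let the good region
  be the union of all clopen sets whose clopen subsets are all good; clopen subsets of the good region
  are good. Suppose that its complement \<open>A\<close> is not empty. It suffices to find a clopen set \<open>W\<close>
  meeting \<open>A\<close> such that \<open>A \<inter> Z\<close>, together with the added points, is good for every clopen \<open>Z \<subseteq> W\<close>, for
  then \<open>W\<close> lies in the good region. One of the following applies.

  \<^item> \<open>A\<close> has an isolated point, or a perfect compact relatively open part. In the second case all
    nonempty clopen pieces of that part are homeomorphic (they are Cantor sets). By compactness the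
    added points can be chosen to form a null sequence, whose function space is that of the null
    functions (\<open>good_compact_remainder\<close>).

  \<^item> \<open>A\<close> is nowhere locally compact. Either some point of \<open>A\<close> has a neighbourhood without isolated
    points of the space, or isolated points accumulate at every point of \<open>A\<close>. In the latter case one
    isolated point of each infinite piece, if any, is added as well, so that the added points accumulate
    at every point of \<open>A\<close>.
    Then all clopen parts of the resulting set that meet \<open>A\<close> are homeomorphic
    (\<open>good_nowhere_locally_compact\<close>).

  The homeomorphisms split a set into two clopen copies of itself, which makes it good. They are
  constructed from two matching sequences of finer and finer partitions
  (\<open>homeomorphic_by_matching_partitions\<close>).
\<close>

section \<open>Uniform homeomorphisms with controlled distortion\<close>

text \<open>
  Uniform continuity for pointwise convergence. Stating it by coordinates makes it independent of
  whether the index set is the space itself or a sum of copies of it.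
\<close>

definition coord_unif_cont :: "('i \<Rightarrow> real) set \<Rightarrow> (('i \<Rightarrow> real) \<Rightarrow> ('j \<Rightarrow> real)) \<Rightarrow> bool" where
  "coord_unif_cont E u \<longleftrightarrow>
     (\<forall>j. \<forall>\<epsilon>>0. \<exists>I \<delta>. finite I \<and> \<delta> > 0 \<and>
       (\<forall>f\<in>E. \<forall>g\<in>E. (\<forall>i\<in>I. \<bar>f i - g i\<bar> < \<delta>) \<longrightarrow> \<bar>u f j - u g j\<bar> < \<epsilon>))"

text \<open>
  This is \<open>sup \<bar>u f\<bar> \<le> c * sup \<bar>f\<bar>\<close>, with real bounds \<open>s\<close> in place of extended reals. For
  unbounded \<open>f\<close> nothing is claimed; if \<open>u\<close> has an inverse with such a bound, then \<open>u f\<close> is unbounded, too.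
\<close>

definition sup_bound :: "real \<Rightarrow> ('i \<Rightarrow> real) set \<Rightarrow> (('i \<Rightarrow> real) \<Rightarrow> ('j \<Rightarrow> real)) \<Rightarrow> bool" where
  "sup_bound c E u \<longleftrightarrow> (\<forall>f\<in>E. \<forall>s. (\<forall>i. \<bar>f i\<bar> \<le> s) \<longrightarrow> (\<forall>j. \<bar>u f j\<bar> \<le> c * s))"

definition tame :: "real \<Rightarrow> ('i \<Rightarrow> real) set \<Rightarrow> ('j \<Rightarrow> real) set \<Rightarrow> (('i \<Rightarrow> real) \<Rightarrow> ('j \<Rightarrow> real)) \<Rightarrow> bool" where
  "tame c E F u \<longleftrightarrow> u ` E \<subseteq> F \<and> coord_unif_cont E u \<and> sup_bound c E u"

text \<open>
  The same constant bounds the map and its inverse. Such pairs can be reversed and composed, which the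
  one-sided normalisation in the definition of \<open>bumpeq\<close> would not allow; rescaling restores it at the end.
\<close>

definition tame_pair :: "real \<Rightarrow> ('i \<Rightarrow> real) set \<Rightarrow> ('j \<Rightarrow> real) set \<Rightarrow>
    (('i \<Rightarrow> real) \<Rightarrow> ('j \<Rightarrow> real)) \<Rightarrow> (('j \<Rightarrow> real) \<Rightarrow> ('i \<Rightarrow> real)) \<Rightarrow> bool" where
  "tame_pair c E F u v \<longleftrightarrow> tame c E F u \<and> tame c F E v \<and>
     (\<forall>f\<in>E. v (u f) = f) \<and> (\<forall>g\<in>F. u (v g) = g)"

definition similar :: "('i \<Rightarrow> real) set \<Rightarrow> ('j \<Rightarrow> real) set \<Rightarrow> bool" (infix "\<simeq>" 50) where
  "E \<simeq> F \<longleftrightarrow> (\<forall>c>1. \<exists>u v. tame_pair c E F u v)"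

text \<open>
  The product of two function spaces, realised on the disjoint sum of the index sets. Its supremum norm
  is the norm of the product.
\<close>

definition dsum :: "('i \<Rightarrow> real) set \<Rightarrow> ('j \<Rightarrow> real) set \<Rightarrow> ('i + 'j \<Rightarrow> real) set" (infixr "\<oplus>" 65) where
  "E \<oplus> F = {h. h \<circ> Inl \<in> E \<and> h \<circ> Inr \<in> F}"

text \<open>
  All maps written down explicitly below depend, in each coordinate, on finitely many coordinates of
  the argument in a Lipschitz way.
\<close>

lemma coord_unif_cont_Lipschitz:
  assumes "\<And>j. \<exists>I L. finite I \<and> (\<forall>f\<in>E. \<forall>g\<in>E. \<bar>u f j - u g j\<bar> \<le> L * (\<Sum>i\<in>I. \<bar>f i - g i\<bar>))"
  shows "coord_unif_cont E u"
  unfolding coord_unif_cont_def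
proof (intro allI impI)
  fix j and \<epsilon> :: real assume \<epsilon>: "\<epsilon> > 0"
  obtain I L where I: "finite I" and L: "\<forall>f\<in>E. \<forall>g\<in>E. \<bar>u f j - u g j\<bar> \<le> L * (\<Sum>i\<in>I. \<bar>f i - g i\<bar>)"
    using assms by meson
  define L' where "L' = \<bar>L\<bar> + 1"
  define N where "N = real (card I) + 1"
  have pos: "L' > 0" "N > 0" by (auto simp: L'_def N_def)
  show "\<exists>I \<delta>. finite I \<and> \<delta> > 0 \<and> (\<forall>f\<in>E. \<forall>g\<in>E. (\<forall>i\<in>I. \<bar>f i - g i\<bar> < \<delta>) \<longrightarrow> \<bar>u f j - u g j\<bar> < \<epsilon>)"
  proof (intro exI conjI ballI impI)
    show "finite I" by fact
    show "\<epsilon> / (L' * N) > 0" using \<epsilon> pos by simp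
    fix f g assume fg: "f \<in> E" "g \<in> E" and *: "\<forall>i\<in>I. \<bar>f i - g i\<bar> < \<epsilon> / (L' * N)"
    have "(\<Sum>i\<in>I. \<bar>f i - g i\<bar>) \<le> real (card I) * (\<epsilon> / (L' * N))"
      by (rule sum_bounded_above) (use * in \<open>auto intro: less_imp_le\<close>)
    also have "\<dots> < N * (\<epsilon> / (L' * N))"
      using \<epsilon> pos by (intro mult_strict_right_mono) (auto simp: N_def)
    also have "\<dots> = \<epsilon> / L'" using pos by simp
    finally have s: "(\<Sum>i\<in>I. \<bar>f i - g i\<bar>) < \<epsilon> / L'" .
    have "\<bar>u f j - u g j\<bar> \<le> L * (\<Sum>i\<in>I. \<bar>f i - g i\<bar>)" using L fg by auto
    also have "\<dots> \<le> L' * (\<Sum>i\<in>I. \<bar>f i - g i\<bar>)"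
      by (intro mult_right_mono) (auto simp: L'_def intro: sum_nonneg)
    also have "\<dots> < L' * (\<epsilon> / L')" using s pos by (intro mult_strict_left_mono)
    finally show "\<bar>u f j - u g j\<bar> < \<epsilon>" using pos by simp
  qed
qed

lemma coord_unif_cont_select:
  assumes "\<And>j. (\<exists>i. \<forall>f\<in>E. u f j = f i) \<or> (\<forall>f\<in>E. u f j = 0)"
  shows "coord_unif_cont E u"
proof (rule coord_unif_cont_Lipschitz)
  fix j
  from assms[of j] show "\<exists>I L. finite I \<and> (\<forall>f\<in>E. \<forall>g\<in>E. \<bar>u f j - u g j\<bar> \<le> L * (\<Sum>i\<in>I. \<bar>f i - g i\<bar>))"
  proof
    assume "\<exists>i. \<forall>f\<in>E. u f j = f i"
    then obtain i where "\<forall>f\<in>E. u f j = f i" by blast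
    then show ?thesis by (intro exI[of _ "{i}"] exI[of _ 1]) auto
  next
    assume "\<forall>f\<in>E. u f j = 0"
    then show ?thesis by (intro exI[of _ "{}"] exI[of _ 1]) auto
  qed
qed

lemma sup_bound_select:
  assumes "\<And>f j. f \<in> E \<Longrightarrow> u f j = 0 \<or> (\<exists>i. u f j = f i)" and "c \<ge> 1"
  shows "sup_bound c E u"
  unfolding sup_bound_def
proof (intro ballI allI impI)
  fix f s j assume f: "f \<in> E" and s: "\<forall>i. \<bar>f i\<bar> \<le> s"
  have "\<bar>u f j\<bar> \<le> s" using assms(1)[OF f, of j] s by (metis abs_ge_zero abs_zero order_trans)
  moreover have "0 \<le> s" using s by (meson abs_ge_zero order_trans)
  ultimately show "\<bar>u f j\<bar> \<le> c * s" using assms(2) by (meson mult_le_cancel_right1 order_trans not_less)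
qed

lemma tame_select:
  assumes "\<And>f. f \<in> E \<Longrightarrow> u f \<in> F"
    and "\<And>j. (\<exists>i. \<forall>f\<in>E. u f j = f i) \<or> (\<forall>f\<in>E. u f j = 0)" and "c \<ge> 1"
  shows "tame c E F u"
  unfolding tame_def
proof (intro conjI)
  show "u ` E \<subseteq> F" using assms by auto
  show "coord_unif_cont E u" by (rule coord_unif_cont_select) (rule assms)
  show "sup_bound c E u"
  proof (rule sup_bound_select)
    fix f j assume "f \<in> E"
    with assms(2)[of j] show "u f j = 0 \<or> (\<exists>i. u f j = f i)" by blast
  qed fact
qed

text \<open>
  Linear bijections that only move coordinates around and insert zeros are isometries.
\<close>

lemma similar_select:
  assumes "\<And>f. f \<in> E \<Longrightarrow> u f \<in> F" "\<And>g. g \<in> F \<Longrightarrow> v g \<in> E"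
    and "\<And>j. (\<exists>i. \<forall>f\<in>E. u f j = f i) \<or> (\<forall>f\<in>E. u f j = 0)"
    and "\<And>i. (\<exists>j. \<forall>g\<in>F. v g i = g j) \<or> (\<forall>g\<in>F. v g i = 0)"
    and "\<And>f. f \<in> E \<Longrightarrow> v (u f) = f" "\<And>g. g \<in> F \<Longrightarrow> u (v g) = g"
  shows "E \<simeq> F"
  unfolding similar_def tame_pair_def
proof (intro allI impI exI conjI ballI)
  fix c :: real assume c: "c > 1"
  show "tame c E F u" by (rule tame_select) (use assms c in auto)
  show "tame c F E v" by (rule tame_select) (use assms c in auto)
qed (use assms in auto)

lemma similar_refl: "E \<simeq> E"
  by (rule similar_select[of E "\<lambda>f. f" E "\<lambda>f. f"]) auto

lemma similar_sym: "E \<simeq> F \<Longrightarrow> F \<simeq> E"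
  unfolding similar_def tame_pair_def by blast

lemma coord_unif_cont_comp:
  assumes u: "coord_unif_cont E u" "u ` E \<subseteq> F" and v: "coord_unif_cont F v"
  shows "coord_unif_cont E (\<lambda>f. v (u f))"
  unfolding coord_unif_cont_def
proof (intro allI impI)
  fix j and \<epsilon> :: real assume "\<epsilon> > 0"
  obtain I \<delta> where I: "finite I" "\<delta> > 0"
    and Iv: "\<And>f g. f \<in> F \<Longrightarrow> g \<in> F \<Longrightarrow> (\<forall>i\<in>I. \<bar>f i - g i\<bar> < \<delta>) \<Longrightarrow> \<bar>v f j - v g j\<bar> < \<epsilon>"
    using v[unfolded coord_unif_cont_def, rule_format, OF \<open>\<epsilon> > 0\<close>, of j] by blast
  have "\<forall>i. \<exists>J \<eta>. finite J \<and> \<eta> > 0 \<and>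
      (\<forall>f\<in>E. \<forall>g\<in>E. (\<forall>k\<in>J. \<bar>f k - g k\<bar> < \<eta>) \<longrightarrow> \<bar>u f i - u g i\<bar> < \<delta>)"
    using u(1)[unfolded coord_unif_cont_def, rule_format, OF I(2)] by blast
  then obtain J \<eta> where J: "\<And>i. finite (J i)" "\<And>i. \<eta> i > 0"
    and Ju: "\<And>i f g. f \<in> E \<Longrightarrow> g \<in> E \<Longrightarrow> (\<forall>k\<in>J i. \<bar>f k - g k\<bar> < \<eta> i) \<Longrightarrow> \<bar>u f i - u g i\<bar> < \<delta>"
    by metis
  define \<eta>' where "\<eta>' = Min (insert 1 (\<eta> ` I))"
  have \<eta>': "\<eta>' > 0" "\<And>i. i \<in> I \<Longrightarrow> \<eta>' \<le> \<eta> i" using I(1) J(2) by (auto simp: \<eta>'_def)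
  show "\<exists>I \<delta>. finite I \<and> \<delta> > 0 \<and>
      (\<forall>f\<in>E. \<forall>g\<in>E. (\<forall>i\<in>I. \<bar>f i - g i\<bar> < \<delta>) \<longrightarrow> \<bar>v (u f) j - v (u g) j\<bar> < \<epsilon>)"
  proof (intro exI conjI ballI impI)
    show "finite (\<Union>i\<in>I. J i)" using I J by auto
    show "\<eta>' > 0" by fact
    fix f g assume fg: "f \<in> E" "g \<in> E" and *: "\<forall>i\<in>\<Union>i\<in>I. J i. \<bar>f i - g i\<bar> < \<eta>'"
    have "\<forall>i\<in>I. \<bar>u f i - u g i\<bar> < \<delta>"
    proof
      fix i assume "i \<in> I"
      then have "\<forall>k\<in>J i. \<bar>f k - g k\<bar> < \<eta> i" using * \<eta>'(2)[of i] by force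
      then show "\<bar>u f i - u g i\<bar> < \<delta>" by (rule Ju[OF fg])
    qed
    moreover have "u f \<in> F" "u g \<in> F" using fg u(2) by auto
    ultimately show "\<bar>v (u f) j - v (u g) j\<bar> < \<epsilon>" using Iv by blast
  qed
qed

lemma tame_comp:
  assumes "tame c E F u" "tame d F G v"
  shows "tame (d * c) E G (\<lambda>f. v (u f))"
proof -
  have "sup_bound (d * c) E (\<lambda>f. v (u f))"
    unfolding sup_bound_def
  proof (intro ballI allI impI)
    fix f s j assume "f \<in> E" "\<forall>i. \<bar>f i\<bar> \<le> s"
    then have "u f \<in> F" "\<forall>i. \<bar>u f i\<bar> \<le> c * s" using assms(1) by (auto simp: tame_def sup_bound_def)
    then have "\<bar>v (u f) j\<bar> \<le> d * (c * s)" using assms(2) by (auto simp: tame_def sup_bound_def)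
    then show "\<bar>v (u f) j\<bar> \<le> d * c * s" by (simp add: mult.assoc)
  qed
  with assms show ?thesis by (auto simp: tame_def intro: coord_unif_cont_comp)
qed

lemma similar_trans:
  assumes "E \<simeq> F" "F \<simeq> G" shows "E \<simeq> G"
  unfolding similar_def
proof (intro allI impI)
  fix c :: real assume c: "c > 1"
  then have s: "sqrt c > 1" "sqrt c * sqrt c = c" by auto
  obtain u v where uv: "tame_pair (sqrt c) E F u v" using assms(1) s(1) unfolding similar_def by blast
  obtain u' v' where uv': "tame_pair (sqrt c) F G u' v'" using assms(2) s(1) unfolding similar_def by blast
  have "tame c E G (\<lambda>f. u' (u f))" using tame_comp[of "sqrt c" E F u "sqrt c" G u'] uv uv' s
    by (simp add: tame_pair_def)
  moreover have "tame c G E (\<lambda>f. v (v' f))" using tame_comp[of "sqrt c" G F v' "sqrt c" E v] uv uv' s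
    by (simp add: tame_pair_def)
  moreover have "\<forall>f\<in>E. v (v' (u' (u f))) = f" "\<forall>g\<in>G. u' (u (v (v' g))) = g"
    using uv uv' by (auto simp: tame_pair_def tame_def image_subset_iff)
  ultimately show "\<exists>u v. tame_pair c E G u v" unfolding tame_pair_def by blast
qed

lemmas [trans] = similar_trans

lemma tame_dsum:
  assumes u: "tame c E E' u" and w: "tame c F F' w"
  shows "tame c (E \<oplus> F) (E' \<oplus> F') (\<lambda>h. case_sum (u (h \<circ> Inl)) (w (h \<circ> Inr)))"
proof -
  let ?k = "\<lambda>h. case_sum (u (h \<circ> Inl)) (w (h \<circ> Inr))"
  have "?k ` (E \<oplus> F) \<subseteq> E' \<oplus> F'"
    using u w by (auto simp: dsum_def tame_def comp_def)
  moreover have "coord_unif_cont (E \<oplus> F) ?k"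
    unfolding coord_unif_cont_def
  proof (intro allI impI)
    fix j and \<epsilon> :: real assume \<epsilon>: "\<epsilon> > 0"
    show "\<exists>I \<delta>. finite I \<and> \<delta> > 0 \<and> (\<forall>f\<in>E \<oplus> F. \<forall>g\<in>E \<oplus> F.
        (\<forall>i\<in>I. \<bar>f i - g i\<bar> < \<delta>) \<longrightarrow> \<bar>?k f j - ?k g j\<bar> < \<epsilon>)"
    proof (cases j)
      case (Inl a)
      obtain I \<delta> where "finite I" "\<delta> > 0" and
        *: "\<forall>f\<in>E. \<forall>g\<in>E. (\<forall>i\<in>I. \<bar>f i - g i\<bar> < \<delta>) \<longrightarrow> \<bar>u f a - u g a\<bar> < \<epsilon>"
        using u[unfolded tame_def coord_unif_cont_def, THEN conjunct2, THEN conjunct1, rule_format, OF \<epsilon>, of a] by blast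
      then show ?thesis
        by (intro exI[of _ "Inl ` I"] exI[of _ \<delta>]) (auto simp: Inl dsum_def)
    next
      case (Inr a)
      obtain I \<delta> where "finite I" "\<delta> > 0" and
        *: "\<forall>f\<in>F. \<forall>g\<in>F. (\<forall>i\<in>I. \<bar>f i - g i\<bar> < \<delta>) \<longrightarrow> \<bar>w f a - w g a\<bar> < \<epsilon>"
        using w[unfolded tame_def coord_unif_cont_def, THEN conjunct2, THEN conjunct1, rule_format, OF \<epsilon>, of a] by blast
      then show ?thesis
        by (intro exI[of _ "Inr ` I"] exI[of _ \<delta>]) (auto simp: Inr dsum_def)
    qed
  qed
  moreover have "sup_bound c (E \<oplus> F) ?k"
    using u w by (auto simp: sup_bound_def tame_def dsum_def split: sum.split)
  ultimately show ?thesis by (simp add: tame_def)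
qed

lemma similar_dsum:
  assumes "E \<simeq> E'" "F \<simeq> F'"
  shows "E \<oplus> F \<simeq> E' \<oplus> F'"
  unfolding similar_def
proof (intro allI impI)
  fix c :: real assume c: "c > 1"
  obtain u v where uv: "tame_pair c E E' u v" using assms(1) c by (auto simp: similar_def)
  obtain w z where wz: "tame_pair c F F' w z" using assms(2) c by (auto simp: similar_def)
  have *: "case_sum (h \<circ> Inl) (h \<circ> Inr) = h" for h :: "'x + 'y \<Rightarrow> real"
    by (auto simp: fun_eq_iff split: sum.split)
  show "\<exists>u v. tame_pair c (E \<oplus> F) (E' \<oplus> F') u v"
    unfolding tame_pair_def
  proof (intro exI conjI ballI)
    show "tame c (E \<oplus> F) (E' \<oplus> F') (\<lambda>h. case_sum (u (h \<circ> Inl)) (w (h \<circ> Inr)))"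
      using uv wz by (intro tame_dsum) (auto simp: tame_pair_def)
    show "tame c (E' \<oplus> F') (E \<oplus> F) (\<lambda>h. case_sum (v (h \<circ> Inl)) (z (h \<circ> Inr)))"
      using uv wz by (intro tame_dsum) (auto simp: tame_pair_def)
  qed (use uv wz in \<open>auto simp: tame_pair_def dsum_def comp_def *[unfolded comp_def]\<close>)
qed

lemma dsum_commute: "E \<oplus> F \<simeq> F \<oplus> E"
proof (rule similar_select[of _ "\<lambda>h. case_sum (h \<circ> Inr) (h \<circ> Inl)" _ "\<lambda>h. case_sum (h \<circ> Inr) (h \<circ> Inl)"])
  fix j :: "'b + 'a"
  show "(\<exists>i. \<forall>f\<in>E \<oplus> F. case_sum (f \<circ> Inr) (f \<circ> Inl) j = f i) \<or> (\<forall>f\<in>E \<oplus> F. case_sum (f \<circ> Inr) (f \<circ> Inl) j = 0)"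
    by (cases j) auto
next
  fix j :: "'a + 'b"
  show "(\<exists>i. \<forall>f\<in>F \<oplus> E. case_sum (f \<circ> Inr) (f \<circ> Inl) j = f i) \<or> (\<forall>f\<in>F \<oplus> E. case_sum (f \<circ> Inr) (f \<circ> Inl) j = 0)"
    by (cases j) auto
qed (auto simp: dsum_def comp_def fun_eq_iff split: sum.split)

lemma dsum_assoc: "(E \<oplus> F) \<oplus> G \<simeq> E \<oplus> (F \<oplus> G)"
proof (rule similar_select[of _ "\<lambda>h. case_sum (h \<circ> Inl \<circ> Inl) (case_sum (h \<circ> Inl \<circ> Inr) (h \<circ> Inr))" _
        "\<lambda>h. case_sum (case_sum (h \<circ> Inl) (h \<circ> Inr \<circ> Inl)) (h \<circ> Inr \<circ> Inr)"])
  fix j :: "'a + ('b + 'c)"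
  let ?u = "\<lambda>h :: ('a + 'b) + 'c \<Rightarrow> real. case_sum (h \<circ> Inl \<circ> Inl) (case_sum (h \<circ> Inl \<circ> Inr) (h \<circ> Inr))"
  show "(\<exists>i. \<forall>f\<in>(E \<oplus> F) \<oplus> G. ?u f j = f i) \<or> (\<forall>f\<in>(E \<oplus> F) \<oplus> G. ?u f j = 0)"
    by (rule disjI1) (auto split: sum.split intro: exI[of _ "case_sum (Inl \<circ> Inl) (case_sum (Inl \<circ> Inr) Inr) j"])
next
  fix j :: "('a + 'b) + 'c"
  let ?u = "\<lambda>h :: 'a + ('b + 'c) \<Rightarrow> real. case_sum (case_sum (h \<circ> Inl) (h \<circ> Inr \<circ> Inl)) (h \<circ> Inr \<circ> Inr)"
  show "(\<exists>i. \<forall>f\<in>E \<oplus> (F \<oplus> G). ?u f j = f i) \<or> (\<forall>f\<in>E \<oplus> (F \<oplus> G). ?u f j = 0)"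
    by (rule disjI1) (auto split: sum.split intro: exI[of _ "case_sum (case_sum Inl (Inr \<circ> Inl)) (Inr \<circ> Inr) j"])
qed (auto simp: dsum_def comp_def fun_eq_iff split: sum.split)

lemma dsum_interchange: "(E \<oplus> F) \<oplus> (G \<oplus> H) \<simeq> (E \<oplus> G) \<oplus> (F \<oplus> H)"
proof -
  have "(E \<oplus> F) \<oplus> (G \<oplus> H) \<simeq> E \<oplus> (F \<oplus> (G \<oplus> H))" by (rule dsum_assoc)
  also have "\<dots> \<simeq> E \<oplus> ((F \<oplus> G) \<oplus> H)"
    by (intro similar_dsum similar_refl similar_sym[OF dsum_assoc])
  also have "\<dots> \<simeq> E \<oplus> ((G \<oplus> F) \<oplus> H)"
    by (intro similar_dsum similar_refl dsum_commute)
  also have "\<dots> \<simeq> E \<oplus> (G \<oplus> (F \<oplus> H))"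
    by (intro similar_dsum similar_refl dsum_assoc)
  also have "\<dots> \<simeq> (E \<oplus> G) \<oplus> (F \<oplus> H)" by (rule similar_sym[OF dsum_assoc])
  finally show ?thesis .
qed

definition squarable :: "('i \<Rightarrow> real) set \<Rightarrow> bool" where
  "squarable E \<longleftrightarrow> E \<simeq> E \<oplus> E"

lemma squarable_similar:
  assumes "E \<simeq> F" "squarable F" shows "squarable E"
proof -
  note assms(1)
  also have "F \<simeq> F \<oplus> F" using assms(2) by (simp add: squarable_def)
  also have "\<dots> \<simeq> E \<oplus> E" by (intro similar_dsum similar_sym[OF assms(1)])
  finally show ?thesis by (simp add: squarable_def)
qed

lemma squarable_dsum:
  assumes "squarable E" "squarable F" shows "squarable (E \<oplus> F)"
proof -
  have "E \<oplus> F \<simeq> (E \<oplus> E) \<oplus> (F \<oplus> F)" using assms by (intro similar_dsum) (auto simp: squarable_def)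
  also have "\<dots> \<simeq> (E \<oplus> F) \<oplus> (E \<oplus> F)" by (rule dsum_interchange)
  finally show ?thesis by (simp add: squarable_def)
qed

text \<open>
  This replaces squarability of the summand \<open>K\<close>: a finite-dimensional \<open>K\<close> is not squarable, but
  infinite-dimensional function spaces absorb it.
\<close>

lemma squarable_if_absorbs:
  assumes E: "E \<simeq> K \<oplus> G" and G: "squarable G" and abs: "E \<simeq> K \<oplus> E"
  shows "squarable E"
proof -
  have "E \<oplus> E \<simeq> (K \<oplus> G) \<oplus> (K \<oplus> G)" by (intro similar_dsum E)
  also have "\<dots> \<simeq> (K \<oplus> K) \<oplus> (G \<oplus> G)" by (rule dsum_interchange)
  also have "\<dots> \<simeq> (K \<oplus> K) \<oplus> G"
    using G by (intro similar_dsum similar_refl) (auto simp: squarable_def intro: similar_sym)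
  also have "\<dots> \<simeq> K \<oplus> (K \<oplus> G)" by (rule dsum_assoc)
  also have "\<dots> \<simeq> K \<oplus> E" by (intro similar_dsum similar_refl similar_sym[OF E])
  also have "\<dots> \<simeq> E" by (rule similar_sym[OF abs])
  finally show ?thesis by (simp add: squarable_def similar_sym)
qed

lemma absorbs_left_summand:
  assumes "E \<simeq> A \<oplus> B" "A \<simeq> F \<oplus> A" shows "E \<simeq> F \<oplus> E"
proof -
  note assms(1)
  also have "A \<oplus> B \<simeq> (F \<oplus> A) \<oplus> B" by (intro similar_dsum assms similar_refl)
  also have "\<dots> \<simeq> F \<oplus> (A \<oplus> B)" by (rule dsum_assoc)
  also have "\<dots> \<simeq> F \<oplus> E" by (intro similar_dsum similar_refl similar_sym[OF assms(1)])
  finally show ?thesis .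
qed

lemma absorbs_right_summand:
  assumes "E \<simeq> A \<oplus> B" "B \<simeq> F \<oplus> B" shows "E \<simeq> F \<oplus> E"
  using absorbs_left_summand[OF similar_trans[OF assms(1) dsum_commute] assms(2)] .

section \<open>Spaces assembled from blocks\<close>

definition restrict_to :: "('i \<Rightarrow> 'b option) \<Rightarrow> 'b \<Rightarrow> ('i \<Rightarrow> real) \<Rightarrow> 'i \<Rightarrow> real" where
  "restrict_to l b f = (\<lambda>i. if l i = Some b then f i else 0)"

text \<open>
  The coordinates are partitioned into blocks by the labelling \<open>l\<close>; coordinates labelled \<open>None\<close> carry
  the value 0. A function belongs to the space if its restriction to each block \<open>b\<close> lies in \<open>E b\<close> and
  it decays uniformly along each member of \<open>\<F>\<close>, which is thought of as a filter on the set of blocks.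
  Decay is expressed by the norms of the restrictions alone, so that it survives any change of the
  spaces \<open>E b\<close> with bounded distortion.
\<close>

definition block_space ::
  "'b set \<Rightarrow> 'b set set set \<Rightarrow> ('i \<Rightarrow> 'b option) \<Rightarrow> ('b \<Rightarrow> ('i \<Rightarrow> real) set) \<Rightarrow> ('i \<Rightarrow> real) set" where
  "block_space \<U> \<F> l E = {f. (\<forall>i. l i = None \<longrightarrow> f i = 0) \<and> (\<forall>b\<in>\<U>. restrict_to l b f \<in> E b) \<and>
     (\<forall>\<Phi>\<in>\<F>. \<forall>\<epsilon>>0. \<exists>\<V>\<in>\<Phi>. \<forall>i b. l i = Some b \<longrightarrow> b \<in> \<V> \<longrightarrow> \<bar>f i\<bar> \<le> \<epsilon>)}"

definition blockwise :: "('j \<Rightarrow> 'b option) \<Rightarrow> ('i \<Rightarrow> 'b option) \<Rightarrow> ('b \<Rightarrow> ('i \<Rightarrow> real) \<Rightarrow> ('j \<Rightarrow> real)) \<Rightarrow>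
    ('i \<Rightarrow> real) \<Rightarrow> ('j \<Rightarrow> real)" where
  "blockwise l' l u f = (\<lambda>j. case l' j of None \<Rightarrow> 0 | Some b \<Rightarrow> u b (restrict_to l b f) j)"

lemma restrict_to_blockwise:
  assumes "b \<in> \<U>" "u b (restrict_to l b f) \<in> E' b" "\<And>g j. g \<in> E' b \<Longrightarrow> l' j \<noteq> Some b \<Longrightarrow> g j = 0"
  shows "restrict_to l' b (blockwise l' l u f) = u b (restrict_to l b f)"
  using assms(2,3) by (auto simp: restrict_to_def blockwise_def fun_eq_iff)

text \<open>
  Each coordinate of the result depends on one block only, which gives uniform continuity. The
  constant \<open>c\<close> being common to all blocks gives the bound and the preservation of decay.
\<close>

lemma tame_blockwise:
  assumes u: "\<And>b. b \<in> \<U> \<Longrightarrow> tame c (E b) (E' b) (u b)"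
    and l': "\<And>j b. l' j = Some b \<Longrightarrow> b \<in> \<U>"
    and E': "\<And>b g j. b \<in> \<U> \<Longrightarrow> g \<in> E' b \<Longrightarrow> l' j \<noteq> Some b \<Longrightarrow> g j = 0"
    and c: "c > 0"
  shows "tame c (block_space \<U> \<F> l E) (block_space \<U> \<F> l' E') (blockwise l' l u)"
proof -
  let ?B = "block_space \<U> \<F> l E" and ?w = "blockwise l' l u"
  have res: "restrict_to l b f \<in> E b" if "f \<in> ?B" "b \<in> \<U>" for f b
    using that by (auto simp: block_space_def)
  have rb: "restrict_to l' b (?w f) = u b (restrict_to l b f)" if "f \<in> ?B" "b \<in> \<U>" for f b
    using u[OF that(2)] res[OF that] E'[OF that(2)] that(2)
    by (intro restrict_to_blockwise[of b \<U> u l f E']) (auto simp: tame_def)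
  have "?w f \<in> block_space \<U> \<F> l' E'" if f: "f \<in> ?B" for f
    unfolding block_space_def
  proof (intro CollectI conjI allI impI ballI)
    show "?w f j = 0" if "l' j = None" for j using that by (simp add: blockwise_def)
    show "restrict_to l' b (?w f) \<in> E' b" if "b \<in> \<U>" for b
      using rb[OF f that] u[OF that] res[OF f that] by (auto simp: tame_def)
    fix \<Phi> and \<epsilon> :: real assume "\<Phi> \<in> \<F>" "\<epsilon> > 0"
    then have "\<exists>\<V>\<in>\<Phi>. \<forall>i b. l i = Some b \<longrightarrow> b \<in> \<V> \<longrightarrow> \<bar>f i\<bar> \<le> \<epsilon> / c"
      using f c by (auto simp: block_space_def)
    then obtain \<V> where V: "\<V> \<in> \<Phi>" "\<And>i b. l i = Some b \<Longrightarrow> b \<in> \<V> \<Longrightarrow> \<bar>f i\<bar> \<le> \<epsilon> / c" by blast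
    show "\<exists>\<V>\<in>\<Phi>. \<forall>j b. l' j = Some b \<longrightarrow> b \<in> \<V> \<longrightarrow> \<bar>?w f j\<bar> \<le> \<epsilon>"
    proof (intro bexI[OF _ V(1)] allI impI)
      fix j b assume j: "l' j = Some b" and b: "b \<in> \<V>"
      have bU: "b \<in> \<U>" using l' j by blast
      have "\<forall>i. \<bar>restrict_to l b f i\<bar> \<le> \<epsilon> / c"
        using V(2) b c \<open>\<epsilon> > 0\<close> by (auto simp: restrict_to_def)
      then have "\<bar>u b (restrict_to l b f) j\<bar> \<le> c * (\<epsilon> / c)"
        using u[OF bU] res[OF f bU] unfolding tame_def sup_bound_def by blast
      then show "\<bar>?w f j\<bar> \<le> \<epsilon>" using j c by (simp add: blockwise_def)
    qed
  qed
  moreover have "coord_unif_cont ?B ?w"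
    unfolding coord_unif_cont_def
  proof (intro allI impI)
    fix j and \<epsilon> :: real assume \<epsilon>: "\<epsilon> > 0"
    show "\<exists>I \<delta>. finite I \<and> \<delta> > 0 \<and> (\<forall>f\<in>?B. \<forall>g\<in>?B. (\<forall>i\<in>I. \<bar>f i - g i\<bar> < \<delta>) \<longrightarrow> \<bar>?w f j - ?w g j\<bar> < \<epsilon>)"
    proof (cases "l' j")
      case None
      then show ?thesis using \<epsilon> by (intro exI[of _ "{}"] exI[of _ 1]) (auto simp: blockwise_def)
    next
      case (Some b)
      then have bU: "b \<in> \<U>" by (rule l')
      obtain I \<delta> where I: "finite I" "\<delta> > 0" and
        *: "\<And>f g. f \<in> E b \<Longrightarrow> g \<in> E b \<Longrightarrow> (\<forall>i\<in>I. \<bar>f i - g i\<bar> < \<delta>) \<Longrightarrow> \<bar>u b f j - u b g j\<bar> < \<epsilon>"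
        using u[OF bU, unfolded tame_def coord_unif_cont_def, THEN conjunct2, THEN conjunct1, rule_format, OF \<epsilon>, of j]
        by blast
      show ?thesis
      proof (intro exI conjI ballI impI)
        fix f g assume fg: "f \<in> ?B" "g \<in> ?B" "\<forall>i\<in>I. \<bar>f i - g i\<bar> < \<delta>"
        have "\<forall>i\<in>I. \<bar>restrict_to l b f i - restrict_to l b g i\<bar> < \<delta>"
          using fg(3) I(2) by (auto simp: restrict_to_def)
        then show "\<bar>?w f j - ?w g j\<bar> < \<epsilon>"
          using * res[OF fg(1) bU] res[OF fg(2) bU] Some by (simp add: blockwise_def)
      qed (use I in auto)
    qed
  qed
  moreover have "sup_bound c ?B ?w"
    unfolding sup_bound_def
  proof (intro ballI allI impI)
    fix f s j assume f: "f \<in> ?B" and s: "\<forall>i. \<bar>f i\<bar> \<le> s"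
    then have s0: "0 \<le> s" by (meson abs_ge_zero order_trans)
    show "\<bar>?w f j\<bar> \<le> c * s"
    proof (cases "l' j")
      case None
      then show ?thesis using s0 c by (simp add: blockwise_def)
    next
      case (Some b)
      then have bU: "b \<in> \<U>" by (rule l')
      have "\<forall>i. \<bar>restrict_to l b f i\<bar> \<le> s" using s s0 by (auto simp: restrict_to_def)
      then show ?thesis using u[OF bU] res[OF f bU] Some by (auto simp: blockwise_def tame_def sup_bound_def)
    qed
  qed
  ultimately show ?thesis by (auto simp: tame_def)
qed

lemma blockwise_inverse:
  assumes f: "f \<in> block_space \<U> \<F> l E" and uv: "\<And>b. b \<in> \<U> \<Longrightarrow> tame_pair c (E b) (E' b) (u b) (v b)"
    and l: "\<And>i b. l i = Some b \<Longrightarrow> b \<in> \<U>"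
    and E': "\<And>b g j. b \<in> \<U> \<Longrightarrow> g \<in> E' b \<Longrightarrow> l' j \<noteq> Some b \<Longrightarrow> g j = 0"
  shows "blockwise l l' v (blockwise l' l u f) = f"
proof
  fix i
  show "blockwise l l' v (blockwise l' l u f) i = f i"
  proof (cases "l i")
    case None
    then show ?thesis using f by (simp add: blockwise_def block_space_def)
  next
    case (Some b)
    then have bU: "b \<in> \<U>" by (rule l)
    have r: "restrict_to l b f \<in> E b" using f bU by (auto simp: block_space_def)
    then have "restrict_to l' b (blockwise l' l u f) = u b (restrict_to l b f)"
      using uv[OF bU] E'[OF bU] bU
      by (intro restrict_to_blockwise[of b \<U> u l f E']) (auto simp: tame_pair_def tame_def)
    moreover have "v b (u b (restrict_to l b f)) = restrict_to l b f"
      using r uv[OF bU] by (auto simp: tame_pair_def)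
    ultimately show ?thesis using Some by (simp add: blockwise_def restrict_to_def)
  qed
qed

lemma similar_block_space:
  assumes sim: "\<And>b. b \<in> \<U> \<Longrightarrow> E b \<simeq> E' b"
    and l: "\<And>i b. l i = Some b \<Longrightarrow> b \<in> \<U>" and l': "\<And>j b. l' j = Some b \<Longrightarrow> b \<in> \<U>"
    and E: "\<And>b f i. b \<in> \<U> \<Longrightarrow> f \<in> E b \<Longrightarrow> l i \<noteq> Some b \<Longrightarrow> f i = 0"
    and E': "\<And>b g j. b \<in> \<U> \<Longrightarrow> g \<in> E' b \<Longrightarrow> l' j \<noteq> Some b \<Longrightarrow> g j = 0"
  shows "block_space \<U> \<F> l E \<simeq> block_space \<U> \<F> l' E'"
  unfolding similar_def
proof (intro allI impI)
  fix c :: real assume c: "c > 1"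
  then have "\<forall>b\<in>\<U>. \<exists>u v. tame_pair c (E b) (E' b) u v" using sim unfolding similar_def by blast
  then obtain u v where uv: "\<And>b. b \<in> \<U> \<Longrightarrow> tame_pair c (E b) (E' b) (u b) (v b)" by metis
  have sw: "tame_pair c (E' b) (E b) (v b) (u b)" if "b \<in> \<U>" for b
    using uv[OF that] by (auto simp: tame_pair_def)
  show "\<exists>u v. tame_pair c (block_space \<U> \<F> l E) (block_space \<U> \<F> l' E') u v"
    unfolding tame_pair_def
  proof (intro exI conjI ballI)
    show "tame c (block_space \<U> \<F> l E) (block_space \<U> \<F> l' E') (blockwise l' l u)"
      using uv E' l' c by (intro tame_blockwise) (auto simp: tame_pair_def)
    show "tame c (block_space \<U> \<F> l' E') (block_space \<U> \<F> l E) (blockwise l l' v)"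
      using uv E l c by (intro tame_blockwise) (auto simp: tame_pair_def)
    show "blockwise l l' v (blockwise l' l u f) = f" if "f \<in> block_space \<U> \<F> l E" for f
      by (rule blockwise_inverse[OF that, where c = c and E' = E']; fact uv l E')
    show "blockwise l' l u (blockwise l l' v g) = g" if "g \<in> block_space \<U> \<F> l' E'" for g
      by (rule blockwise_inverse[OF that, where c = c and E' = E]; fact sw l' E)
  qed
qed

lemma block_space_dsum:
  assumes "\<And>\<Phi> \<V> \<W>. \<Phi> \<in> \<F> \<Longrightarrow> \<V> \<in> \<Phi> \<Longrightarrow> \<W> \<in> \<Phi> \<Longrightarrow> \<V> \<inter> \<W> \<in> \<Phi>"
  shows "block_space \<U> \<F> (case_sum l l') (\<lambda>b. E b \<oplus> E' b) = block_space \<U> \<F> l E \<oplus> block_space \<U> \<F> l' E'"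
proof -
  have r: "restrict_to (case_sum l l') b h \<circ> Inl = restrict_to l b (h \<circ> Inl)"
    "restrict_to (case_sum l l') b h \<circ> Inr = restrict_to l' b (h \<circ> Inr)" for b h
    by (auto simp: restrict_to_def)
  show ?thesis
  proof (intro set_eqI iffI)
    fix h assume h: "h \<in> block_space \<U> \<F> (case_sum l l') (\<lambda>b. E b \<oplus> E' b)"
    have d: "\<exists>\<V>\<in>\<Phi>. \<forall>i b. case_sum l l' i = Some b \<longrightarrow> b \<in> \<V> \<longrightarrow> \<bar>h i\<bar> \<le> \<epsilon>"
      if "\<Phi> \<in> \<F>" "\<epsilon> > 0" for \<Phi> \<epsilon>
      using h that by (auto simp: block_space_def)
    have "\<exists>\<V>\<in>\<Phi>. \<forall>i b. l i = Some b \<longrightarrow> b \<in> \<V> \<longrightarrow> \<bar>h (Inl i)\<bar> \<le> \<epsilon>"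
      "\<exists>\<V>\<in>\<Phi>. \<forall>i b. l' i = Some b \<longrightarrow> b \<in> \<V> \<longrightarrow> \<bar>h (Inr i)\<bar> \<le> \<epsilon>" if a: "\<Phi> \<in> \<F>" "\<epsilon> > 0" for \<Phi> \<epsilon>
    proof -
      obtain \<V> where V: "\<V> \<in> \<Phi>" "\<forall>i b. case_sum l l' i = Some b \<longrightarrow> b \<in> \<V> \<longrightarrow> \<bar>h i\<bar> \<le> \<epsilon>"
        using d[OF a] by blast
      have "\<bar>h (Inl i)\<bar> \<le> \<epsilon>" if "l i = Some b" "b \<in> \<V>" for i b
        using V(2)[rule_format, of "Inl i" b] that by simp
      then show "\<exists>\<V>\<in>\<Phi>. \<forall>i b. l i = Some b \<longrightarrow> b \<in> \<V> \<longrightarrow> \<bar>h (Inl i)\<bar> \<le> \<epsilon>" using V(1) by blast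
      have "\<bar>h (Inr i)\<bar> \<le> \<epsilon>" if "l' i = Some b" "b \<in> \<V>" for i b
        using V(2)[rule_format, of "Inr i" b] that by simp
      then show "\<exists>\<V>\<in>\<Phi>. \<forall>i b. l' i = Some b \<longrightarrow> b \<in> \<V> \<longrightarrow> \<bar>h (Inr i)\<bar> \<le> \<epsilon>" using V(1) by blast
    qed
    with h show "h \<in> block_space \<U> \<F> l E \<oplus> block_space \<U> \<F> l' E'"
      by (auto simp: block_space_def dsum_def r)
  next
    fix h assume "h \<in> block_space \<U> \<F> l E \<oplus> block_space \<U> \<F> l' E'"
    then have hl: "h \<circ> Inl \<in> block_space \<U> \<F> l E" and hr: "h \<circ> Inr \<in> block_space \<U> \<F> l' E'"
      by (auto simp: dsum_def)
    have zero: "(h \<circ> Inl) i = 0" if "l i = None" for i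
      using hl that unfolding block_space_def by blast
    have zero': "(h \<circ> Inr) i = 0" if "l' i = None" for i
      using hr that unfolding block_space_def by blast
    show "h \<in> block_space \<U> \<F> (case_sum l l') (\<lambda>b. E b \<oplus> E' b)"
      unfolding block_space_def
    proof (intro CollectI conjI allI impI ballI)
      show "h i = 0" if "case_sum l l' i = None" for i
        using zero zero' that by (cases i) auto
      show "restrict_to (case_sum l l') b h \<in> E b \<oplus> E' b" if "b \<in> \<U>" for b
        using hl hr that unfolding dsum_def block_space_def mem_Collect_eq r by blast
      fix \<Phi> and \<epsilon> :: real assume a: "\<Phi> \<in> \<F>" "\<epsilon> > 0"
      obtain \<V> where V: "\<V> \<in> \<Phi>" "\<forall>i b. l i = Some b \<longrightarrow> b \<in> \<V> \<longrightarrow> \<bar>(h \<circ> Inl) i\<bar> \<le> \<epsilon>"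
        using hl a unfolding block_space_def by blast
      obtain \<W> where W: "\<W> \<in> \<Phi>" "\<forall>i b. l' i = Some b \<longrightarrow> b \<in> \<W> \<longrightarrow> \<bar>(h \<circ> Inr) i\<bar> \<le> \<epsilon>"
        using hr a unfolding block_space_def by blast
      show "\<exists>\<V>\<in>\<Phi>. \<forall>i b. case_sum l l' i = Some b \<longrightarrow> b \<in> \<V> \<longrightarrow> \<bar>h i\<bar> \<le> \<epsilon>"
        using V(2) W(2) by (intro bexI[OF _ assms[OF a(1) V(1) W(1)]]) (auto split: sum.splits)
    qed
  qed
qed

lemma squarable_block_space:
  assumes "\<And>b. b \<in> \<U> \<Longrightarrow> squarable (E b)"
    and "\<And>i b. l i = Some b \<Longrightarrow> b \<in> \<U>"
    and E: "\<And>b f i. b \<in> \<U> \<Longrightarrow> f \<in> E b \<Longrightarrow> l i \<noteq> Some b \<Longrightarrow> f i = 0"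
    and "\<And>\<Phi> \<V> \<W>. \<Phi> \<in> \<F> \<Longrightarrow> \<V> \<in> \<Phi> \<Longrightarrow> \<W> \<in> \<Phi> \<Longrightarrow> \<V> \<inter> \<W> \<in> \<Phi>"
  shows "squarable (block_space \<U> \<F> l E)"
proof -
  have "block_space \<U> \<F> l E \<simeq> block_space \<U> \<F> (case_sum l l) (\<lambda>b. E b \<oplus> E b)"
  proof (rule similar_block_space)
    fix b f i assume "b \<in> \<U>" "f \<in> E b \<oplus> E b" "case_sum l l i \<noteq> Some b"
    then show "f i = 0" using E[of b "f \<circ> Inl"] E[of b "f \<circ> Inr"] by (cases i) (auto simp: dsum_def)
  qed (use assms in \<open>auto simp: squarable_def split: sum.splits\<close>)
  also have "block_space \<U> \<F> (case_sum l l) (\<lambda>b. E b \<oplus> E b) = block_space \<U> \<F> l E \<oplus> block_space \<U> \<F> l E"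
    by (rule block_space_dsum) (rule assms(4))
  finally show ?thesis by (simp add: squarable_def)
qed

section \<open>All functions and null functions on a set\<close>

text \<open>
  All real functions on \<open>D\<close>, or only those that tend to 0 along the discrete set \<open>D\<close>.
\<close>

definition coord_space :: "bool \<Rightarrow> 'i set \<Rightarrow> ('i \<Rightarrow> real) set" where
  "coord_space all D = {f. (\<forall>x. x \<notin> D \<longrightarrow> f x = 0) \<and> (all \<or> (\<forall>\<epsilon>>0. finite {x. \<bar>f x\<bar> \<ge> \<epsilon>}))}"

text \<open>
  Both spaces are invariant under permutations of the index set, hence depend on its cardinality only.
\<close>

lemma coord_space_dsum:
  assumes \<sigma>: "bij_betw \<sigma> (D <+> D') D''"
  shows "coord_space p D'' \<simeq> coord_space p D \<oplus> coord_space p D'"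
proof -
  define \<tau> where "\<tau> = inv_into (D <+> D') \<sigma>"
  have st: "\<And>x. x \<in> D'' \<Longrightarrow> \<sigma> (\<tau> x) = x \<and> \<tau> x \<in> D <+> D'" and ts: "\<And>x. x \<in> D <+> D' \<Longrightarrow> \<tau> (\<sigma> x) = x \<and> \<sigma> x \<in> D''"
    using \<sigma> unfolding \<tau>_def
    by (auto simp: bij_betw_inv_into_right bij_betw_inv_into_left bij_betwE[OF bij_betw_inv_into] bij_betwE)
  let ?u = "\<lambda>f y. if y \<in> D <+> D' then f (\<sigma> y) else 0"
  let ?v = "\<lambda>h x. if x \<in> D'' then h (\<tau> x) else 0"
  have sm: "h \<in> coord_space p D \<oplus> coord_space p D' \<longleftrightarrow> h \<in> coord_space p (D <+> D')" for h
  proof -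
    have *: "finite {x. \<epsilon> \<le> \<bar>h x\<bar>} \<longleftrightarrow> finite {x. \<epsilon> \<le> \<bar>h (Inl x)\<bar>} \<and> finite {x. \<epsilon> \<le> \<bar>h (Inr x)\<bar>}" for \<epsilon>
    proof -
      have "{x. \<epsilon> \<le> \<bar>h x\<bar>} = {x. \<epsilon> \<le> \<bar>h (Inl x)\<bar>} <+> {x. \<epsilon> \<le> \<bar>h (Inr x)\<bar>}"
      proof (rule set_eqI)
        show "y \<in> {x. \<epsilon> \<le> \<bar>h x\<bar>} \<longleftrightarrow> y \<in> {x. \<epsilon> \<le> \<bar>h (Inl x)\<bar>} <+> {x. \<epsilon> \<le> \<bar>h (Inr x)\<bar>}" for y
          by (cases y) auto
      qed
      then show ?thesis by (simp add: finite_Plus_iff)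
    qed
    have **: "(\<forall>x. x \<notin> D <+> D' \<longrightarrow> h x = 0) \<longleftrightarrow> (\<forall>x. x \<notin> D \<longrightarrow> h (Inl x) = 0) \<and> (\<forall>x. x \<notin> D' \<longrightarrow> h (Inr x) = 0)"
      by (simp add: split_sum_all InlI InrI Inl_not_Inr split: sum.splits) (auto elim!: PlusE)
    show ?thesis by (auto simp: coord_space_def dsum_def * **)
  qed
  show ?thesis
  proof (rule similar_select[of _ ?u _ ?v])
    show "?u f \<in> coord_space p D \<oplus> coord_space p D'" if f: "f \<in> coord_space p D''" for f
      unfolding sm unfolding coord_space_def
    proof (intro CollectI conjI allI impI)
      show "p \<or> (\<forall>\<epsilon>>0. finite {x. \<epsilon> \<le> \<bar>?u f x\<bar>})"
      proof (rule disj_imp[THEN iffD2], intro allI impI)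
        fix \<epsilon> :: real assume "\<not> p" "\<epsilon> > 0"
        then have "finite {x. \<epsilon> \<le> \<bar>f x\<bar>}" using f by (auto simp: coord_space_def)
        then have "finite (\<tau> ` {x. \<epsilon> \<le> \<bar>f x\<bar>})" by simp
        moreover have "{x. \<epsilon> \<le> \<bar>?u f x\<bar>} \<subseteq> \<tau> ` {x. \<epsilon> \<le> \<bar>f x\<bar>}"
        proof
          fix y assume "y \<in> {x. \<epsilon> \<le> \<bar>?u f x\<bar>}"
          then have "y \<in> D <+> D'" "\<epsilon> \<le> \<bar>f (\<sigma> y)\<bar>" using \<open>\<epsilon> > 0\<close> by (auto split: if_splits)
          then show "y \<in> \<tau> ` {x. \<epsilon> \<le> \<bar>f x\<bar>}" using ts[of y] by (intro image_eqI[of _ _ "\<sigma> y"]) auto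
        qed
        ultimately show "finite {x. \<epsilon> \<le> \<bar>?u f x\<bar>}" by (rule rev_finite_subset)
      qed
    qed auto
    show "?v h \<in> coord_space p D''" if "h \<in> coord_space p D \<oplus> coord_space p D'" for h
      unfolding coord_space_def
    proof (intro CollectI conjI allI impI)
      show "p \<or> (\<forall>\<epsilon>>0. finite {x. \<epsilon> \<le> \<bar>?v h x\<bar>})"
      proof (rule disj_imp[THEN iffD2], intro allI impI)
        fix \<epsilon> :: real assume "\<not> p" "\<epsilon> > 0"
        then have "finite {x. \<epsilon> \<le> \<bar>h x\<bar>}" using that[unfolded sm] by (auto simp: coord_space_def)
        then have "finite (\<sigma> ` {x. \<epsilon> \<le> \<bar>h x\<bar>})" by simp
        moreover have "{x. \<epsilon> \<le> \<bar>?v h x\<bar>} \<subseteq> \<sigma> ` {x. \<epsilon> \<le> \<bar>h x\<bar>}"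
        proof
          fix y assume "y \<in> {x. \<epsilon> \<le> \<bar>?v h x\<bar>}"
          then have "y \<in> D''" "\<epsilon> \<le> \<bar>h (\<tau> y)\<bar>" using \<open>\<epsilon> > 0\<close> by (auto split: if_splits)
          then show "y \<in> \<sigma> ` {x. \<epsilon> \<le> \<bar>h x\<bar>}" using st[of y] by (intro image_eqI[of _ _ "\<tau> y"]) auto
        qed
        ultimately show "finite {x. \<epsilon> \<le> \<bar>?v h x\<bar>}" by (rule rev_finite_subset)
      qed
    qed auto
    show "?v (?u f) = f" if "f \<in> coord_space p D''" for f
      using st that by (auto simp: fun_eq_iff coord_space_def)
    show "?u (?v h) = h" if "h \<in> coord_space p D \<oplus> coord_space p D'" for h
      using ts that[unfolded sm] by (auto simp: fun_eq_iff coord_space_def)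
    show "(\<exists>i. \<forall>f\<in>coord_space p D''. ?u f j = f i) \<or> (\<forall>f\<in>coord_space p D''. ?u f j = 0)" for j
      by auto
    show "(\<exists>j. \<forall>h\<in>coord_space p D \<oplus> coord_space p D'. ?v h i = h j) \<or>
        (\<forall>h\<in>coord_space p D \<oplus> coord_space p D'. ?v h i = 0)" for i
      by auto
  qed
qed

lemma coord_space_finite: "finite D \<Longrightarrow> coord_space p D = coord_space True D"
proof -
  assume "finite D"
  then have "finite {x. \<epsilon> \<le> \<bar>f x\<bar>}" if "\<epsilon> > 0" "\<forall>x. x \<notin> D \<longrightarrow> f x = 0" for \<epsilon> :: real and f :: "'a \<Rightarrow> real"
    by (rule rev_finite_subset) (use that in force)
  then show ?thesis by (auto simp: coord_space_def)
qed

lemma squarable_coord_space: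
  assumes "infinite D" shows "squarable (coord_space p D)"
proof -
  have "\<exists>\<sigma>. bij_betw \<sigma> (D <+> D) D"
    unfolding card_of_ordIso using assms by (intro card_of_Plus_infinite1 card_of_mono1 order_refl)
  then show ?thesis unfolding squarable_def by (blast intro: coord_space_dsum)
qed

lemma coord_space_absorbs_finite:
  assumes "infinite D" "finite F" shows "coord_space p D \<simeq> coord_space True F \<oplus> coord_space p D"
proof -
  have "\<exists>\<sigma>. bij_betw \<sigma> (F <+> D) D"
    unfolding card_of_ordIso using assms
    by (intro card_of_Plus_infinite2 ordLess_imp_ordLeq finite_ordLess_infinite card_of_Well_order)
      (simp_all add: Field_card_of)
  then have "coord_space p D \<simeq> coord_space p F \<oplus> coord_space p D" by (blast intro: coord_space_dsum)
  with coord_space_finite[OF assms(2), of p] show ?thesis by simp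
qed

section \<open>A family of homeomorphisms of the line\<close>

text \<open>
  For \<open>a \<ge> 0\<close> this is an increasing piecewise linear homeomorphism of the line that sends \<open>a\<close> to 0. It is
  the identity for \<open>b \<le> - a\<close>, has slope \<open>1 / 2\<close> up to \<open>a\<close> and then slope \<open>L\<close>, until it catches up with
  the identity again. It never exceeds \<open>max a \<bar>b\<bar>\<close> in absolute value; and it differs from \<open>b\<close> only where
  \<open>\<bar>b\<bar> \<le> L / (L - 1) * a\<close>, so that no more than this factor is lost.
\<close>

definition half_shear :: "real \<Rightarrow> real \<Rightarrow> real \<Rightarrow> real" where
  "half_shear L a b = min b (max ((b - a) / 2) (L * (b - a)))"

text \<open>
  The inverse of \<open>half_shear L a\<close>: the inverses of the three linear pieces, with minimum and maximum
  exchanged.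
\<close>

definition half_unshear :: "real \<Rightarrow> real \<Rightarrow> real \<Rightarrow> real" where
  "half_unshear L a t = max t (min (2 * t + a) (t / L + a))"

text \<open>
  For \<open>a \<le> 0\<close> the homeomorphism is reflected. One of the two factors is always the identity, since
  \<open>half_shear L 0\<close> is; writing the case distinction as a composition makes the dependence on \<open>a\<close>
  visibly Lipschitz.
\<close>

definition shear :: "real \<Rightarrow> real \<Rightarrow> real \<Rightarrow> real" where
  "shear L a b = - half_shear L (- min a 0) (- half_shear L (max a 0) b)"

definition unshear :: "real \<Rightarrow> real \<Rightarrow> real \<Rightarrow> real" where
  "unshear L a t = half_unshear L (max a 0) (- half_unshear L (- min a 0) (- t))"

lemma half_shear_zero: "L > 1 \<Longrightarrow> half_shear L 0 b = b"
  using mult_right_mono[of 1 L b] mult_right_mono_neg[of 1 L b]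
  by (cases "b \<ge> 0") (auto simp: half_shear_def min_def max_def)

lemma half_unshear_half_shear:
  assumes L: "L > 1" and a: "a \<ge> 0"
  shows "half_unshear L a (half_shear L a b) = b"
proof -
  have d: "L * (b - a) / L = b - a" using L by simp
  consider "b \<le> - a" | "- a < b" "b < a" | "a \<le> b" "L * (b - a) \<le> b" | "a \<le> b" "b < L * (b - a)"
    by linarith
  then show ?thesis
  proof cases
    case 1
    then have "half_shear L a b = b" using a by (auto simp: half_shear_def min_def max_def)
    then show ?thesis using 1 by (auto simp: half_unshear_def)
  next
    case 2
    have "L * (b - a) \<le> 1 * (b - a)" using 2 L by (intro mult_right_mono_neg) auto
    then have *: "half_shear L a b = (b - a) / 2" using 2 by (auto simp: half_shear_def min_def max_def)
    define q where "q = (b - a) / 2 / L"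
    have "q \<ge> (b - a) / 2" using 2 L unfolding q_def
      using mult_right_mono_neg[of 1 L "(b - a) / 2"] by (simp add: le_divide_eq mult.commute)
    then show ?thesis using 2 unfolding half_unshear_def * q_def[symmetric] by (auto simp: min_def max_def field_simps)
  next
    case 3
    have q: "L * (b - a) \<ge> 1 * (b - a)" using 3 L by (intro mult_right_mono) auto
    then have *: "half_shear L a b = L * (b - a)" using 3 by (auto simp: half_shear_def min_def max_def)
    show ?thesis using 3 q unfolding half_unshear_def * d by (auto simp: min_def max_def)
  next
    case 4
    have q: "L * (b - a) \<ge> 1 * (b - a)" using 4 L by (intro mult_right_mono) auto
    then have *: "half_shear L a b = b" using 4 by (auto simp: half_shear_def min_def max_def)
    have "b / L \<le> b - a" using 4 L by (simp add: divide_le_eq mult.commute)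
    then show ?thesis unfolding half_unshear_def * by (auto simp: min_def max_def)
  qed
qed

lemma half_shear_half_unshear:
  assumes L: "L > 1" and a: "a \<ge> 0"
  shows "half_shear L a (half_unshear L a t) = t"
proof -
  have d: "L * (t / L) = t" using L by simp
  have r: "t \<ge> 0 \<Longrightarrow> t / L \<le> t" "t \<le> 0 \<Longrightarrow> t / L \<ge> t"
    using L by (auto simp: divide_le_eq le_divide_eq mult_le_cancel_left1 mult_le_cancel_left2)
  consider "t \<le> - a" | "- a < t" "t < 0" | "0 \<le> t" "t \<le> t / L + a" | "0 \<le> t" "t / L + a < t"
    by linarith
  then show ?thesis
  proof cases
    case 1
    then have "half_unshear L a t = t" using a by (auto simp: half_unshear_def min_def max_def)
    then show ?thesis using 1 a by (auto simp: half_shear_def min_def max_def)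
  next
    case 2
    then have *: "half_unshear L a t = 2 * t + a" using r by (auto simp: half_unshear_def min_def max_def)
    have "L * (2 * t) \<le> 1 * (2 * t)" using 2 L by (intro mult_right_mono_neg) auto
    then show ?thesis using 2 unfolding half_shear_def * by (auto simp: min_def max_def)
  next
    case 3
    then have *: "half_unshear L a t = t / L + a" using r by (auto simp: half_unshear_def min_def max_def)
    have "t / L \<ge> 0" using 3 L by simp
    then show ?thesis using 3 r L unfolding half_shear_def * by (auto simp: min_def max_def)
  next
    case 4
    then have *: "half_unshear L a t = t" using r by (auto simp: half_unshear_def min_def max_def)
    have "L * (t - a) \<ge> t" using 4 L by (simp add: field_simps)
    then show ?thesis unfolding half_shear_def * by (auto simp: min_def max_def)
  qed
qed

lemma half_shear_bound:
  assumes "L > 1" "a \<ge> 0" "\<bar>a\<bar> \<le> s" "\<bar>b\<bar> \<le> s"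
  shows "\<bar>half_shear L a b\<bar> \<le> s"
proof (cases "b \<ge> a")
  case True
  then have "L * (b - a) \<ge> 0" using assms by simp
  then show ?thesis using assms by (auto simp: half_shear_def min_def max_def)
next
  case False
  moreover have "L * (b - a) \<le> 1 * (b - a)"
    using False assms by (intro mult_right_mono_neg) auto
  ultimately show ?thesis using assms by (auto simp: half_shear_def min_def max_def field_simps abs_le_iff)
qed

lemma half_unshear_bound:
  assumes L: "L > 1" and a: "a \<ge> 0" and s: "\<bar>a\<bar> \<le> s" "\<bar>t\<bar> \<le> s"
  shows "\<bar>half_unshear L a t\<bar> \<le> L / (L - 1) * s"
proof -
  have s0: "0 \<le> s" using s(1) by linarith
  have c: "L / (L - 1) \<ge> 1" using L by simp
  then have cs: "s \<le> L / (L - 1) * s" using c s0 mult_right_mono[of 1 "L / (L - 1)" s] by simp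
  have r: "t \<ge> 0 \<Longrightarrow> t / L \<ge> 0" "t \<le> 0 \<Longrightarrow> t / L \<ge> t"
    using L by (auto simp: le_divide_eq mult_le_cancel_left1 mult_le_cancel_left2)
  consider "t < 0" | "0 \<le> t" "t \<le> t / L + a" | "0 \<le> t" "t / L + a < t" by linarith
  then have "half_unshear L a t \<le> L / (L - 1) * s"
  proof cases
    case 1
    then have "half_unshear L a t \<le> s" using s r by (auto simp: half_unshear_def min_def max_def)
    with cs show ?thesis by linarith
  next
    case 2
    have "t * (L - 1) \<le> a * L" using 2 L by (simp add: field_simps)
    then have "t \<le> L / (L - 1) * a" using L by (simp add: field_simps)
    then have "t / L \<le> a / (L - 1)" using L by (simp add: field_simps)
    then have "t / L + a \<le> L / (L - 1) * a" using L by (simp add: field_simps)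
    also have "\<dots> \<le> L / (L - 1) * s" using s L by (intro mult_left_mono) auto
    finally show ?thesis using 2 a r by (auto simp: half_unshear_def min_def max_def)
  next
    case 3
    then have "half_unshear L a t = t" by (auto simp: half_unshear_def min_def max_def)
    with cs s show ?thesis by linarith
  qed
  moreover have "half_unshear L a t \<ge> t" by (simp add: half_unshear_def)
  ultimately show ?thesis using cs s by linarith
qed

lemma unshear_shear: "L > 1 \<Longrightarrow> unshear L a (shear L a b) = b"
  by (simp add: shear_def unshear_def half_unshear_half_shear)

lemma shear_unshear: "L > 1 \<Longrightarrow> shear L a (unshear L a t) = t"
  by (simp add: shear_def unshear_def half_shear_half_unshear)

lemma half_shear_self: "a \<ge> 0 \<Longrightarrow> half_shear L a a = 0"
  by (simp add: half_shear_def)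

lemma shear_self: "L > 1 \<Longrightarrow> shear L a a = 0"
  by (cases "a \<ge> 0") (simp_all add: shear_def half_shear_self half_shear_zero max_def min_def)

lemma unshear_zero: "L > 1 \<Longrightarrow> unshear L a 0 = a"
  by (metis shear_self unshear_shear)

lemma shear_bound:
  assumes "L > 1" "\<bar>a\<bar> \<le> s" "\<bar>b\<bar> \<le> s"
  shows "\<bar>shear L a b\<bar> \<le> s"
  unfolding shear_def abs_minus_cancel
  using assms by (intro half_shear_bound) (auto intro!: half_shear_bound)

lemma unshear_bound:
  assumes L: "L > 1" and "\<bar>a\<bar> \<le> s" "\<bar>t\<bar> \<le> s"
  shows "\<bar>unshear L a t\<bar> \<le> L / (L - 1) * s"
proof (cases "a \<ge> 0")
  case True
  have "half_unshear L 0 (- t) = - t" by (metis L half_shear_zero half_unshear_half_shear order_refl)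
  then have "unshear L a t = half_unshear L a t" using True by (simp add: unshear_def min_def max_def)
  then show ?thesis using True assms half_unshear_bound by simp
next
  case False
  have "half_unshear L 0 x = x" for x by (metis L half_shear_zero half_unshear_half_shear order_refl)
  then have "unshear L a t = - half_unshear L (- a) (- t)" using False by (simp add: unshear_def min_def max_def)
  then show ?thesis using False assms half_unshear_bound[of L "- a" s "- t"] by simp
qed

lemma abs_min_max_diff_le:
  fixes x y :: real
  assumes "\<bar>x - x'\<bar> \<le> e" "\<bar>y - y'\<bar> \<le> e"
  shows "\<bar>min x y - min x' y'\<bar> \<le> e" "\<bar>max x y - max x' y'\<bar> \<le> e"
  using assms by (auto simp: min_def max_def abs_le_iff)

lemma half_shear_Lipschitz:
  assumes "L > 1"
  shows "\<bar>half_shear L a b - half_shear L a' b'\<bar> \<le> L * (\<bar>a - a'\<bar> + \<bar>b - b'\<bar>)"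
proof -
  define e where "e = \<bar>a - a'\<bar> + \<bar>b - b'\<bar>"
  have e: "e \<le> L * e" using assms by (simp add: e_def mult_le_cancel_right1)
  have "\<bar>L * (b - a) - L * (b' - a')\<bar> = L * \<bar>(b - a) - (b' - a')\<bar>"
    using assms by (simp add: abs_mult flip: right_diff_distrib)
  also have "\<dots> \<le> L * e" using assms by (intro mult_left_mono) (auto simp: e_def)
  finally have 1: "\<bar>L * (b - a) - L * (b' - a')\<bar> \<le> L * e" .
  have 2: "\<bar>(b - a) / 2 - (b' - a') / 2\<bar> \<le> L * e" "\<bar>b - b'\<bar> \<le> L * e"
    using e by (auto simp: e_def field_simps abs_if split: if_splits)
  show ?thesis unfolding half_shear_def e_def[symmetric]
    by (intro abs_min_max_diff_le 1 2)
qed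

lemma half_unshear_Lipschitz:
  assumes "L > 1"
  shows "\<bar>half_unshear L a t - half_unshear L a' t'\<bar> \<le> 2 * (\<bar>a - a'\<bar> + \<bar>t - t'\<bar>)"
proof -
  have "\<bar>t / L - t' / L\<bar> = \<bar>t - t'\<bar> / L"
    using assms by (simp add: abs_divide flip: diff_divide_distrib)
  also have "\<dots> \<le> \<bar>t - t'\<bar>" using assms by (simp add: divide_le_eq mult_le_cancel_left1)
  finally have "\<bar>t / L - t' / L\<bar> \<le> \<bar>t - t'\<bar>" .
  then show ?thesis unfolding half_unshear_def
    by (intro abs_min_max_diff_le) (auto simp: abs_if split: if_splits)
qed

lemma shear_Lipschitz:
  assumes "L > 1"
  shows "\<bar>shear L a b - shear L a' b'\<bar> \<le> L * (1 + L) * (\<bar>a - a'\<bar> + \<bar>b - b'\<bar>)"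
proof -
  let ?e = "\<bar>a - a'\<bar> + \<bar>b - b'\<bar>"
  have "\<bar>half_shear L (max a 0) b - half_shear L (max a' 0) b'\<bar> \<le> L * (\<bar>max a 0 - max a' 0\<bar> + \<bar>b - b'\<bar>)"
    by (rule half_shear_Lipschitz[OF assms])
  also have "\<dots> \<le> L * ?e" using assms by (intro mult_left_mono) (auto simp: max_def)
  finally have 1: "\<bar>half_shear L (max a 0) b - half_shear L (max a' 0) b'\<bar> \<le> L * ?e" .
  have neg: "\<bar>- x - - y\<bar> = \<bar>x - y\<bar>" for x y :: real by linarith
  have "\<bar>shear L a b - shear L a' b'\<bar> \<le> L * (\<bar>- min a 0 - - min a' 0\<bar> +
      \<bar>- half_shear L (max a 0) b - - half_shear L (max a' 0) b'\<bar>)"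
    unfolding shear_def neg[of "half_shear L _ (- half_shear L (max a 0) b)"]
    by (rule half_shear_Lipschitz[OF assms])
  also have "\<dots> \<le> L * (?e + L * ?e)"
    using assms 1 unfolding neg by (intro mult_left_mono add_mono) (auto simp: min_def)
  finally show ?thesis by (simp add: algebra_simps)
qed

lemma unshear_Lipschitz:
  assumes "L > 1"
  shows "\<bar>unshear L a t - unshear L a' t'\<bar> \<le> 6 * (\<bar>a - a'\<bar> + \<bar>t - t'\<bar>)"
proof -
  let ?e = "\<bar>a - a'\<bar> + \<bar>t - t'\<bar>"
  have "\<bar>half_unshear L (- min a 0) (- t) - half_unshear L (- min a' 0) (- t')\<bar>
      \<le> 2 * (\<bar>- min a 0 - - min a' 0\<bar> + \<bar>- t - - t'\<bar>)"
    by (rule half_unshear_Lipschitz[OF assms])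
  also have "\<dots> \<le> 2 * ?e" by (intro mult_left_mono) (auto simp: min_def)
  finally have 1: "\<bar>half_unshear L (- min a 0) (- t) - half_unshear L (- min a' 0) (- t')\<bar> \<le> 2 * ?e" .
  have neg: "\<bar>- x - - y\<bar> = \<bar>x - y\<bar>" for x y :: real by linarith
  have "\<bar>unshear L a t - unshear L a' t'\<bar> \<le> 2 * (\<bar>max a 0 - max a' 0\<bar> +
      \<bar>- half_unshear L (- min a 0) (- t) - - half_unshear L (- min a' 0) (- t')\<bar>)"
    unfolding unshear_def by (rule half_unshear_Lipschitz[OF assms])
  also have "\<dots> \<le> 2 * (?e + 2 * ?e)"
    using 1 unfolding neg by (intro mult_left_mono add_mono) (auto simp: max_def)
  finally show ?thesis by simp
qed

section \<open>Spaces of continuous functions on subspaces\<close>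

abbreviation Cp_on :: "'a topology \<Rightarrow> 'a set \<Rightarrow> ('a \<Rightarrow> real) set" where
  "Cp_on X S \<equiv> Cp (subtopology X S)"

definition Cp_vanishing :: "'a topology \<Rightarrow> 'a set \<Rightarrow> 'a set \<Rightarrow> ('a \<Rightarrow> real) set" where
  "Cp_vanishing X Z K = {f \<in> Cp_on X Z. \<forall>x\<in>K. f x = 0}"

lemma Cp_on_iff_continuous_map:
  "S \<subseteq> topspace X \<Longrightarrow> f \<in> Cp_on X S \<longleftrightarrow>
     (\<forall>x. x \<notin> S \<longrightarrow> f x = 0) \<and> continuous_map (subtopology X S) euclideanreal f"
  by (auto simp: Cp_def inf.absorb2)

lemma Cp_on_iff:
  assumes "S \<subseteq> topspace X"
  shows "f \<in> Cp_on X S \<longleftrightarrow> (\<forall>x. x \<notin> S \<longrightarrow> f x = 0) \<and>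
     (\<forall>a\<in>S. \<forall>\<epsilon>>0. \<exists>U. openin X U \<and> a \<in> U \<and> (\<forall>x\<in>U \<inter> S. \<bar>f x - f a\<bar> < \<epsilon>))"
proof -
  have "continuous_map (subtopology X S) euclideanreal f \<longleftrightarrow>
     (\<forall>a\<in>S. \<forall>\<epsilon>>0. \<exists>U. openin (subtopology X S) U \<and> a \<in> U \<and> (\<forall>x\<in>U. \<bar>f a - f x\<bar> < \<epsilon>))"
    using Met_TC.continuous_map_to_metric[of "subtopology X S" f] assms
    by (simp add: dist_real_def inf.absorb2)
  also have "\<dots> \<longleftrightarrow> (\<forall>a\<in>S. \<forall>\<epsilon>>0. \<exists>U. openin X U \<and> a \<in> U \<and> (\<forall>x\<in>U \<inter> S. \<bar>f x - f a\<bar> < \<epsilon>))"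
    by (intro ball_cong all_cong refl imp_cong)
       (auto simp: openin_subtopology abs_minus_commute; blast)
  finally show ?thesis using Cp_on_iff_continuous_map[OF assms] by blast
qed

text \<open>
  Continuity of \<open>shear\<close> and \<open>unshear\<close> along two continuous functions follows from their joint continuity.
\<close>

lemma continuous_map_compose2_real:
  assumes "continuous_on UNIV (\<lambda>p::real \<times> real. h (fst p) (snd p))"
    and "continuous_map X euclideanreal f" "continuous_map X euclideanreal g"
  shows "continuous_map X euclideanreal (\<lambda>x. h (f x) (g x) :: real)"
proof -
  have "continuous_map X (prod_topology euclideanreal euclideanreal) (\<lambda>x. (f x, g x))"
    using assms(2,3) unfolding continuous_map_paired by blast
  then have "continuous_map X euclidean (\<lambda>x. (f x, g x))" by simp
  from continuous_map_compose[OF this, of euclideanreal "\<lambda>p. h (fst p) (snd p)"] assms(1)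
  show ?thesis by (simp add: comp_def)
qed

lemma continuous_shear: "continuous_on UNIV (\<lambda>p::real \<times> real. shear L (fst p) (snd p))"
  unfolding shear_def half_shear_def by (intro continuous_intros) auto

lemma continuous_unshear: "continuous_on UNIV (\<lambda>p::real \<times> real. unshear L (fst p) (snd p))"
  unfolding unshear_def half_unshear_def divide_inverse by (intro continuous_intros)

lemma two_point_Lipschitz:
  fixes f g :: "'i \<Rightarrow> real"
  assumes "\<bar>s - t\<bar> \<le> C * (\<bar>f i - g i\<bar> + \<bar>f j - g j\<bar>)" "C \<ge> 0"
  shows "\<bar>s - t\<bar> \<le> (2 * C) * (\<Sum>k\<in>{i,j}. \<bar>f k - g k\<bar>)"
proof -
  have "\<bar>f i - g i\<bar> + \<bar>f j - g j\<bar> \<le> 2 * (\<Sum>k\<in>{i,j}. \<bar>f k - g k\<bar>)" by (cases "i = j") auto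
  then have "C * (\<bar>f i - g i\<bar> + \<bar>f j - g j\<bar>) \<le> C * (2 * (\<Sum>k\<in>{i,j}. \<bar>f k - g k\<bar>))"
    by (rule mult_left_mono) fact
  with assms(1) show ?thesis by simp
qed

text \<open>
  The second component stores the value at \<open>x\<close> relative to the value at the retracted point. The value
  at \<open>x\<close> is recovered by the inverse of the shear, since the value at \<open>r x\<close> is known from the first
  component. Both directions depend on two coordinates at a time.
\<close>

lemma Cp_on_retract_decomposition:
  assumes r: "continuous_map X X r" "\<And>x. x \<in> topspace X \<Longrightarrow> r x \<in> K" "\<And>x. x \<in> K \<Longrightarrow> r x = x"
    and Z: "Z \<subseteq> topspace X" and K: "K \<subseteq> Z"
  shows "Cp_on X Z \<simeq> Cp_on X K \<oplus> Cp_vanishing X Z K"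
  unfolding similar_def
proof (intro allI impI)
  fix c :: real assume c: "c > 1"
  (* With this choice the distortion L / (L - 1) of the inverse of the shear is c. *)
  define L where "L = c / (c - 1)"
  have L: "L > 1" "L / (L - 1) = c" using c by (auto simp: L_def field_simps)
  let ?u = "\<lambda>f. case_sum (\<lambda>x. if x \<in> K then f x else 0) (\<lambda>x. if x \<in> Z then shear L (f (r x)) (f x) else 0)"
  let ?v = "\<lambda>h x. if x \<in> Z then unshear L (h (Inl (r x))) (h (Inr x)) else 0"
  have KX: "K \<subseteq> topspace X" using K Z by auto
  have rZ: "continuous_map (subtopology X Z) (subtopology X K) r"
    using r Z by (auto simp: continuous_map_in_subtopology continuous_map_from_subtopology)
  have cm_if: "continuous_map (subtopology X S) euclideanreal (\<lambda>x. if x \<in> S then g x else 0)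
      \<longleftrightarrow> continuous_map (subtopology X S) euclideanreal g" for S g
    by (auto elim!: continuous_map_eq)
  have uE: "?u f \<in> Cp_on X K \<oplus> Cp_vanishing X Z K" if f: "f \<in> Cp_on X Z" for f
  proof -
    have cf: "continuous_map (subtopology X Z) euclideanreal f"
      using f Z by (simp add: Cp_on_iff_continuous_map)
    then have cK: "continuous_map (subtopology X K) euclideanreal f"
      using K by (metis continuous_map_from_subtopology subtopology_subtopology inf.absorb2)
    have "continuous_map (subtopology X Z) euclideanreal (\<lambda>x. f (r x))"
      using continuous_map_compose[OF rZ cK] by (simp add: comp_def)
    then have "continuous_map (subtopology X Z) euclideanreal (\<lambda>x. shear L (f (r x)) (f x))"
      using cf by (rule continuous_map_compose2_real[OF continuous_shear])
    then show ?thesis using cK KX Z K r(3) L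
      by (auto simp: dsum_def comp_def Cp_vanishing_def Cp_on_iff_continuous_map cm_if shear_self)
  qed
  have vE: "?v h \<in> Cp_on X Z" if h: "h \<in> Cp_on X K \<oplus> Cp_vanishing X Z K" for h
  proof -
    have cK: "continuous_map (subtopology X K) euclideanreal (h \<circ> Inl)"
      and cZ: "continuous_map (subtopology X Z) euclideanreal (h \<circ> Inr)"
      using h KX Z by (auto simp: dsum_def Cp_vanishing_def Cp_on_iff_continuous_map)
    have "continuous_map (subtopology X Z) euclideanreal (\<lambda>x. h (Inl (r x)))"
      using continuous_map_compose[OF rZ cK] by (simp add: comp_def)
    then have "continuous_map (subtopology X Z) euclideanreal (\<lambda>x. unshear L (h (Inl (r x))) (h (Inr x)))"
      using cZ by (intro continuous_map_compose2_real[OF continuous_unshear]) (auto simp: comp_def)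
    then show ?thesis using Z by (simp add: Cp_on_iff_continuous_map cm_if)
  qed
  show "\<exists>u v. tame_pair c (Cp_on X Z) (Cp_on X K \<oplus> Cp_vanishing X Z K) u v"
    unfolding tame_pair_def
  proof (intro exI conjI ballI)
    show "tame c (Cp_on X Z) (Cp_on X K \<oplus> Cp_vanishing X Z K) ?u"
      unfolding tame_def
    proof (intro conjI)
      show "coord_unif_cont (Cp_on X Z) ?u"
      proof (rule coord_unif_cont_Lipschitz)
        fix j :: "'a + 'a"
        show "\<exists>I C. finite I \<and> (\<forall>f\<in>Cp_on X Z. \<forall>g\<in>Cp_on X Z. \<bar>?u f j - ?u g j\<bar> \<le> C * (\<Sum>i\<in>I. \<bar>f i - g i\<bar>))"
        proof (cases j)
          case (Inl x)
          then show ?thesis by (intro exI[of _ "{x}"] exI[of _ 1]) auto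
        next
          case (Inr x)
          have "\<bar>?u f j - ?u g j\<bar> \<le> (2 * (L * (1 + L))) * (\<Sum>i\<in>{r x, x}. \<bar>f i - g i\<bar>)" for f g
            by (rule two_point_Lipschitz)
               (use shear_Lipschitz[OF L(1)] L(1) in \<open>auto simp: Inr\<close>)
          then show ?thesis
            by (intro exI[of _ "{r x, x}"] exI[of _ "2 * (L * (1 + L))"] conjI ballI) blast+
        qed
      qed
      show "sup_bound c (Cp_on X Z) ?u"
        unfolding sup_bound_def
      proof (intro ballI allI impI)
        fix f :: "'a \<Rightarrow> real" and s j assume s: "\<forall>i. \<bar>f i\<bar> \<le> s"
        then have s0: "0 \<le> s" by (meson abs_ge_zero order_trans)
        then have "s \<le> c * s" using c by (simp add: mult_le_cancel_right1)
        moreover have "\<bar>?u f j\<bar> \<le> s" using s s0 shear_bound[OF L(1)] by (cases j) auto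
        ultimately show "\<bar>?u f j\<bar> \<le> c * s" by linarith
      qed
    qed (use uE in auto)
    show "tame c (Cp_on X K \<oplus> Cp_vanishing X Z K) (Cp_on X Z) ?v"
      unfolding tame_def
    proof (intro conjI)
      show "coord_unif_cont (Cp_on X K \<oplus> Cp_vanishing X Z K) ?v"
      proof (rule coord_unif_cont_Lipschitz)
        fix x
        have "\<bar>?v f x - ?v g x\<bar> \<le> (2 * 6) * (\<Sum>i\<in>{Inl (r x), Inr x}. \<bar>f i - g i\<bar>)" for f g
          by (rule two_point_Lipschitz) (use unshear_Lipschitz[OF L(1)] in auto)
        then show "\<exists>I C. finite I \<and> (\<forall>f\<in>Cp_on X K \<oplus> Cp_vanishing X Z K. \<forall>g\<in>Cp_on X K \<oplus> Cp_vanishing X Z K.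
            \<bar>?v f x - ?v g x\<bar> \<le> C * (\<Sum>i\<in>I. \<bar>f i - g i\<bar>))"
          by (intro exI[of _ "{Inl (r x), Inr x}"] exI[of _ "2 * 6"] conjI ballI) blast+
      qed
      show "sup_bound c (Cp_on X K \<oplus> Cp_vanishing X Z K) ?v"
        unfolding sup_bound_def
      proof (intro ballI allI impI)
        fix h :: "'a + 'a \<Rightarrow> real" and s x assume s: "\<forall>i. \<bar>h i\<bar> \<le> s"
        then have s0: "0 \<le> s" by (meson abs_ge_zero order_trans)
        then show "\<bar>?v h x\<bar> \<le> c * s" using s c unshear_bound[OF L(1), of _ s] by (auto simp: L(2))
      qed
    qed (use vE in auto)
    show "?v (?u f) = f" if "f \<in> Cp_on X Z" for f
      using that Z r K L by (auto simp: fun_eq_iff unshear_shear Cp_on_iff)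
    show "?u (?v h) = h" if h: "h \<in> Cp_on X K \<oplus> Cp_vanishing X Z K" for h
    proof
      fix j
      have z: "\<And>x. x \<notin> K \<Longrightarrow> h (Inl x) = 0" "\<And>x. x \<notin> Z \<Longrightarrow> h (Inr x) = 0" "\<And>x. x \<in> K \<Longrightarrow> h (Inr x) = 0"
        using h KX Z by (auto simp: dsum_def Cp_vanishing_def Cp_on_iff)
      have k: "?v h (r x) = h (Inl (r x))" if "x \<in> Z" for x
        using that r Z K z(3) L by (auto simp: unshear_zero)
      show "?u (?v h) j = h j"
      proof (cases j)
        case (Inl x)
        then show ?thesis using z K r(3) L by (auto simp: unshear_zero)
      next
        case (Inr x)
        then show ?thesis using k z L by (auto simp: shear_unshear)
      qed
    qed
  qed
qed

lemma Cp_on_zero: "f \<in> Cp_on X S \<Longrightarrow> S \<subseteq> topspace X \<Longrightarrow> x \<notin> S \<Longrightarrow> f x = 0"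
  by (simp add: Cp_on_iff)

lemma Cp_on_restrict:
  assumes "f \<in> Cp_on X S" "T \<subseteq> S" "S \<subseteq> topspace X"
  shows "(\<lambda>x. if x \<in> T then f x else 0) \<in> Cp_on X T"
proof -
  have "T \<subseteq> topspace X" using assms by auto
  moreover have "\<exists>U. openin X U \<and> a \<in> U \<and> (\<forall>x\<in>U \<inter> T. \<bar>f x - f a\<bar> < \<epsilon>)" if a: "a \<in> T" "\<epsilon> > 0" for a \<epsilon>
  proof -
    have "a \<in> S" using a assms by auto
    then obtain U where "openin X U" "a \<in> U" "\<forall>x\<in>U \<inter> S. \<bar>f x - f a\<bar> < \<epsilon>"
      using assms(1) a(2) unfolding Cp_on_iff[OF assms(3)] by blast
    then have "\<forall>x\<in>U \<inter> T. \<bar>f x - f a\<bar> < \<epsilon>" using assms(2) by blast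
    then show ?thesis using \<open>openin X U\<close> \<open>a \<in> U\<close> by blast
  qed
  ultimately show ?thesis by (simp add: Cp_on_iff)
qed

text \<open>
  The open sets \<open>U\<close> and \<open>V\<close> witness that both parts are open in the union.
\<close>

lemma Cp_on_disjoint_union:
  assumes ST: "S \<union> T \<subseteq> topspace X" and disj: "S \<inter> T = {}"
    and S: "openin X U" "U \<inter> (S \<union> T) = S" and T: "openin X V" "V \<inter> (S \<union> T) = T"
  shows "Cp_on X (S \<union> T) \<simeq> Cp_on X S \<oplus> Cp_on X T"
proof -
  let ?u = "\<lambda>f. case_sum (\<lambda>x. if x \<in> S then f x else 0) (\<lambda>x. if x \<in> T then f x else 0)"
  let ?v = "\<lambda>h x. if x \<in> S then h (Inl x) else if x \<in> T then h (Inr x) else 0"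
  have sub: "S \<subseteq> topspace X" "T \<subseteq> topspace X" using ST by auto
  show ?thesis
  proof (rule similar_select[of _ ?u _ ?v])
    show "?u f \<in> Cp_on X S \<oplus> Cp_on X T" if "f \<in> Cp_on X (S \<union> T)" for f
      using Cp_on_restrict[OF that _ ST, of S] Cp_on_restrict[OF that _ ST, of T]
      by (auto simp: dsum_def comp_def)
    show "?v h \<in> Cp_on X (S \<union> T)" if h: "h \<in> Cp_on X S \<oplus> Cp_on X T" for h
      unfolding Cp_on_iff[OF ST]
    proof (intro conjI allI impI ballI)
      fix a and \<epsilon> :: real assume a: "a \<in> S \<union> T" and \<epsilon>: "\<epsilon> > 0"
      have hS: "h \<circ> Inl \<in> Cp_on X S" and hT: "h \<circ> Inr \<in> Cp_on X T" using h by (auto simp: dsum_def)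
      show "\<exists>W. openin X W \<and> a \<in> W \<and> (\<forall>x\<in>W \<inter> (S \<union> T). \<bar>?v h x - ?v h a\<bar> < \<epsilon>)"
      proof (cases "a \<in> S")
        case True
        then obtain W where "openin X W" "a \<in> W" "\<forall>x\<in>W \<inter> S. \<bar>(h \<circ> Inl) x - (h \<circ> Inl) a\<bar> < \<epsilon>"
          using hS \<epsilon> unfolding Cp_on_iff[OF sub(1)] by blast
        then show ?thesis using S True by (intro exI[of _ "U \<inter> W"]) auto
      next
        case False
        then have aT: "a \<in> T" using a by auto
        then obtain W where "openin X W" "a \<in> W" "\<forall>x\<in>W \<inter> T. \<bar>(h \<circ> Inr) x - (h \<circ> Inr) a\<bar> < \<epsilon>"
          using hT \<epsilon> unfolding Cp_on_iff[OF sub(2)] by blast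
        then show ?thesis using T aT disj by (intro exI[of _ "V \<inter> W"]) auto
      qed
    qed auto
    show "?v (?u f) = f" if "f \<in> Cp_on X (S \<union> T)" for f
      using Cp_on_zero[OF that ST] by auto
    show "?u (?v h) = h" if "h \<in> Cp_on X S \<oplus> Cp_on X T" for h
    proof -
      have "h \<circ> Inl \<in> Cp_on X S" "h \<circ> Inr \<in> Cp_on X T" using that by (auto simp: dsum_def)
      then have "\<And>x. x \<notin> S \<Longrightarrow> h (Inl x) = 0" "\<And>x. x \<notin> T \<Longrightarrow> h (Inr x) = 0"
        using Cp_on_zero sub by fastforce+
      then show ?thesis using disj by (auto simp: fun_eq_iff split: sum.split)
    qed
    show "(\<exists>i. \<forall>f\<in>Cp_on X (S \<union> T). ?u f j = f i) \<or> (\<forall>f\<in>Cp_on X (S \<union> T). ?u f j = 0)" for j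
      by (cases j) auto
    show "(\<exists>j. \<forall>h\<in>Cp_on X S \<oplus> Cp_on X T. ?v h i = h j) \<or> (\<forall>h\<in>Cp_on X S \<oplus> Cp_on X T. ?v h i = 0)" for i
      by auto
  qed
qed

lemma Cp_on_homeomorphic:
  assumes P: "P \<subseteq> topspace X" and Q: "Q \<subseteq> topspace X"
    and hk: "homeomorphic_maps (subtopology X P) (subtopology X Q) h k"
  shows "Cp_on X P \<simeq> Cp_on X Q"
proof -
  have ts: "topspace (subtopology X P) = P" "topspace (subtopology X Q) = Q" using P Q by auto
  have hk': "continuous_map (subtopology X P) (subtopology X Q) h" "continuous_map (subtopology X Q) (subtopology X P) k"
    "\<And>x. x \<in> P \<Longrightarrow> k (h x) = x" "\<And>y. y \<in> Q \<Longrightarrow> h (k y) = y"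
    using hk ts by (auto simp: homeomorphic_maps_def)
  have im: "\<And>x. x \<in> P \<Longrightarrow> h x \<in> Q" "\<And>y. y \<in> Q \<Longrightarrow> k y \<in> P"
    using hk'(1,2) ts by (auto simp: continuous_map_def Pi_iff)
  have mv: "(\<lambda>y. if y \<in> B then f (m y) else 0) \<in> Cp_on X B"
    if "f \<in> Cp_on X A" "continuous_map (subtopology X B) (subtopology X A) m" "A \<subseteq> topspace X" "B \<subseteq> topspace X"
    for f A B m
  proof -
    have "continuous_map (subtopology X A) euclideanreal f"
      using that by (simp add: Cp_on_iff_continuous_map)
    then have "continuous_map (subtopology X B) euclideanreal (f \<circ> m)"
      using that(2) continuous_map_compose by blast
    then have "continuous_map (subtopology X B) euclideanreal (\<lambda>y. if y \<in> B then f (m y) else 0)"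
      by (rule continuous_map_eq) auto
    then show ?thesis using that by (simp add: Cp_on_iff_continuous_map)
  qed
  show ?thesis
  proof (rule similar_select[of _ "\<lambda>f y. if y \<in> Q then f (k y) else 0" _ "\<lambda>g x. if x \<in> P then g (h x) else 0"])
    show "(\<lambda>y. if y \<in> Q then f (k y) else 0) \<in> Cp_on X Q" if "f \<in> Cp_on X P" for f
      using mv[OF that hk'(2) P Q] .
    show "(\<lambda>x. if x \<in> P then g (h x) else 0) \<in> Cp_on X P" if "g \<in> Cp_on X Q" for g
      using mv[OF that hk'(1) Q P] .
  qed (use hk' im Cp_on_zero P Q in \<open>auto simp: fun_eq_iff\<close>)
qed

lemma Cp_on_discrete:
  assumes D: "D \<subseteq> topspace X" and iso: "\<And>x. x \<in> D \<Longrightarrow> \<exists>U. openin X U \<and> U \<inter> D = {x}"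
  shows "Cp_on X D = coord_space True D"
proof -
  have "\<exists>U. openin X U \<and> a \<in> U \<and> (\<forall>x\<in>U \<inter> D. \<bar>f x - f a\<bar> < \<epsilon>)" if "a \<in> D" "\<epsilon> > 0" for a \<epsilon> and f :: "'a \<Rightarrow> real"
    using iso[OF that(1)] that by force
  then show ?thesis by (auto simp: Cp_on_iff[OF D] coord_space_def)
qed

text \<open>
  A function vanishing on \<open>B\<close> is small on a neighbourhood of \<open>B\<close>, hence at all but finitely many points
  of \<open>D\<close>. Conversely, in a T1 space removing finitely many points of \<open>D\<close> leaves a neighbourhood of
  every point of \<open>B\<close>.
\<close>

lemma Cp_vanishing_null_sequence:
  assumes S: "S \<subseteq> topspace X" "S = B \<union> D" "B \<inter> D = {}" and T1: "t1_space X"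
    and iso: "\<And>x. x \<in> D \<Longrightarrow> \<exists>U. openin X U \<and> U \<inter> S = {x}"
    and cofin: "\<And>U. openin X U \<Longrightarrow> B \<subseteq> U \<Longrightarrow> finite (D - U)"
  shows "Cp_vanishing X S B = coord_space False D"
proof (intro set_eqI iffI)
  fix f assume "f \<in> Cp_vanishing X S B"
  then have f: "f \<in> Cp_on X S" "\<And>x. x \<in> B \<Longrightarrow> f x = 0" by (auto simp: Cp_vanishing_def)
  show "f \<in> coord_space False D"
    unfolding coord_space_def
  proof (intro CollectI conjI allI impI disjI2)
    show "f x = 0" if "x \<notin> D" for x using that f(2) Cp_on_zero[OF f(1) S(1)] S(2) by blast
    fix \<epsilon> :: real assume \<epsilon>: "\<epsilon> > 0"
    have "\<forall>a\<in>B. \<exists>U. openin X U \<and> a \<in> U \<and> (\<forall>x\<in>U \<inter> S. \<bar>f x - f a\<bar> < \<epsilon>)"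
      using f(1) \<epsilon> S(2) unfolding Cp_on_iff[OF S(1)] by blast
    then obtain U where U: "\<And>a. a \<in> B \<Longrightarrow> openin X (U a) \<and> a \<in> U a \<and> (\<forall>x\<in>U a \<inter> S. \<bar>f x - f a\<bar> < \<epsilon>)" by metis
    have "finite (D - (\<Union>a\<in>B. U a))" using U by (intro cofin) auto
    moreover have "{x. \<epsilon> \<le> \<bar>f x\<bar>} \<subseteq> D - (\<Union>a\<in>B. U a)"
    proof
      fix x assume x: "x \<in> {x. \<epsilon> \<le> \<bar>f x\<bar>}"
      then have xS: "x \<in> S" using Cp_on_zero[OF f(1) S(1), of x] \<epsilon> by (cases "x \<in> S") auto
      have "x \<notin> U a" if "a \<in> B" for a
        using U[OF that] x xS f(2)[OF that] by (metis IntI diff_zero mem_Collect_eq not_le)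
      moreover have "x \<notin> B" using x f(2)[of x] \<epsilon> by auto
      ultimately show "x \<in> D - (\<Union>a\<in>B. U a)" using xS S(2) by blast
    qed
    ultimately show "finite {x. \<epsilon> \<le> \<bar>f x\<bar>}" by (rule rev_finite_subset)
  qed
next
  fix f assume f: "f \<in> coord_space False D"
  have "f \<in> Cp_on X S"
    unfolding Cp_on_iff[OF S(1)]
  proof (intro conjI allI impI ballI)
    show "f x = 0" if "x \<notin> S" for x using f that S by (auto simp: coord_space_def)
    fix a and \<epsilon> :: real assume a: "a \<in> S" and \<epsilon>: "\<epsilon> > 0"
    show "\<exists>U. openin X U \<and> a \<in> U \<and> (\<forall>x\<in>U \<inter> S. \<bar>f x - f a\<bar> < \<epsilon>)"
    proof (cases "a \<in> D")
      case True
      then show ?thesis using iso[OF True] \<epsilon> by force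
    next
      case False
      then have "f a = 0" using f by (auto simp: coord_space_def)
      have fin: "finite {x. \<epsilon> \<le> \<bar>f x\<bar>}" using f \<epsilon> by (auto simp: coord_space_def)
      then have "finite ({x. \<epsilon> \<le> \<bar>f x\<bar>} \<inter> topspace X)" by auto
      then have "closedin X ({x. \<epsilon> \<le> \<bar>f x\<bar>} \<inter> topspace X)" using T1 unfolding t1_space_closedin_finite by blast
      then have "openin X (topspace X - {x. \<epsilon> \<le> \<bar>f x\<bar>} \<inter> topspace X)" by blast
      moreover have "a \<in> topspace X - {x. \<epsilon> \<le> \<bar>f x\<bar>} \<inter> topspace X" using a S(1) \<open>f a = 0\<close> \<epsilon> by auto
      ultimately show ?thesis using \<open>f a = 0\<close>
        by (intro exI[of _ "topspace X - {x. \<epsilon> \<le> \<bar>f x\<bar>} \<inter> topspace X"]) auto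
    qed
  qed
  then show "f \<in> Cp_vanishing X S B" using f S(3) by (auto simp: Cp_vanishing_def coord_space_def)
qed

text \<open>
  The functions vanishing on \<open>K\<close> form a block space. For each \<open>a \<in> K\<close> the relevant filter on the pieces
  is generated by the sets of those pieces that meet a given neighbourhood of \<open>a\<close>. Because the pieces
  shrink to \<open>K\<close>, continuity at \<open>a\<close> is decay along this filter.
\<close>

lemma squarable_Cp_vanishing:
  assumes Z: "Z \<subseteq> topspace X" "K \<subseteq> Z" and disj: "disjoint \<U>" and un: "\<Union>\<U> = Z - K"
    and op: "\<And>U. U \<in> \<U> \<Longrightarrow> openin X U"
    and shrink: "\<And>G a. openin X G \<Longrightarrow> K \<subseteq> G \<Longrightarrow> a \<in> K \<Longrightarrow>
        \<exists>N. openin X N \<and> a \<in> N \<and> (\<forall>U\<in>\<U>. U \<inter> N \<noteq> {} \<longrightarrow> U \<subseteq> G)"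
    and sq: "\<And>U. U \<in> \<U> \<Longrightarrow> squarable (Cp_on X U)"
  shows "squarable (Cp_vanishing X Z K)"
proof -
  define l where "l x = (if \<exists>U\<in>\<U>. x \<in> U then Some (THE U. U \<in> \<U> \<and> x \<in> U) else None)" for x
  have l: "l x = Some U \<longleftrightarrow> U \<in> \<U> \<and> x \<in> U" for x U
  proof -
    have "\<And>V. V \<in> \<U> \<Longrightarrow> x \<in> V \<Longrightarrow> (THE U. U \<in> \<U> \<and> x \<in> U) = V"
      using disj by (intro the_equality) (auto simp: pairwise_def disjnt_def)
    then show ?thesis unfolding l_def by auto
  qed
  have lN: "l x = None \<longleftrightarrow> x \<notin> Z - K" for x unfolding un[symmetric] l_def by auto
  define \<Phi> where "\<Phi> a = {\<V>. \<exists>N. openin X N \<and> a \<in> N \<and> {U \<in> \<U>. U \<inter> N \<noteq> {}} \<subseteq> \<V>}" for a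
  have rt: "restrict_to l U f = (\<lambda>x. if x \<in> U then f x else 0)" if "U \<in> \<U>" for U f
    using that by (auto simp: restrict_to_def l)
  have UX: "U \<subseteq> topspace X" "U \<subseteq> Z" if "U \<in> \<U>" for U using that op openin_subset un by auto
  have "Cp_vanishing X Z K = block_space \<U> (\<Phi> ` K) l (Cp_on X)"
  proof (intro set_eqI iffI)
    fix f assume "f \<in> Cp_vanishing X Z K"
    then have f: "f \<in> Cp_on X Z" "\<And>x. x \<in> K \<Longrightarrow> f x = 0" by (auto simp: Cp_vanishing_def)
    show "f \<in> block_space \<U> (\<Phi> ` K) l (Cp_on X)"
      unfolding block_space_def
    proof (intro CollectI conjI allI impI ballI)
      show "f x = 0" if "l x = None" for x using that f Cp_on_zero[OF f(1) Z(1)] by (auto simp: lN)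
      show "restrict_to l U f \<in> Cp_on X U" if "U \<in> \<U>" for U
        using Cp_on_restrict[OF f(1) UX(2)[OF that] Z(1)] rt[OF that] by simp
      fix \<Psi> and \<epsilon> :: real assume "\<Psi> \<in> \<Phi> ` K" and \<epsilon>: "\<epsilon> > 0"
      then obtain a where a: "a \<in> K" and \<Psi>: "\<Psi> = \<Phi> a" by auto
      have "\<forall>b\<in>K. \<exists>G. openin X G \<and> b \<in> G \<and> (\<forall>x\<in>G \<inter> Z. \<bar>f x - f b\<bar> < \<epsilon>)"
        using f(1) \<epsilon> Z(2) unfolding Cp_on_iff[OF Z(1)] by blast
      then obtain G where G: "\<And>b. b \<in> K \<Longrightarrow> openin X (G b) \<and> b \<in> G b \<and> (\<forall>x\<in>G b \<inter> Z. \<bar>f x - f b\<bar> < \<epsilon>)"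
        by metis
      have "openin X (\<Union>b\<in>K. G b)" "K \<subseteq> (\<Union>b\<in>K. G b)" using G by auto
      from shrink[OF this a] obtain N where N: "openin X N" "a \<in> N" "\<forall>U\<in>\<U>. U \<inter> N \<noteq> {} \<longrightarrow> U \<subseteq> (\<Union>b\<in>K. G b)"
        by blast
      have "\<bar>f x\<bar> \<le> \<epsilon>" if "l x = Some U" "U \<inter> N \<noteq> {}" for x U
      proof -
        have U: "U \<in> \<U>" "x \<in> U" using that l by auto
        have "U \<subseteq> (\<Union>b\<in>K. G b)" using N(3) U(1) that(2) by blast
        then obtain b where b: "b \<in> K" "x \<in> G b" using U(2) by blast
        have "x \<in> G b \<inter> Z" using b UX(2)[OF U(1)] U(2) by blast
        then have "\<bar>f x - f b\<bar> < \<epsilon>" using G[OF b(1)] by blast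
        then show ?thesis using f(2)[OF b(1)] by simp
      qed
      moreover have "{U \<in> \<U>. U \<inter> N \<noteq> {}} \<in> \<Psi>" unfolding \<Psi> \<Phi>_def using N by blast
      ultimately show "\<exists>\<V>\<in>\<Psi>. \<forall>i b. l i = Some b \<longrightarrow> b \<in> \<V> \<longrightarrow> \<bar>f i\<bar> \<le> \<epsilon>"
        by (intro bexI[of _ "{U \<in> \<U>. U \<inter> N \<noteq> {}}"]) simp_all
    qed
  next
    fix f assume f: "f \<in> block_space \<U> (\<Phi> ` K) l (Cp_on X)"
    have f0: "f x = 0" if "x \<notin> Z - K" for x
      using f that unfolding lN[symmetric] block_space_def by simp
    have fU: "(\<lambda>x. if x \<in> U then f x else 0) \<in> Cp_on X U" if "U \<in> \<U>" for U
      using f that unfolding rt[OF that, symmetric] block_space_def by simp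
    have "f \<in> Cp_on X Z"
      unfolding Cp_on_iff[OF Z(1)]
    proof (intro conjI allI impI ballI)
      show "f x = 0" if "x \<notin> Z" for x using f0 that by auto
      fix a and \<epsilon> :: real assume a: "a \<in> Z" and \<epsilon>: "\<epsilon> > 0"
      show "\<exists>U. openin X U \<and> a \<in> U \<and> (\<forall>x\<in>U \<inter> Z. \<bar>f x - f a\<bar> < \<epsilon>)"
      proof (cases "a \<in> K")
        case True
        have "\<Phi> a \<in> \<Phi> ` K" "\<epsilon> / 2 > 0" using True \<epsilon> by auto
        then obtain \<V> where V: "\<V> \<in> \<Phi> a" "\<forall>i b. l i = Some b \<longrightarrow> b \<in> \<V> \<longrightarrow> \<bar>f i\<bar> \<le> \<epsilon> / 2"
          using f[unfolded block_space_def, THEN CollectD, THEN conjunct2, THEN conjunct2, rule_format,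
              of "\<Phi> a" "\<epsilon> / 2"] by blast
        obtain N where N: "openin X N" "a \<in> N" "{U \<in> \<U>. U \<inter> N \<noteq> {}} \<subseteq> \<V>" using V(1) unfolding \<Phi>_def by blast
        have "\<bar>f x - f a\<bar> < \<epsilon>" if "x \<in> N \<inter> Z" for x
        proof (cases "x \<in> K")
          case True
          then show ?thesis using f0[of x] f0[of a] \<open>a \<in> K\<close> \<epsilon> by auto
        next
          case False
          then have "x \<in> \<Union>\<U>" using that unfolding un by simp
          then obtain U where U: "U \<in> \<U>" "x \<in> U" by blast
          then have lx: "l x = Some U" using l by simp
          have "U \<inter> N \<noteq> {}" using that U by blast
          then have "U \<in> \<V>" using N(3) U by blast
          then have "\<bar>f x\<bar> \<le> \<epsilon> / 2" using V(2) lx by simp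
          then show ?thesis using f0[of a] \<open>a \<in> K\<close> \<epsilon> by auto
        qed
        then show ?thesis using N by blast
      next
        case False
        then have "a \<in> \<Union>\<U>" using a unfolding un by simp
        then obtain U where U: "U \<in> \<U>" "a \<in> U" by blast
        obtain W where "openin X W" "a \<in> W"
          "\<forall>x\<in>W \<inter> U. \<bar>(if x \<in> U then f x else 0) - (if a \<in> U then f a else 0)\<bar> < \<epsilon>"
          using fU[OF U(1)] U(2) \<epsilon> unfolding Cp_on_iff[OF UX(1)[OF U(1)]] by blast
        then show ?thesis using U op[OF U(1)] by (intro exI[of _ "W \<inter> U"]) auto
      qed
    qed
    then show "f \<in> Cp_vanishing X Z K" using f0 by (auto simp: Cp_vanishing_def)
  qed
  moreover have "squarable (block_space \<U> (\<Phi> ` K) l (Cp_on X))"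
  proof (rule squarable_block_space)
    show "f x = 0" if "U \<in> \<U>" "f \<in> Cp_on X U" "l x \<noteq> Some U" for U f x
      using that l Cp_on_zero[OF that(2) UX(1)] by blast
    fix \<Psi> \<V> \<W> assume "\<Psi> \<in> \<Phi> ` K" "\<V> \<in> \<Psi>" "\<W> \<in> \<Psi>"
    then obtain a N N' where "a \<in> K" "\<Psi> = \<Phi> a" "openin X N" "a \<in> N" "{U \<in> \<U>. U \<inter> N \<noteq> {}} \<subseteq> \<V>"
      "openin X N'" "a \<in> N'" "{U \<in> \<U>. U \<inter> N' \<noteq> {}} \<subseteq> \<W>"
      unfolding \<Phi>_def by blast
    then show "\<V> \<inter> \<W> \<in> \<Psi>" unfolding \<Phi>_def by (auto intro!: exI[of _ "N \<inter> N'"])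
  qed (use sq l in auto)
  ultimately show ?thesis by simp
qed

section \<open>Partitions and retractions of zero-dimensional Polish spaces\<close>

locale zero_dimensional_polish = Metric_space M d for M :: "'a set" and d +
  assumes complete: mcomplete
    and separable: "separable_space mtopology"
    and zero_dimensional: "zero_dimensional_space mtopology"
begin

lemma openM: "openin mtopology G \<Longrightarrow> G \<subseteq> M"
  using openin_subset[of mtopology G] by simp

lemma closedM: "closedin mtopology K \<Longrightarrow> K \<subseteq> M"
  using closedin_subset[of mtopology K] by simp

definition clopen :: "'a set \<Rightarrow> bool" where
  "clopen S \<longleftrightarrow> openin mtopology S \<and> closedin mtopology S"

lemma clopen_subset: "clopen S \<Longrightarrow> S \<subseteq> M"
  using openM by (auto simp: clopen_def)

lemma clopen_Int: "clopen S \<Longrightarrow> clopen T \<Longrightarrow> clopen (S \<inter> T)"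
  by (auto simp: clopen_def)

lemma clopen_Diff: "clopen S \<Longrightarrow> clopen T \<Longrightarrow> clopen (S - T)"
  by (auto simp: clopen_def openin_diff closedin_diff)

lemma clopen_M: "clopen M"
  by (auto simp: clopen_def)

lemma clopen_finite_Union: "finite \<V> \<Longrightarrow> (\<And>V. V \<in> \<V> \<Longrightarrow> clopen V) \<Longrightarrow> clopen (\<Union>\<V>)"
  unfolding clopen_def by (auto intro!: closedin_Union)

lemma closedin_finite_subset: "finite F \<Longrightarrow> F \<subseteq> M \<Longrightarrow> closedin mtopology F"
  using Hausdorff_imp_t1_space[OF Hausdorff_space_mtopology] unfolding t1_space_closedin_finite by simp

lemma clopen_neighbourhood:
  assumes "openin mtopology U" "x \<in> U"
  obtains V where "clopen V" "x \<in> V" "V \<subseteq> U"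
  using zero_dimensional assms unfolding zero_dimensional_space_def clopen_def by metis

definition clopen_partition :: "'a set set \<Rightarrow> 'a set \<Rightarrow> bool" where
  "clopen_partition \<U> G \<longleftrightarrow>
     countable \<U> \<and> disjoint \<U> \<and> \<Union>\<U> = G \<and> {} \<notin> \<U> \<and> (\<forall>U\<in>\<U>. clopen U)"

text \<open>
  The diameter of each member is at most its distance to \<open>K\<close>.
\<close>

definition relatively_small :: "'a set set \<Rightarrow> 'a set \<Rightarrow> bool" where
  "relatively_small \<U> K \<longleftrightarrow> (\<forall>U\<in>\<U>. \<forall>x\<in>U. \<forall>y\<in>U. \<forall>a\<in>K. d x y \<le> d x a)"

text \<open>
  By separability countably many admissible clopen sets cover \<open>G\<close>, and these can be made disjoint
  because clopen sets are closed under differences and \<open>P\<close> is hereditary.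
\<close>

lemma clopen_partition_exists:
  assumes G: "openin mtopology G"
    and cover: "\<And>x. x \<in> G \<Longrightarrow> \<exists>V. clopen V \<and> x \<in> V \<and> P V"
    and hered: "\<And>V W. P V \<Longrightarrow> clopen W \<Longrightarrow> W \<subseteq> V \<Longrightarrow> P W"
  shows "\<exists>\<U>. clopen_partition \<U> G \<and> (\<forall>U\<in>\<U>. P U)"
proof (cases "G = {}")
  case True
  then show ?thesis by (intro exI[of _ "{}"]) (auto simp: clopen_partition_def)
next
  case False
  obtain Q where Q: "countable Q" "Q \<subseteq> M" "mtopology closure_of Q = M"
    using separable unfolding separable_space_def by auto
  define B where "B = {(q, n::nat). q \<in> Q \<and> (\<exists>V. clopen V \<and> V \<subseteq> G \<and> P V \<and> mball q (1 / Suc n) \<subseteq> V)}"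
  have "countable B" by (rule countable_subset[of _ "Q \<times> UNIV"]) (auto simp: B_def Q)
  have "\<forall>p\<in>B. \<exists>V. clopen V \<and> V \<subseteq> G \<and> P V \<and> mball (fst p) (1 / Suc (snd p)) \<subseteq> V" by (auto simp: B_def)
  then obtain V where V: "\<And>p. p \<in> B \<Longrightarrow> clopen (V p) \<and> V p \<subseteq> G \<and> P (V p) \<and> mball (fst p) (1 / Suc (snd p)) \<subseteq> V p"
    by metis
  have cov: "\<exists>p\<in>B. x \<in> V p" if x: "x \<in> G" for x
  proof -
    obtain V1 where V1: "clopen V1" "x \<in> V1" "P V1" using cover[OF x] by blast
    obtain V2 where V2: "clopen V2" "x \<in> V2" "V2 \<subseteq> V1 \<inter> G"
      using clopen_neighbourhood[of "V1 \<inter> G" x] V1 x G by (auto simp: clopen_def)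
    then have P2: "P V2" using hered[OF V1(3)] by auto
    obtain e where e: "e > 0" "mball x e \<subseteq> V2" using V2 unfolding clopen_def openin_mtopology by blast
    obtain n where n: "1 / real (Suc n) < e / 2" using e(1) nat_approx_posE[of "e / 2"] by auto
    have xM: "x \<in> M" using x G openM by blast
    then have "x \<in> mtopology closure_of Q" using Q by simp
    then have "\<forall>r>0. \<exists>y\<in>Q. y \<in> mball x r" unfolding metric_closure_of by blast
    moreover have "1 / real (Suc n) > 0" by simp
    ultimately obtain q where q: "q \<in> Q" "q \<in> mball x (1 / Suc n)" by blast
    have "mball q (1 / Suc n) \<subseteq> mball x e"
    proof
      fix y assume y: "y \<in> mball q (1 / Suc n)"
      then have "d x y \<le> d x q + d q y" using q by (intro triangle) auto
      then show "y \<in> mball x e" using y q n by auto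
    qed
    then have "(q, n) \<in> B" using q e V2 P2 unfolding B_def by blast
    moreover have "x \<in> V (q, n)" using V[OF \<open>(q, n) \<in> B\<close>] q commute by auto
    ultimately show ?thesis by blast
  qed
  have "B \<noteq> {}" using False cov by auto
  define A where "A n = V (from_nat_into B n)" for n
  have A: "clopen (A n) \<and> A n \<subseteq> G \<and> P (A n)" for n
    unfolding A_def using V from_nat_into[OF \<open>B \<noteq> {}\<close>] by auto
  have UA: "(\<Union>n. A n) = G"
    using A cov range_from_nat_into[OF \<open>B \<noteq> {}\<close> \<open>countable B\<close>] unfolding A_def by auto (metis rangeE)
  have cd: "clopen (disjointed A n)" for n
    unfolding disjointed_def using A by (intro clopen_Diff clopen_finite_Union) auto
  have "clopen U \<and> P U" if U': "U \<in> range (disjointed A) - {{}}" for U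
  proof -
    obtain n where U: "U = disjointed A n" using U' by auto
    then have "U \<subseteq> A n" by (simp add: disjointed_def)
    then show "clopen U \<and> P U" using cd[of n] A[of n] hered[of "A n" U] U by blast
  qed
  moreover have "disjoint (range (disjointed A) - {{}})"
    using disjoint_family_on_disjoint_image[OF disjoint_family_disjointed[of A]] by (auto simp: pairwise_def)
  moreover have "\<Union> (range (disjointed A) - {{}}) = G" using UN_disjointed_eq[of A] UA by auto
  ultimately show ?thesis unfolding clopen_partition_def
    by (intro exI[of _ "range (disjointed A) - {{}}"]) auto
qed

lemma relatively_small_partition_exists:
  assumes G: "openin mtopology G" and K: "closedin mtopology K" "G \<inter> K = {}"
    and cover: "\<And>x. x \<in> G \<Longrightarrow> \<exists>V. clopen V \<and> x \<in> V \<and> P V"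
    and hered: "\<And>V W. P V \<Longrightarrow> clopen W \<Longrightarrow> W \<subseteq> V \<Longrightarrow> P W"
  shows "\<exists>\<U>. clopen_partition \<U> G \<and> relatively_small \<U> K \<and> (\<forall>U\<in>\<U>. P U)"
proof -
  (* Relative smallness is itself a hereditary property, to be demanded together with P. *)
  define R where "R V \<longleftrightarrow> P V \<and> (\<forall>x\<in>V. \<forall>y\<in>V. \<forall>a\<in>K. d x y \<le> d x a)" for V
  have coverR: "\<exists>V. clopen V \<and> x \<in> V \<and> R V" if x: "x \<in> G" for x
  proof -
    have xM: "x \<in> M" using x G openM by blast
    have "openin mtopology (M - K)" "x \<in> M - K" using K x xM by auto
    then obtain e where e: "e > 0" "mball x e \<subseteq> M - K" unfolding openin_mtopology by blast
    obtain V1 where V1: "clopen V1" "x \<in> V1" "P V1" using cover[OF x] by blast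
    obtain V where V: "clopen V" "x \<in> V" "V \<subseteq> V1 \<inter> mball x (e / 3)"
      using clopen_neighbourhood[of "V1 \<inter> mball x (e / 3)" x] V1 xM e by (auto simp: clopen_def)
    have "d y z \<le> d y a" if "y \<in> V" "z \<in> V" "a \<in> K" for y z a
    proof -
      have m: "y \<in> M" "z \<in> M" "d x y < e / 3" "d x z < e / 3" using that V by auto
      have "a \<in> M" using that K closedM by blast
      moreover have "a \<notin> mball x e" using e that by blast
      ultimately have "d x a \<ge> e" using xM by auto
      moreover have "d x a \<le> d x y + d y a" "d y z \<le> d y x + d x z"
        using triangle m xM \<open>a \<in> M\<close> by auto
      ultimately show ?thesis using m commute[of x y] by linarith
    qed
    then have "R V" using hered[OF V1(3) V(1)] V(3) unfolding R_def by blast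
    then show ?thesis using V by blast
  qed
  have heredR: "R W" if "R V" "clopen W" "W \<subseteq> V" for V W
    using that hered[of V W] unfolding R_def by blast
  have "\<exists>\<U>. clopen_partition \<U> G \<and> (\<forall>U\<in>\<U>. R U)"
    by (rule clopen_partition_exists[OF G]) (fact coverR, fact heredR)
  then obtain \<U> where \<U>: "clopen_partition \<U> G" "\<And>U. U \<in> \<U> \<Longrightarrow> R U" by blast
  have "relatively_small \<U> K" "\<forall>U\<in>\<U>. P U" using \<U>(2) unfolding R_def relatively_small_def by simp_all
  then show ?thesis using \<U>(1) by blast
qed

text \<open>
  If a relatively small set comes close to a point of \<open>K\<close>, all of it is close to this point.
\<close>

lemma relatively_small_shrink:
  assumes small: "relatively_small \<U> K"
    and UM: "\<And>U. U \<in> \<U> \<Longrightarrow> U \<subseteq> M" and G: "openin mtopology G" and a: "a \<in> K" "a \<in> G"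
  shows "\<exists>N. openin mtopology N \<and> a \<in> N \<and> (\<forall>U\<in>\<U>. U \<inter> N \<noteq> {} \<longrightarrow> U \<subseteq> G)"
proof -
  obtain e where e: "e > 0" "mball a e \<subseteq> G" using G a unfolding openin_mtopology by blast
  have aM: "a \<in> M" using G a openM by blast
  have "U \<subseteq> G" if U: "U \<in> \<U>" "x \<in> U" "x \<in> mball a (e / 2)" for U x
  proof
    fix y assume y: "y \<in> U"
    have m: "x \<in> M" "y \<in> M" using y UM U by blast+
    have "d a y \<le> d a x + d x y" using triangle m aM by auto
    also have "d x y \<le> d x a" using small U y a unfolding relatively_small_def by blast
    finally have "y \<in> mball a e" using U aM m commute[of x a] by auto
    then show "y \<in> G" using e by blast
  qed
  then have "\<forall>U\<in>\<U>. U \<inter> mball a (e / 2) \<noteq> {} \<longrightarrow> U \<subseteq> G" by blast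
  moreover have "a \<in> mball a (e / 2)" using aM e by simp
  ultimately show ?thesis using openin_mball by blast
qed

text \<open>
  The retraction is constant on the members of a relatively small partition of the complement. Its value
  there is a point of \<open>K\<close> that is nearest, up to a factor 2, to some point of the member; this forces
  continuity at the points of \<open>K\<close>.
\<close>

lemma closed_retract:
  assumes K: "closedin mtopology K" "K \<noteq> {}"
  obtains r where "continuous_map mtopology mtopology r" "\<And>x. x \<in> M \<Longrightarrow> r x \<in> K" "\<And>x. x \<in> K \<Longrightarrow> r x = x"
proof -
  have KM: "K \<subseteq> M" using K closedM by blast
  have "openin mtopology (M - K)" using K by auto
  then have "\<exists>\<U>. clopen_partition \<U> (M - K) \<and> relatively_small \<U> K \<and> (\<forall>U\<in>\<U>. True)"
    using K(1) clopen_M by (intro relatively_small_partition_exists) auto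
  then obtain \<U> where part: "clopen_partition \<U> (M - K)" and rel: "relatively_small \<U> K" by blast
  have U: "disjoint \<U>" "\<Union>\<U> = M - K" "{} \<notin> \<U>" "\<And>U. U \<in> \<U> \<Longrightarrow> clopen U"
    using part by (auto simp: clopen_partition_def)
  have small: "d x y \<le> d x a" if "U \<in> \<U>" "x \<in> U" "y \<in> U" "a \<in> K" for U x y a
    using rel that unfolding relatively_small_def by blast
  have "\<exists>b p. b \<in> K \<and> p \<in> U \<and> (\<forall>a\<in>K. d p b \<le> 2 * d p a)" if UU: "U \<in> \<U>" for U
  proof -
    obtain p where p: "p \<in> U" using U(3) UU by fastforce
    then have pM: "p \<in> M" "p \<notin> K" using U(2) UU by blast+
    define \<rho> where "\<rho> = (INF a\<in>K. d p a)"
    have bdd: "bdd_below (d p ` K)" by (rule bdd_belowI[of _ 0]) auto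
    have le: "\<rho> \<le> d p a" if "a \<in> K" for a unfolding \<rho>_def by (rule cINF_lower[OF bdd that])
    obtain e where e: "e > 0" "mball p e \<subseteq> M - K"
      using \<open>openin mtopology (M - K)\<close> pM unfolding openin_mtopology by blast
    have "e \<le> \<rho>" unfolding \<rho>_def
    proof (rule cINF_greatest[OF K(2)])
      fix a assume "a \<in> K"
      then have "a \<notin> mball p e" "a \<in> M" using e KM by blast+
      then show "e \<le> d p a" using pM by auto
    qed
    then have "\<rho> < 2 * \<rho>" using e by linarith
    then obtain b where "b \<in> K" "d p b < 2 * \<rho>"
      using cINF_less_iff[OF K(2) bdd] unfolding \<rho>_def by blast
    then show ?thesis using le p by fastforce
  qed
  then obtain b p where bp: "\<And>U. U \<in> \<U> \<Longrightarrow> b U \<in> K \<and> p U \<in> U \<and> (\<forall>a\<in>K. d (p U) (b U) \<le> 2 * d (p U) a)" by metis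
  define r where "r x = (if x \<in> K then x else b (THE U. U \<in> \<U> \<and> x \<in> U))" for x
  have rU: "r x = b U" if "U \<in> \<U>" "x \<in> U" for U x
  proof -
    have "(THE U. U \<in> \<U> \<and> x \<in> U) = U"
      using U(1) that by (intro the_equality) (auto simp: pairwise_def disjnt_def)
    moreover have "x \<notin> K" using that U(2) by blast
    ultimately show ?thesis by (simp add: r_def)
  qed
  have rK: "r x \<in> K" if "x \<in> M" for x
  proof (cases "x \<in> K")
    case False
    then have "x \<in> \<Union>\<U>" using U(2) that by simp
    then show ?thesis using rU bp by fastforce
  qed (simp add: r_def)
  show ?thesis
  proof (rule that[of r])
    show "continuous_map mtopology mtopology r"
      unfolding continuous_map_to_metric
    proof (intro ballI allI impI)
      fix x and \<epsilon> :: real assume "x \<in> topspace mtopology" and \<epsilon>: "\<epsilon> > 0"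
      then have xM: "x \<in> M" by simp
      show "\<exists>W. openin mtopology W \<and> x \<in> W \<and> (\<forall>y\<in>W. r y \<in> mball (r x) \<epsilon>)"
      proof (cases "x \<in> K")
        case False
        then have "x \<in> \<Union>\<U>" using U(2) xM by simp
        then obtain V where V: "V \<in> \<U>" "x \<in> V" by blast
        then have "\<forall>y\<in>V. r y \<in> mball (r x) \<epsilon>" using rU[OF V(1)] rK[OF xM] KM \<epsilon> by auto
        then show ?thesis using V U(4)[OF V(1)] unfolding clopen_def by blast
      next
        case True
        have rx: "r x = x" using True by (simp add: r_def)
        have "r y \<in> mball x \<epsilon>" if y: "y \<in> mball x (\<epsilon> / 6)" for y
        proof (cases "y \<in> K")
          case True
          then show ?thesis using y \<epsilon> by (auto simp: r_def)
        next
          case False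
          have yM: "y \<in> M" using y by simp
          then have "y \<in> \<Union>\<U>" using U(2) False by simp
          then obtain V where V: "V \<in> \<U>" "y \<in> V" by blast
          have p: "p V \<in> V" "b V \<in> K" "d (p V) (b V) \<le> 2 * d (p V) x" using bp[OF V(1)] True by auto
          have m: "p V \<in> M" "b V \<in> M" using p V U(4) clopen_subset KM by blast+
          have "d y (p V) \<le> d y x" using small V p(1) True by blast
          moreover have "d (p V) x \<le> d (p V) y + d y x" using triangle m xM yM by blast
          moreover have "d x (b V) \<le> d x (p V) + d (p V) (b V)" using triangle m xM by blast
          ultimately have "d x (b V) \<le> 6 * d x y" using p(3) commute[of y x] commute[of "p V" x] commute[of "p V" y] by linarith
          then show ?thesis using rU[OF V] y m xM by auto
        qed
        then show ?thesis unfolding rx using xM \<epsilon> by (intro exI[of _ "mball x (\<epsilon> / 6)"]) auto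
      qed
    qed
  qed (use rK in \<open>auto simp: r_def\<close>)
qed

lemma Cp_on_decomposition:
  assumes "closedin mtopology K" "K \<noteq> {}" "K \<subseteq> Z" "Z \<subseteq> M"
  shows "Cp_on mtopology Z \<simeq> Cp_on mtopology K \<oplus> Cp_vanishing mtopology Z K"
proof -
  obtain r where "continuous_map mtopology mtopology r" "\<And>x. x \<in> M \<Longrightarrow> r x \<in> K" "\<And>x. x \<in> K \<Longrightarrow> r x = x"
    using closed_retract[OF assms(1,2)] by blast
  then show ?thesis using assms by (intro Cp_on_retract_decomposition[of _ r]) auto
qed

lemma Cp_on_finite:
  assumes "finite F" "F \<subseteq> M"
  shows "Cp_on mtopology F = coord_space True F"
proof (rule Cp_on_discrete)
  fix x assume "x \<in> F"
  moreover have "closedin mtopology (F - {x})" using assms by (intro closedin_finite_subset) auto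
  ultimately show "\<exists>U. openin mtopology U \<and> U \<inter> F = {x}"
    using assms by (intro exI[of _ "M - (F - {x})"]) (auto simp: closedin_def)
qed (use assms in auto)

text \<open>
  Either \<open>Z\<close> is discrete, or it contains a nontrivial convergent sequence \<open>S\<close>. In the second case the
  null functions on the sequence form a summand of \<open>Cp_on mtopology S\<close>, which in turn is a summand of
  \<open>Cp_on mtopology Z\<close>; and the null functions on an infinite set absorb finitely many coordinates.
\<close>

lemma Cp_on_absorbs_finite:
  assumes Z: "Z \<subseteq> M" "infinite Z" and cl: "closedin mtopology Z" and F: "finite F"
  shows "Cp_on mtopology Z \<simeq> coord_space True F \<oplus> Cp_on mtopology Z"
proof (cases "\<forall>x\<in>Z. \<exists>U. openin mtopology U \<and> U \<inter> Z = {x}")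
  case True
  then have "Cp_on mtopology Z = coord_space True Z" using Z by (intro Cp_on_discrete) auto
  then show ?thesis using coord_space_absorbs_finite[OF Z(2) F, of True] by simp
next
  case False
  then obtain a where a: "a \<in> Z" "\<And>U. openin mtopology U \<Longrightarrow> U \<inter> Z \<noteq> {a}" by blast
  have aM: "a \<in> M" using a Z by blast
  have near: "\<exists>y\<in>Z. y \<noteq> a \<and> d a y < e" if "e > 0" for e
    using a(2)[of "mball a e"] a(1) aM that Z by fastforce
  (* Strictly decreasing distances to a make the sequence injective. *)
  have "\<exists>x. \<forall>n. (x n \<in> Z \<and> x n \<noteq> a \<and> d a (x n) < 1 / Suc n) \<and> d a (x (Suc n)) < d a (x n)"
  proof (rule dependent_nat_choice)
    show "\<exists>x. x \<in> Z \<and> x \<noteq> a \<and> d a x < 1 / Suc 0" using near[of 1] by auto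
    fix x n assume "x \<in> Z \<and> x \<noteq> a \<and> d a x < 1 / Suc n"
    then have "d a x > 0" using aM Z by auto
    then show "\<exists>y. (y \<in> Z \<and> y \<noteq> a \<and> d a y < 1 / Suc (Suc n)) \<and> d a y < d a x"
      using near[of "min (d a x) (1 / Suc (Suc n))"] by auto
  qed
  then obtain x where x: "\<And>n. x n \<in> Z" "\<And>n. x n \<noteq> a" "\<And>n. d a (x n) < 1 / Suc n" "\<And>n. d a (x (Suc n)) < d a (x n)"
    by blast
  have "d a (x n) < d a (x m)" if "m < n" for m n
    using that x(4) by (rule lift_Suc_mono_less[of "\<lambda>n. - d a (x n)", simplified, rotated]) 
  then have "inj x" by (metis injI less_irrefl linorder_neqE_nat)
  define D where "D = range x"
  have D: "D \<subseteq> Z" "a \<notin> D" "infinite D" using x \<open>inj x\<close> by (auto simp: D_def finite_image_iff)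
  define S where "S = insert a D"
  have SM: "S \<subseteq> M" "S \<subseteq> Z" using D Z a by (auto simp: S_def)
  have fin: "finite (D - mball a e)" if e: "e > 0" for e
  proof -
    obtain n where n: "1 / real (Suc n) < e" by (rule nat_approx_posE[OF e])
    have "D - mball a e \<subseteq> x ` {..n}"
    proof
      fix y assume y: "y \<in> D - mball a e"
      then obtain m where m: "y = x m" by (auto simp: D_def)
      then have "e \<le> d a (x m)" using y x(1) Z aM by auto
      then have "1 / real (Suc n) < 1 / real (Suc m)" using x(3)[of m] n by linarith
      then have "m < n" by (simp add: divide_less_cancel frac_less2 field_simps)
      then show "y \<in> x ` {..n}" using m by auto
    qed
    then show ?thesis by (rule finite_subset) simp
  qed
  have iso: "\<exists>U. openin mtopology U \<and> y \<in> U \<and> U \<inter> S \<subseteq> {y}" if y: "y \<in> M" "y \<noteq> a" for y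
  proof -
    define e where "e = d a y / 2"
    have e: "e > 0" "y \<notin> mcball a e" using y aM by (auto simp: e_def)
    have c: "closedin mtopology (mcball a e)" "closedin mtopology ((D - mball a e) - {y})"
      using fin[OF e(1)] D Z by (auto intro!: closedin_finite_subset)
    show ?thesis
    proof (intro exI conjI)
      show "openin mtopology (M - (mcball a e \<union> ((D - mball a e) - {y})))"
        using c by (metis closedin_Un closedin_def topspace_mtopology)
      show "(M - (mcball a e \<union> ((D - mball a e) - {y}))) \<inter> S \<subseteq> {y}"
        using aM e mball_subset_mcball by (auto simp: S_def)
    qed (use y e in auto)
  qed
  have Sc: "closedin mtopology S"
    unfolding closedin_def
  proof (intro conjI)
    show "openin mtopology (topspace mtopology - S)"
    proof (subst openin_subopen, intro ballI)
      fix y assume y: "y \<in> topspace mtopology - S"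
      then obtain U where "openin mtopology U" "y \<in> U" "U \<inter> S \<subseteq> {y}" using iso[of y] by (auto simp: S_def)
      then show "\<exists>T. openin mtopology T \<and> y \<in> T \<and> T \<subseteq> topspace mtopology - S"
        using y openM[of U] by (intro exI[of _ U]) auto
    qed
  qed (use SM in auto)
  have ac: "closedin mtopology {a}" using aM closedin_finite_subset by blast
  have "Cp_vanishing mtopology S {a} = coord_space False D"
  proof (rule Cp_vanishing_null_sequence)
    show "t1_space mtopology" by (rule Hausdorff_imp_t1_space[OF Hausdorff_space_mtopology])
    show "\<exists>U. openin mtopology U \<and> U \<inter> S = {y}" if "y \<in> D" for y
    proof -
      have "y \<in> M" "y \<noteq> a" "y \<in> S" using that D Z by (auto simp: S_def)
      then obtain U where "openin mtopology U" "y \<in> U" "U \<inter> S \<subseteq> {y}" using iso by blast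
      then show ?thesis using \<open>y \<in> S\<close> by blast
    qed
    show "finite (D - U)" if U: "openin mtopology U" "{a} \<subseteq> U" for U
    proof -
      obtain e where "e > 0" "mball a e \<subseteq> U" using U unfolding openin_mtopology by blast
      then show ?thesis using fin[of e] by (meson Diff_mono finite_subset order_refl)
    qed
  qed (use SM D in \<open>auto simp: S_def\<close>)
  then have S1: "Cp_on mtopology S \<simeq> Cp_on mtopology {a} \<oplus> coord_space False D"
    using Cp_on_decomposition[OF ac, of S] SM by (simp add: S_def)
  have "Cp_on mtopology S \<simeq> coord_space True F \<oplus> Cp_on mtopology S"
    by (rule absorbs_right_summand[OF S1 coord_space_absorbs_finite[OF D(3) F]])
  moreover have "Cp_on mtopology Z \<simeq> Cp_on mtopology S \<oplus> Cp_vanishing mtopology Z S"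
    using SM Z by (intro Cp_on_decomposition Sc) (auto simp: S_def)
  ultimately show ?thesis by (rule absorbs_left_summand[rotated])
qed

text \<open>
  Finite sets have to be allowed, since arbitrary clopen subsets occur below and nonzero
  finite-dimensional spaces are not squarable.
\<close>

definition good :: "'a set \<Rightarrow> bool" where
  "good S \<longleftrightarrow> finite S \<or> squarable (Cp_on mtopology S)"

lemma good_if_decomposes:
  assumes Z: "closedin mtopology Z" and K: "good K" "K \<subseteq> M"
    and dec: "Cp_on mtopology Z \<simeq> Cp_on mtopology K \<oplus> G" and G: "squarable G"
  shows "good Z"
proof (cases "finite Z")
  case False
  have ZM: "Z \<subseteq> M" using Z closedM by blast
  show ?thesis
  proof (cases "finite K")
    case True
    have "Cp_on mtopology Z \<simeq> Cp_on mtopology K \<oplus> Cp_on mtopology Z"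
      using Cp_on_absorbs_finite[OF ZM False Z True] Cp_on_finite[OF True K(2)] by simp
    then show ?thesis using squarable_if_absorbs[OF dec G] by (simp add: good_def)
  next
    case False
    then show ?thesis using K squarable_similar[OF dec squarable_dsum[OF _ G]] by (auto simp: good_def)
  qed
qed (simp add: good_def)

section \<open>Homeomorphisms from matching partitions\<close>

definition rel_clopen :: "'a set \<Rightarrow> 'a set \<Rightarrow> bool" where
  "rel_clopen S p \<longleftrightarrow> p \<subseteq> S \<and> closedin mtopology p \<and> openin (subtopology mtopology S) p"

definition fine_partition :: "'a set \<Rightarrow> 'a set \<Rightarrow> real \<Rightarrow> 'a set set \<Rightarrow> bool" where
  "fine_partition S p \<epsilon> \<P> \<longleftrightarrow> \<Union>\<P> = p \<and> disjoint \<P> \<and>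
     (\<forall>x\<in>\<P>. rel_clopen S x \<and> x \<noteq> {} \<and> (\<forall>y\<in>x. \<forall>z\<in>x. d y z < \<epsilon>))"

lemma rel_clopen_Int:
  assumes "rel_clopen S p" "clopen V" shows "rel_clopen S (p \<inter> V)"
proof -
  obtain G where G: "openin mtopology G" "p = G \<inter> S"
    using assms(1) unfolding rel_clopen_def openin_subtopology by blast
  have "openin mtopology (G \<inter> V)" using G(1) assms(2) unfolding clopen_def by blast
  moreover have "p \<inter> V = (G \<inter> V) \<inter> S" using G(2) by blast
  ultimately have "openin (subtopology mtopology S) (p \<inter> V)" unfolding openin_subtopology by blast
  then show ?thesis using assms unfolding rel_clopen_def clopen_def by blast
qed

lemma rel_clopen_Diff: "rel_clopen S p \<Longrightarrow> clopen V \<Longrightarrow> rel_clopen S (p - V)"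
proof -
  assume a: "rel_clopen S p" "clopen V"
  have "p - V = p \<inter> (M - V)" using a closedM by (auto simp: rel_clopen_def)
  then show ?thesis using rel_clopen_Int[OF a(1) clopen_Diff[OF clopen_M a(2)]] by simp
qed

text \<open>
  The set \<open>T n\<close> indexes a pair of partitions, by the sets \<open>A s\<close> and by the sets \<open>B s\<close>. The
  member of index \<open>s\<close> that contains \<open>x\<close> at stage \<open>n\<close> determines a decreasing sequence of closed sets
  \<open>B s\<close> whose diameters tend to 0, and by completeness a point. The graph of the resulting map is a
  condition symmetric in \<open>A\<close> and \<open>B\<close>; exchanging the roles therefore yields the inverse map.
\<close>

lemma scheme_map:
  fixes T :: "nat \<Rightarrow> 's set" and A B :: "'s \<Rightarrow> 'a set"
  assumes PM: "P \<subseteq> M" and QM: "Q \<subseteq> M"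
    and cover: "\<And>n x. x \<in> P \<Longrightarrow> \<exists>s\<in>T n. x \<in> A s"
    and disj: "\<And>n s t x. s \<in> T n \<Longrightarrow> t \<in> T n \<Longrightarrow> x \<in> A s \<Longrightarrow> x \<in> A t \<Longrightarrow> s = t"
    and refine: "\<And>n s. s \<in> T (Suc n) \<Longrightarrow> \<exists>t\<in>T n. A s \<subseteq> A t \<and> B s \<subseteq> B t"
    and clo: "\<And>n s. s \<in> T n \<Longrightarrow> closedin mtopology (B s) \<and> B s \<noteq> {} \<and> B s \<subseteq> Q"
    and small: "\<And>n s y z. s \<in> T (Suc n) \<Longrightarrow> y \<in> B s \<Longrightarrow> z \<in> B s \<Longrightarrow> d y z < 1 / Suc n"
    and op: "\<And>n s. s \<in> T n \<Longrightarrow> openin (subtopology mtopology P) (A s)"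
  shows "\<exists>h. continuous_map (subtopology mtopology P) (subtopology mtopology Q) h \<and>
    (\<forall>x\<in>P. \<forall>y. (\<forall>n. \<exists>s\<in>T n. x \<in> A s \<and> y \<in> B s) \<longleftrightarrow> y = h x)"
proof -
  have ex: "\<exists>y. \<forall>z. (\<forall>n. \<exists>s\<in>T n. x \<in> A s \<and> z \<in> B s) \<longleftrightarrow> z = y" if x: "x \<in> P" for x
  proof -
    obtain s where s: "\<And>n. s n \<in> T n" "\<And>n. x \<in> A (s n)" using cover[OF x] by metis
    have iff: "(\<forall>n. \<exists>t\<in>T n. x \<in> A t \<and> z \<in> B t) \<longleftrightarrow> (\<forall>n. z \<in> B (s n))" for z
    proof
      assume z: "\<forall>n. \<exists>t\<in>T n. x \<in> A t \<and> z \<in> B t"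
      show "\<forall>n. z \<in> B (s n)"
      proof
        fix n
        obtain t where "t \<in> T n" "x \<in> A t" "z \<in> B t" using z by blast
        then show "z \<in> B (s n)" using disj[of t n "s n" x] s by simp
      qed
    qed (use s in blast)
    have dec: "B (s (Suc n)) \<subseteq> B (s n)" for n
    proof -
      obtain t where t: "t \<in> T n" "A (s (Suc n)) \<subseteq> A t" "B (s (Suc n)) \<subseteq> B t" using refine s by blast
      then have "t = s n" using disj[of t n "s n" x] s by blast
      then show ?thesis using t by simp
    qed
    have "\<Inter> (range (\<lambda>n. B (s n))) \<noteq> {}"
    proof (rule complete[unfolded mcomplete_nest, rule_format], intro conjI allI impI)
      show "closedin mtopology (B (s n))" "B (s n) \<noteq> {}" for n using clo s by blast+
      show "decseq (\<lambda>n. B (s n))" using dec by (rule decseq_SucI)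
      fix \<epsilon> :: real assume "\<epsilon> > 0"
      then obtain n where n: "1 / real (Suc n) < \<epsilon>" by (rule nat_approx_posE)
      obtain y where y: "y \<in> B (s (Suc n))" using clo s by blast
      have BM: "B (s (Suc n)) \<subseteq> M" using clo s QM by blast
      have "B (s (Suc n)) \<subseteq> mcball y \<epsilon>"
      proof
        fix z assume z: "z \<in> B (s (Suc n))"
        have "d y z < 1 / real (Suc n)" using small[OF s(1) y z] .
        then show "z \<in> mcball y \<epsilon>" using n y z BM by auto
      qed
      then show "\<exists>n a. B (s n) \<subseteq> mcball a \<epsilon>" by blast
    qed
    then obtain y where y: "\<And>n. y \<in> B (s n)" by blast
    have "z = y" if z: "\<forall>n. z \<in> B (s n)" for z
    proof (rule ccontr)
      assume "z \<noteq> y"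
      have "z \<in> M" "y \<in> M" using clo[OF s(1)] z y QM by blast+
      then have "d z y > 0" using \<open>z \<noteq> y\<close> by simp
      then obtain n where n: "1 / real (Suc n) < d z y" by (rule nat_approx_posE)
      have "d z y < 1 / real (Suc n)" using small[OF s(1)] z y by blast
      with n show False by simp
    qed
    then show ?thesis unfolding iff using y by (intro exI[of _ y]) auto
  qed
  define h where "h x = (SOME y. \<forall>z. (\<forall>n. \<exists>s\<in>T n. x \<in> A s \<and> z \<in> B s) \<longleftrightarrow> z = y)" for x
  have h: "\<forall>y. (\<forall>n. \<exists>s\<in>T n. x \<in> A s \<and> y \<in> B s) \<longleftrightarrow> y = h x" if "x \<in> P" for x
    unfolding h_def by (rule someI_ex[OF ex[OF that]])
  have h': "\<exists>s\<in>T n. x \<in> A s \<and> h x \<in> B s" if "x \<in> P" for x n using h[OF that] by blast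
  have hQ: "h x \<in> Q" if "x \<in> P" for x using h'[OF that, of 0] clo by blast
  have hM: "h x \<in> M" if "x \<in> P" for x using hQ[OF that] QM by blast
  have "continuous_map (subtopology mtopology P) mtopology h"
    unfolding continuous_map_to_metric
  proof (intro ballI allI impI)
    fix x and \<epsilon> :: real assume "x \<in> topspace (subtopology mtopology P)" and "\<epsilon> > 0"
    then have x: "x \<in> P" by simp
    obtain n where n: "1 / real (Suc n) < \<epsilon>" using \<open>\<epsilon> > 0\<close> by (rule nat_approx_posE)
    obtain s where s: "s \<in> T (Suc n)" "x \<in> A s" "h x \<in> B s" using h'[OF x] by blast
    have "h y \<in> mball (h x) \<epsilon>" if y: "y \<in> A s" for y
    proof -
      have yP: "y \<in> P" using op[OF s(1)] openin_subset y by fastforce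
      obtain t where t: "t \<in> T (Suc n)" "y \<in> A t" "h y \<in> B t" using h'[OF yP] by blast
      then have "t = s" using disj s y by blast
      then have "d (h x) (h y) < 1 / real (Suc n)" using small[OF s(1,3)] t by blast
      then show ?thesis using n hM x yP by auto
    qed
    then show "\<exists>U. openin (subtopology mtopology P) U \<and> x \<in> U \<and> (\<forall>y\<in>U. h y \<in> mball (h x) \<epsilon>)"
      using op[OF s(1)] s(2) by blast
  qed
  then have "continuous_map (subtopology mtopology P) (subtopology mtopology Q) h"
    using hQ by (auto simp: continuous_map_in_subtopology)
  then show ?thesis using h by blast
qed

text \<open>
  The relation \<open>R\<close> says that two sets look alike. If sets that look alike have arbitrarily fine
  partitions whose members can be matched so as to look alike again, iterating the matching gives two
  sequences of partitions with the same combinatorics, and hence a homeomorphism.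
\<close>

lemma homeomorphic_by_matching_partitions:
  assumes R: "\<And>p q. R p q \<Longrightarrow> rel_clopen S p \<and> rel_clopen S q \<and> p \<noteq> {} \<and> q \<noteq> {}"
    and step: "\<And>p q \<epsilon>. R p q \<Longrightarrow> \<epsilon> > 0 \<Longrightarrow> \<exists>\<P> \<Q> f. fine_partition S p \<epsilon> \<P> \<and> fine_partition S q \<epsilon> \<Q> \<and>
        bij_betw f \<P> \<Q> \<and> (\<forall>x\<in>\<P>. R x (f x))"
    and PQ: "R P Q" and SM: "S \<subseteq> M"
  shows "\<exists>h k. homeomorphic_maps (subtopology mtopology P) (subtopology mtopology Q) h k"
proof -
  (* The set \<open>\<S>\<close> of pairs matches a fine partition of the first component of s with one of the second. *)
  define ok where "ok s \<epsilon> \<S> \<longleftrightarrow> \<Union> (fst ` \<S>) = fst s \<and> \<Union> (snd ` \<S>) = snd s \<and>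
      (\<forall>t\<in>\<S>. R (fst t) (snd t) \<and> (\<forall>y\<in>fst t. \<forall>z\<in>fst t. d y z < \<epsilon>) \<and> (\<forall>y\<in>snd t. \<forall>z\<in>snd t. d y z < \<epsilon>)) \<and>
      (\<forall>t\<in>\<S>. \<forall>t'\<in>\<S>. t \<noteq> t' \<longrightarrow> fst t \<inter> fst t' = {} \<and> snd t \<inter> snd t' = {})"
    for s :: "'a set \<times> 'a set" and \<epsilon> :: real and \<S>
  have "\<exists>\<S>. ok s \<epsilon> \<S>" if Rs: "R (fst s) (snd s)" and \<epsilon>: "\<epsilon> > 0" for s \<epsilon>
  proof -
    obtain \<P> \<Q> f where P: "fine_partition S (fst s) \<epsilon> \<P>" and Q: "fine_partition S (snd s) \<epsilon> \<Q>"
      and f: "bij_betw f \<P> \<Q>" "\<forall>x\<in>\<P>. R x (f x)" using step[OF Rs \<epsilon>] by blast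
    have fQ: "f ` \<P> = \<Q>" and inj: "inj_on f \<P>" using f(1) by (auto simp: bij_betw_def)
    show ?thesis
    proof (intro exI[of _ "(\<lambda>x. (x, f x)) ` \<P>"], unfold ok_def, intro conjI ballI impI)
      show "\<Union> (fst ` (\<lambda>x. (x, f x)) ` \<P>) = fst s" "\<Union> (snd ` (\<lambda>x. (x, f x)) ` \<P>) = snd s"
        using P Q fQ by (auto simp: fine_partition_def image_image)
      fix t assume "t \<in> (\<lambda>x. (x, f x)) ` \<P>"
      then obtain x where x: "x \<in> \<P>" "t = (x, f x)" by blast
      then have fx: "f x \<in> \<Q>" using fQ by blast
      show "R (fst t) (snd t)" using f(2) x by simp
      show "d y z < \<epsilon>" if "y \<in> fst t" "z \<in> fst t" for y z using P x that by (simp add: fine_partition_def)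
      show "d y z < \<epsilon>" if "y \<in> snd t" "z \<in> snd t" for y z using Q x fx that by (simp add: fine_partition_def)
      fix t' assume "t' \<in> (\<lambda>x. (x, f x)) ` \<P>" and ne: "t \<noteq> t'"
      then obtain x' where x': "x' \<in> \<P>" "t' = (x', f x')" by blast
      have "x \<noteq> x'" using ne x x' by blast
      then have ne': "f x \<noteq> f x'" using inj x x' by (meson inj_onD)
      have "f x' \<in> \<Q>" using fQ x'(1) by blast
      have "disjoint \<P>" "disjoint \<Q>" using P Q by (simp_all add: fine_partition_def)
      then have "disjnt x x'" "disjnt (f x) (f x')"
        using pairwiseD[OF _ x(1) x'(1) \<open>x \<noteq> x'\<close>] pairwiseD[OF _ fx \<open>f x' \<in> \<Q>\<close> ne'] by blast+
      then show "fst t \<inter> fst t' = {}" "snd t \<inter> snd t' = {}"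
        using x(2) x'(2) by (simp_all add: disjnt_def)
    qed
  qed
  then have "\<forall>s n. \<exists>\<S>. R (fst s) (snd s) \<longrightarrow> ok s (1 / real (Suc n)) \<S>" by simp
  then obtain F where F: "\<And>s n. R (fst s) (snd s) \<Longrightarrow> ok s (1 / real (Suc n)) (F s n)" by metis
  define T where "T = rec_nat {(P, Q)} (\<lambda>n T. \<Union>s\<in>T. F s n)"
  have T0: "T 0 = {(P, Q)}" and TS: "\<And>n. T (Suc n) = (\<Union>s\<in>T n. F s n)" by (simp_all add: T_def)
  have RT: "s \<in> T n \<Longrightarrow> R (fst s) (snd s)" for s n
  proof (induction n arbitrary: s)
    case (Suc n)
    then obtain t where t: "t \<in> T n" "s \<in> F t n" unfolding TS by blast
    have "ok t (1 / real (Suc n)) (F t n)" by (rule F[OF Suc.IH[OF t(1)]])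
    then show ?case using t(2) by (simp add: ok_def)
  qed (simp add: T0 PQ)
  have F_cover: "\<Union> (fst ` F s n) = fst s" "\<Union> (snd ` F s n) = snd s" if "s \<in> T n" for s n
    using F[OF RT[OF that], of n] by (simp_all add: ok_def)
  have cover: "\<Union> (fst ` T n) = P \<and> \<Union> (snd ` T n) = Q" for n
  proof (induction n)
    case (Suc n)
    have "\<Union> (fst ` T (Suc n)) = (\<Union>s\<in>T n. \<Union> (fst ` F s n))" unfolding TS by blast
    also have "\<dots> = (\<Union>s\<in>T n. fst s)" by (intro SUP_cong refl F_cover)
    finally have 1: "\<Union> (fst ` T (Suc n)) = P" using Suc by simp
    have "\<Union> (snd ` T (Suc n)) = (\<Union>s\<in>T n. \<Union> (snd ` F s n))" unfolding TS by blast
    also have "\<dots> = (\<Union>s\<in>T n. snd s)" by (intro SUP_cong refl F_cover)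
    finally show ?case using 1 Suc by simp
  qed (simp add: T0)
  have sub: "fst t \<subseteq> fst s \<and> snd t \<subseteq> snd s" if "s \<in> T n" "t \<in> F s n" for s t n
    using F_cover[OF that(1)] that(2) by blast
  have disj: "s \<in> T n \<Longrightarrow> t \<in> T n \<Longrightarrow> s \<noteq> t \<Longrightarrow> fst s \<inter> fst t = {} \<and> snd s \<inter> snd t = {}" for s t n
  proof (induction n arbitrary: s t)
    case (Suc n)
    obtain s' t' where st: "s' \<in> T n" "s \<in> F s' n" "t' \<in> T n" "t \<in> F t' n" using Suc.prems unfolding TS by blast
    show ?case
    proof (cases "s' = t'")
      case True
      have "\<forall>t\<in>F s' n. \<forall>t'\<in>F s' n. t \<noteq> t' \<longrightarrow> fst t \<inter> fst t' = {} \<and> snd t \<inter> snd t' = {}"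
        using F[OF RT[OF st(1)], of n] by (simp add: ok_def)
      then show ?thesis using st(2,4) True Suc.prems(3) by simp
    next
      case False
      then show ?thesis using Suc.IH[OF st(1,3) False] sub[OF st(1,2)] sub[OF st(3,4)] by blast
    qed
  qed (simp add: T0)
  have refine: "\<exists>t\<in>T n. fst s \<subseteq> fst t \<and> snd s \<subseteq> snd t" if "s \<in> T (Suc n)" for s n
    using that sub unfolding TS by blast
  have small: "(\<forall>y\<in>fst s. \<forall>z\<in>fst s. d y z < 1 / Suc n) \<and> (\<forall>y\<in>snd s. \<forall>z\<in>snd s. d y z < 1 / Suc n)"
    if s: "s \<in> T (Suc n)" for s n
  proof -
    obtain t where t: "t \<in> T n" "s \<in> F t n" using s unfolding TS by blast
    then show ?thesis using F[OF RT[OF t(1)], of n] by (simp add: ok_def)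
  qed
  have PS: "P \<subseteq> S" "Q \<subseteq> S" using R[OF PQ] by (auto simp: rel_clopen_def)
  have inPQ: "fst s \<subseteq> P \<and> snd s \<subseteq> Q" if "s \<in> T n" for s n using cover[of n] that by blast
  have clo: "closedin mtopology (fst s)" "fst s \<noteq> {}" "closedin mtopology (snd s)" "snd s \<noteq> {}"
    if "s \<in> T n" for s n
    using R[OF RT[OF that]] by (auto simp: rel_clopen_def)
  have op: "openin (subtopology mtopology P) (fst s)" "openin (subtopology mtopology Q) (snd s)"
    if "s \<in> T n" for s n
  proof -
    have "openin (subtopology mtopology U) q" if "rel_clopen S q" "q \<subseteq> U" "U \<subseteq> S" for q U
    proof -
      obtain G where "openin mtopology G" "q = G \<inter> S"
        using \<open>rel_clopen S q\<close> unfolding rel_clopen_def openin_subtopology by blast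
      then have "openin mtopology G" "q = G \<inter> U" using that(2,3) by auto
      then show ?thesis unfolding openin_subtopology by blast
    qed
    then show "openin (subtopology mtopology P) (fst s)" "openin (subtopology mtopology Q) (snd s)"
      using R[OF RT[OF that]] inPQ[OF that] PS by simp_all
  qed
  obtain h where h: "continuous_map (subtopology mtopology P) (subtopology mtopology Q) h"
    "\<And>x y. x \<in> P \<Longrightarrow> (\<forall>n. \<exists>s\<in>T n. x \<in> fst s \<and> y \<in> snd s) \<longleftrightarrow> y = h x"
  proof -
    have "\<exists>h. continuous_map (subtopology mtopology P) (subtopology mtopology Q) h \<and>
      (\<forall>x\<in>P. \<forall>y. (\<forall>n. \<exists>s\<in>T n. x \<in> fst s \<and> y \<in> snd s) \<longleftrightarrow> y = h x)"
    proof (rule scheme_map)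
      show "\<exists>s\<in>T n. x \<in> fst s" if "x \<in> P" for n x using cover[of n] that by blast
      show "s = t" if "s \<in> T n" "t \<in> T n" "x \<in> fst s" "x \<in> fst t" for n s t x using disj that by blast
      show "\<exists>t\<in>T n. fst s \<subseteq> fst t \<and> snd s \<subseteq> snd t" if "s \<in> T (Suc n)" for n s using refine[OF that] .
      show "closedin mtopology (snd s) \<and> snd s \<noteq> {} \<and> snd s \<subseteq> Q" if "s \<in> T n" for n s
        using clo[OF that] inPQ[OF that] by blast
      show "d y z < 1 / Suc n" if "s \<in> T (Suc n)" "y \<in> snd s" "z \<in> snd s" for n s y z
        using small[OF that(1)] that by blast
      show "openin (subtopology mtopology P) (fst s)" if "s \<in> T n" for n s using op[OF that] by blast
    qed (use PS SM in auto)
    then show ?thesis using that by blast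
  qed
  obtain k where k: "continuous_map (subtopology mtopology Q) (subtopology mtopology P) k"
    "\<And>x y. y \<in> Q \<Longrightarrow> (\<forall>n. \<exists>s\<in>T n. y \<in> snd s \<and> x \<in> fst s) \<longleftrightarrow> x = k y"
  proof -
    have "\<exists>k. continuous_map (subtopology mtopology Q) (subtopology mtopology P) k \<and>
      (\<forall>y\<in>Q. \<forall>x. (\<forall>n. \<exists>s\<in>T n. y \<in> snd s \<and> x \<in> fst s) \<longleftrightarrow> x = k y)"
    proof (rule scheme_map)
      show "\<exists>s\<in>T n. x \<in> snd s" if "x \<in> Q" for n x using cover[of n] that by blast
      show "s = t" if "s \<in> T n" "t \<in> T n" "x \<in> snd s" "x \<in> snd t" for n s t x using disj that by blast
      show "\<exists>t\<in>T n. snd s \<subseteq> snd t \<and> fst s \<subseteq> fst t" if "s \<in> T (Suc n)" for n s using refine[OF that] by blast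
      show "closedin mtopology (fst s) \<and> fst s \<noteq> {} \<and> fst s \<subseteq> P" if "s \<in> T n" for n s
        using clo[OF that] inPQ[OF that] by blast
      show "d y z < 1 / Suc n" if "s \<in> T (Suc n)" "y \<in> fst s" "z \<in> fst s" for n s y z
        using small[OF that(1)] that by blast
      show "openin (subtopology mtopology Q) (snd s)" if "s \<in> T n" for n s using op[OF that] by blast
    qed (use PS SM in auto)
    then show ?thesis using that by blast
  qed
  have PM: "P \<subseteq> M" "Q \<subseteq> M" using PS SM by auto
  have hQ: "h x \<in> Q" if "x \<in> P" for x using h(1) that PM by (auto simp: continuous_map_def Pi_iff)
  have kP: "k y \<in> P" if "y \<in> Q" for y using k(1) that PM by (auto simp: continuous_map_def Pi_iff)
  have "k (h x) = x" if x: "x \<in> P" for x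
  proof -
    have "\<forall>n. \<exists>s\<in>T n. x \<in> fst s \<and> h x \<in> snd s" using h(2)[OF x, of "h x"] by simp
    then have "\<forall>n. \<exists>s\<in>T n. h x \<in> snd s \<and> x \<in> fst s" by blast
    then show ?thesis using k(2)[OF hQ[OF x], of x] by simp
  qed
  moreover have "h (k y) = y" if y: "y \<in> Q" for y
  proof -
    have "\<forall>n. \<exists>s\<in>T n. y \<in> snd s \<and> k y \<in> fst s" using k(2)[OF y, of "k y"] by simp
    then have "\<forall>n. \<exists>s\<in>T n. k y \<in> fst s \<and> y \<in> snd s" by blast
    then show ?thesis using h(2)[OF kP[OF y], of y] by simp
  qed
  ultimately have "homeomorphic_maps (subtopology mtopology P) (subtopology mtopology Q) h k"
    using h(1) k(1) PM by (simp add: homeomorphic_maps_def)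
  then show ?thesis by blast
qed

lemma squarable_if_self_similar:
  assumes S: "S \<subseteq> M" and V: "clopen V"
    and "\<exists>h k. homeomorphic_maps (subtopology mtopology S) (subtopology mtopology (S \<inter> V)) h k"
    and "\<exists>h k. homeomorphic_maps (subtopology mtopology S) (subtopology mtopology (S - V)) h k"
  shows "squarable (Cp_on mtopology S)"
proof -
  have "Cp_on mtopology ((S \<inter> V) \<union> (S - V)) \<simeq> Cp_on mtopology (S \<inter> V) \<oplus> Cp_on mtopology (S - V)"
    by (rule Cp_on_disjoint_union[of _ _ _ V "M - V"]) (use S V in \<open>auto simp: clopen_def\<close>)
  also have "(S \<inter> V) \<union> (S - V) = S" by blast
  finally have "Cp_on mtopology S \<simeq> Cp_on mtopology (S \<inter> V) \<oplus> Cp_on mtopology (S - V)" .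
  also have "\<dots> \<simeq> Cp_on mtopology S \<oplus> Cp_on mtopology S"
    using assms(3,4) S
    by (intro similar_dsum; elim exE; intro similar_sym[OF Cp_on_homeomorphic]) auto
  finally show ?thesis by (simp add: squarable_def)
qed

lemma openin_delete: "openin mtopology U \<Longrightarrow> openin mtopology (U - {y})"
proof (cases "y \<in> M")
  case True
  then show "openin mtopology U \<Longrightarrow> openin mtopology (U - {y})"
    by (intro openin_diff closedin_finite_subset) auto
next
  case False
  then show "openin mtopology U \<Longrightarrow> openin mtopology (U - {y})"
    using openM by (metis Diff_empty Diff_insert0 subsetD)
qed

lemma small_clopen_partition:
  assumes "\<epsilon> > 0"
  shows "\<exists>\<U>. clopen_partition \<U> M \<and> (\<forall>U\<in>\<U>. \<forall>y\<in>U. \<forall>z\<in>U. d y z < \<epsilon>)"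
proof (rule clopen_partition_exists)
  fix x assume x: "x \<in> M"
  then obtain V where V: "clopen V" "x \<in> V" "V \<subseteq> mball x (\<epsilon> / 2)"
    using clopen_neighbourhood[of "mball x (\<epsilon> / 2)" x] assms by auto
  have "d y z < \<epsilon>" if "y \<in> V" "z \<in> V" for y z
  proof -
    have "d x y < \<epsilon> / 2" "d x z < \<epsilon> / 2" "y \<in> M" "z \<in> M" using V(3) that by auto
    moreover have "d y z \<le> d y x + d x z" using triangle calculation x by blast
    ultimately show ?thesis using commute[of x y] by linarith
  qed
  then show "\<exists>V. clopen V \<and> x \<in> V \<and> (\<forall>y\<in>V. \<forall>z\<in>V. d y z < \<epsilon>)" using V by blast
qed auto

section \<open>Perfect compact sets\<close>

text \<open>
  Compactness gives one fine finite partition. A nonempty relatively open set without isolated points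
  can always be split in two, so every larger number of members is possible as well. This freedom allows
  partitions of two different sets to be matched.
\<close>

lemma compact_perfect_fine_partitions:
  assumes p: "rel_clopen S p" "p \<noteq> {}" and comp: "compactin mtopology p"
    and perf: "\<And>x U. x \<in> S \<Longrightarrow> openin mtopology U \<Longrightarrow> U \<inter> S \<noteq> {x}" and \<epsilon>: "\<epsilon> > 0"
  shows "\<exists>N. \<forall>n\<ge>N. \<exists>\<P>. finite \<P> \<and> card \<P> = n \<and> fine_partition S p \<epsilon> \<P>"
proof -
  obtain \<U> where U: "clopen_partition \<U> M" "\<And>U y z. U \<in> \<U> \<Longrightarrow> y \<in> U \<Longrightarrow> z \<in> U \<Longrightarrow> d y z < \<epsilon>"
    using small_clopen_partition[OF \<epsilon>] by blast
  have pM: "p \<subseteq> M" using p closedM by (auto simp: rel_clopen_def)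
  have "\<And>U. U \<in> \<U> \<Longrightarrow> openin mtopology U" "p \<subseteq> \<Union>\<U>"
    using U(1) pM by (auto simp: clopen_partition_def clopen_def)
  then obtain \<V> where V: "finite \<V>" "\<V> \<subseteq> \<U>" "p \<subseteq> \<Union>\<V>" using comp unfolding compactin_def by meson
  define \<P> where "\<P> = (\<lambda>U. p \<inter> U) ` \<V> - {{}}"
  have fp: "fine_partition S p \<epsilon> \<P>"
    unfolding fine_partition_def
  proof (intro conjI ballI)
    show "\<Union>\<P> = p" using V(3) unfolding \<P>_def by blast
    show "disjoint \<P>" using U(1) V(2) unfolding \<P>_def clopen_partition_def pairwise_def disjnt_def by blast
    fix x assume "x \<in> \<P>"
    then obtain U where x: "U \<in> \<U>" "x = p \<inter> U" "x \<noteq> {}" using V(2) unfolding \<P>_def by blast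
    show "rel_clopen S x" using x rel_clopen_Int[OF p(1)] U(1) by (simp add: clopen_partition_def)
    show "x \<noteq> {}" by fact
    fix y z assume "y \<in> x" "z \<in> x"
    then show "d y z < \<epsilon>" using U(2)[OF x(1)] x by blast
  qed
  have fin: "finite \<P>" using V(1) by (simp add: \<P>_def)
  show ?thesis
  proof (intro exI[of _ "card \<P>"] allI impI)
    fix n assume "card \<P> \<le> n"
    then show "\<exists>\<P>. finite \<P> \<and> card \<P> = n \<and> fine_partition S p \<epsilon> \<P>"
    proof (induction n rule: dec_induct)
      case base
      then show ?case using fp fin by blast
    next
      case (step n)
      then obtain \<Q> where Q: "finite \<Q>" "card \<Q> = n" "fine_partition S p \<epsilon> \<Q>" by blast
      have "\<Union>\<Q> = p" using Q(3) by (simp add: fine_partition_def)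
      then obtain q where q: "q \<in> \<Q>" using p(2) by blast
      have q': "rel_clopen S q" "q \<noteq> {}" "\<And>y z. y \<in> q \<Longrightarrow> z \<in> q \<Longrightarrow> d y z < \<epsilon>"
        using Q(3) q by (auto simp: fine_partition_def)
      obtain x where x: "x \<in> q" using q'(2) by blast
      obtain G where G: "openin mtopology G" "q = G \<inter> S"
        using q'(1) unfolding rel_clopen_def openin_subtopology by blast
      obtain y where y: "y \<in> q" "y \<noteq> x" using perf[of x G] G x by blast
      have m: "x \<in> M" "y \<in> M" using x y q'(1) closedM unfolding rel_clopen_def by blast+
      have "openin mtopology (M - {y})" by (rule openin_delete) simp
      then obtain V where V: "clopen V" "x \<in> V" "V \<subseteq> M - {y}"
        using clopen_neighbourhood[of "M - {y}" x] m y by blast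
      define q1 q2 where "q1 = q \<inter> V" and "q2 = q - V"
      have q12: "q1 \<noteq> {}" "q2 \<noteq> {}" "q1 \<inter> q2 = {}" "q1 \<union> q2 = q" "q1 \<noteq> q2"
        using x y V unfolding q1_def q2_def by blast+
      have other: "z \<inter> q = {}" "z \<noteq> {}" if "z \<in> \<Q>" "z \<noteq> q" for z
        using Q(3) q that by (auto simp: fine_partition_def pairwise_def disjnt_def)
      have nin: "q1 \<notin> \<Q> - {q}" "q2 \<notin> \<Q> - {q}" using other q12 by blast+
      let ?R = "insert q1 (insert q2 (\<Q> - {q}))"
      have "card ?R = Suc n" using Q(1,2) q nin q12(5)
        by (simp add: card_Diff_singleton) (metis Suc_pred card_gt_0_iff empty_iff)
      moreover have "fine_partition S p \<epsilon> ?R"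
        unfolding fine_partition_def
      proof (intro conjI ballI)
        have "\<Union>?R = q \<union> \<Union>(\<Q> - {q})" using q12(4) by auto
        then show "\<Union>?R = p" using \<open>\<Union>\<Q> = p\<close> q by auto
        have both: "z \<inter> w = {}" if "z \<in> \<Q> - {q}" "w \<in> \<Q> - {q}" "z \<noteq> w" for z w
          using Q(3) that by (auto simp: fine_partition_def pairwise_def disjnt_def)
        have one: "z \<inter> q1 = {}" "z \<inter> q2 = {}" if "z \<in> \<Q> - {q}" for z
          using other(1)[of z] that q12(4) by blast+
        have "z \<inter> w = {}" if zw: "z \<in> ?R" "w \<in> ?R" "z \<noteq> w" for z w
        proof -
          consider "z = q1" | "z = q2" | "z \<in> \<Q> - {q}" using zw(1) by blast
          then show ?thesis
          proof cases
            case 1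
            then consider "w = q2" | "w \<in> \<Q> - {q}" using zw(2,3) by blast
            then show ?thesis using 1 q12(3) one[of w] by cases (simp_all add: Int_commute)
          next
            case 2
            then consider "w = q1" | "w \<in> \<Q> - {q}" using zw(2,3) by blast
            then show ?thesis using 2 q12(3) one[of w] by cases (simp_all add: Int_commute)
          next
            case 3
            then consider "w = q1" | "w = q2" | "w \<in> \<Q> - {q}" using zw(2) by blast
            then show ?thesis using 3 one[of z] both[of z w] zw(3) by cases simp_all
          qed
        qed
        then show "disjoint ?R" by (auto simp: pairwise_def disjnt_def)
        fix w assume w: "w \<in> ?R"
        show "rel_clopen S w"
          using w Q(3) rel_clopen_Int[OF q'(1) V(1)] rel_clopen_Diff[OF q'(1) V(1)]
          unfolding q1_def q2_def fine_partition_def by blast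
        show "w \<noteq> {}" using w q12(1,2) other(2) by blast
        fix y z assume yz: "y \<in> w" "z \<in> w"
        show "d y z < \<epsilon>"
        proof (cases "w \<in> \<Q>")
          case True
          then show ?thesis using Q(3) yz by (simp add: fine_partition_def)
        next
          case False
          then have "w \<subseteq> q" using w q12(4) by blast
          then show ?thesis using q'(3) yz by blast
        qed
      qed
      moreover have "finite ?R" using Q(1) by simp
      ultimately show ?case by (intro exI[of _ ?R] conjI)
    qed
  qed
qed

text \<open>
  Any two nonempty clopen parts can be partitioned into equally many fine nonempty clopen parts. So they
  are homeomorphic, and \<open>S\<close> is a sum of two copies of itself.
\<close>

lemma good_compact_perfect:
  assumes S: "compactin mtopology S" and perf: "\<And>x U. x \<in> S \<Longrightarrow> openin mtopology U \<Longrightarrow> U \<inter> S \<noteq> {x}"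
  shows "good S"
proof (cases "S = {}")
  case False
  have SM: "S \<subseteq> M" using S compactin_subset_topspace by fastforce
  have Sc: "closedin mtopology S" using S compactin_imp_closedin[OF Hausdorff_space_mtopology] by blast
  define R where "R p q \<longleftrightarrow> rel_clopen S p \<and> rel_clopen S q \<and> p \<noteq> {} \<and> q \<noteq> {}" for p q
  have hom: "\<exists>h k. homeomorphic_maps (subtopology mtopology P) (subtopology mtopology Q) h k" if "R P Q" for P Q
  proof (rule homeomorphic_by_matching_partitions[where R = R and S = S])
    show "R P Q" by fact
    show "S \<subseteq> M" by fact
    show "rel_clopen S p \<and> rel_clopen S q \<and> p \<noteq> {} \<and> q \<noteq> {}" if "R p q" for p q
      using that by (simp add: R_def)
    fix p q and \<epsilon> :: real assume pq: "R p q" and \<epsilon>: "\<epsilon> > 0"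
    have c: "compactin mtopology p" if "rel_clopen S p" for p
      using that S closed_compactin unfolding rel_clopen_def by blast
    obtain N1 where N1: "\<And>n. n \<ge> N1 \<Longrightarrow> \<exists>\<P>. finite \<P> \<and> card \<P> = n \<and> fine_partition S p \<epsilon> \<P>"
      using compact_perfect_fine_partitions[OF _ _ _ perf \<epsilon>] pq c unfolding R_def by meson
    obtain N2 where N2: "\<And>n. n \<ge> N2 \<Longrightarrow> \<exists>\<P>. finite \<P> \<and> card \<P> = n \<and> fine_partition S q \<epsilon> \<P>"
      using compact_perfect_fine_partitions[OF _ _ _ perf \<epsilon>] pq c unfolding R_def by meson
    obtain \<P> where P: "finite \<P>" "card \<P> = max N1 N2" "fine_partition S p \<epsilon> \<P>" using N1[of "max N1 N2"] by auto
    obtain \<Q> where Q: "finite \<Q>" "card \<Q> = max N1 N2" "fine_partition S q \<epsilon> \<Q>" using N2[of "max N1 N2"] by auto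
    obtain f where f: "bij_betw f \<P> \<Q>" using finite_same_card_bij[OF P(1) Q(1)] P Q by auto
    have "R x (f x)" if "x \<in> \<P>" for x
      using P(3) Q(3) that bij_betwE[OF f] unfolding R_def fine_partition_def by blast
    then show "\<exists>\<P> \<Q> f. fine_partition S p \<epsilon> \<P> \<and> fine_partition S q \<epsilon> \<Q> \<and> bij_betw f \<P> \<Q> \<and> (\<forall>x\<in>\<P>. R x (f x))"
      using P Q f by blast
  qed
  obtain x where x: "x \<in> S" using False by blast
  obtain y where y: "y \<in> S" "y \<noteq> x" using perf[OF x openin_topspace] x SM by auto
  have "openin mtopology (M - {y})" by (rule openin_delete) simp
  then obtain V where V: "clopen V" "x \<in> V" "V \<subseteq> M - {y}"
    using clopen_neighbourhood[of "M - {y}" x] x y SM by blast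
  have rS: "rel_clopen S S" using Sc SM by (simp add: rel_clopen_def openin_subtopology_refl)
  have "R S (S \<inter> V)" "R S (S - V)"
    using rS rel_clopen_Int[OF rS V(1)] rel_clopen_Diff[OF rS V(1)] x y V unfolding R_def by blast+
  then have "squarable (Cp_on mtopology S)" by (intro squarable_if_self_similar[OF SM V(1)] hom)
  then show ?thesis by (simp add: good_def)
qed (simp add: good_def)

section \<open>Nowhere locally compact sets with isolated points attached\<close>

text \<open>
  A closed set that is not compact is not totally bounded, by completeness. So finitely many sufficiently
  small pieces cannot cover it.
\<close>

lemma infinitely_many_small_pieces:
  assumes b: "closedin mtopology b" "\<not> compactin mtopology b" and \<epsilon>: "\<epsilon> > 0"
  shows "\<exists>\<U>. clopen_partition \<U> M \<and> (\<forall>U\<in>\<U>. \<forall>y\<in>U. \<forall>z\<in>U. d y z < \<epsilon>) \<and> infinite {U \<in> \<U>. U \<inter> b \<noteq> {}}"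
proof -
  have bM: "b \<subseteq> M" using b closedM by blast
  have "mtopology closure_of b = b" using b by (simp add: closure_of_eq)
  then have "\<not> mtotally_bounded b" using b mtotally_bounded_eq_compact_closure_of[OF complete, of b] by simp
  then have "\<exists>e>0. \<not> (\<exists>F. finite F \<and> F \<subseteq> b \<and> b \<subseteq> (\<Union>x\<in>F. mball x e))"
    unfolding mtotally_bounded_def by simp
  then obtain e where e0: "e > 0" and "\<not> (\<exists>F. finite F \<and> F \<subseteq> b \<and> b \<subseteq> (\<Union>x\<in>F. mball x e))"
    by (elim exE conjE)
  then have e: "\<not> b \<subseteq> (\<Union>x\<in>F. mball x e)" if "finite F" "F \<subseteq> b" for F using that by simp
  have "min \<epsilon> e > 0" using e0 \<epsilon> by simp
  then obtain \<U> where U: "clopen_partition \<U> M" "\<forall>U\<in>\<U>. \<forall>y\<in>U. \<forall>z\<in>U. d y z < min \<epsilon> e"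
    using small_clopen_partition by blast
  have "infinite {U \<in> \<U>. U \<inter> b \<noteq> {}}"
  proof
    assume fin: "finite {U \<in> \<U>. U \<inter> b \<noteq> {}}"
    define c where "c U = (SOME x. x \<in> U \<inter> b)" for U
    have c: "c U \<in> U \<inter> b" if "U \<inter> b \<noteq> {}" for U using that unfolding c_def by (meson ex_in_conv someI_ex)
    have "b \<subseteq> (\<Union>x\<in>c ` {U \<in> \<U>. U \<inter> b \<noteq> {}}. mball x e)"
    proof
      fix y assume y: "y \<in> b"
      then obtain U where UU: "U \<in> \<U>" "y \<in> U" using U(1) bM unfolding clopen_partition_def by blast
      have cU: "c U \<in> U \<inter> b" using c UU y by blast
      then have "d (c U) y < e" using U(2) UU by auto
      then have "y \<in> mball (c U) e" using cU y bM by auto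
      then show "y \<in> (\<Union>x\<in>c ` {U \<in> \<U>. U \<inter> b \<noteq> {}}. mball x e)" using UU y by blast
    qed
    moreover have "c ` {U \<in> \<U>. U \<inter> b \<noteq> {}} \<subseteq> b" using c by blast
    ultimately show False using e[OF finite_imageI[OF fin]] by blast
  qed
  then show ?thesis using U by (intro exI[of _ \<U>]) auto
qed

text \<open>
  Two kinds of parts occur: singletons outside \<open>B\<close>, and clopen parts that meet \<open>B\<close>, here called big. A
  big part splits into countably infinitely many small big parts and a set of singletons. If \<open>B\<close> is not
  all of \<open>K\<close>, the set of singletons is made infinite by removing one isolated point from each of the big
  parts. As all these sets of parts are countable, any two big parts have matching partitions.
\<close>

lemma good_nowhere_locally_compact:
  assumes K: "closedin mtopology K" and B: "closedin mtopology B" "B \<subseteq> K" "B \<noteq> {}"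
    and iso: "\<And>x. x \<in> K - B \<Longrightarrow> \<exists>U. openin mtopology U \<and> U \<inter> K = {x}"
    and dense: "K = B \<or> (\<forall>U. openin mtopology U \<longrightarrow> U \<inter> B \<noteq> {} \<longrightarrow> U \<inter> (K - B) \<noteq> {})"
    and nlc: "\<And>V. clopen V \<Longrightarrow> V \<inter> B \<noteq> {} \<Longrightarrow> \<not> compactin mtopology (V \<inter> B)"
  shows "good K"
proof -
  have KM: "K \<subseteq> M" using K closedM by blast
  have Dcount: "countable (K - B)"
  proof -
    have "\<exists>\<U>. clopen_partition \<U> (M - B) \<and> (\<forall>U\<in>\<U>. \<exists>x. U \<inter> K \<subseteq> {x})"
    proof (rule clopen_partition_exists)
      show "openin mtopology (M - B)" using B(1) by (simp add: closedin_def)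
      fix x assume x: "x \<in> M - B"
      obtain U where U: "openin mtopology U" "x \<in> U" "U \<inter> K \<subseteq> {x}"
      proof (cases "x \<in> K")
        case True
        then obtain U where "openin mtopology U" "U \<inter> K = {x}" using iso[of x] x by blast
        then show ?thesis using that[of U] by blast
      next
        case False
        have "openin mtopology (M - K)" using K by (simp add: closedin_def)
        then show ?thesis using that[of "M - K"] x False by blast
      qed
      obtain V where "clopen V" "x \<in> V" "V \<subseteq> U" using clopen_neighbourhood[OF U(1,2)] by blast
      then show "\<exists>V. clopen V \<and> x \<in> V \<and> (\<exists>x. V \<inter> K \<subseteq> {x})" using U(3) by blast
    qed blast
    then obtain \<U> where U: "clopen_partition \<U> (M - B)" "\<And>U. U \<in> \<U> \<Longrightarrow> \<exists>x. U \<inter> K \<subseteq> {x}" by blast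
    have "countable (\<Union>U\<in>\<U>. U \<inter> K)"
    proof (rule countable_UN)
      show "countable \<U>" using U(1) by (simp add: clopen_partition_def)
      fix W assume "W \<in> \<U>"
      then obtain x where "W \<inter> K \<subseteq> {x}" using U(2) by blast
      then show "countable (W \<inter> K)" by (meson countable_finite finite.emptyI finite.insertI finite_subset)
    qed
    moreover have "K - B \<subseteq> (\<Union>U\<in>\<U>. U \<inter> K)" using U(1) KM unfolding clopen_partition_def by blast
    ultimately show ?thesis using countable_subset by blast
  qed
  have single: "rel_clopen K {x}" if x: "x \<in> K - B" for x
  proof -
    obtain U where U: "openin mtopology U" "U \<inter> K = {x}" using iso[OF x] by blast
    have "closedin mtopology {x}" using x KM by (intro closedin_finite_subset) auto
    moreover have "openin (subtopology mtopology K) {x}" using U unfolding openin_subtopology by blast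
    ultimately show ?thesis using x by (auto simp: rel_clopen_def)
  qed
  define big where "big p \<longleftrightarrow> rel_clopen K p \<and> p \<inter> B \<noteq> {}" for p
  define sing where "sing p \<longleftrightarrow> (\<exists>x\<in>K - B. p = {x})" for p
  have split: "\<exists>\<B> \<S>. fine_partition K p \<epsilon> (\<B> \<union> \<S>) \<and> (\<forall>x\<in>\<B>. big x) \<and> (\<forall>x\<in>\<S>. sing x) \<and>
      countable \<B> \<and> infinite \<B> \<and> countable \<S> \<and> (if K = B then \<S> = {} else infinite \<S>)"
    if p: "big p" and \<epsilon>: "\<epsilon> > 0" for p and \<epsilon> :: real
  proof -
    have rp: "rel_clopen K p" using p by (simp add: big_def)
    obtain G where G: "openin mtopology G" "p = G \<inter> K"
      using rp unfolding rel_clopen_def openin_subtopology by blast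
    have pc: "closedin mtopology p" using rp by (simp add: rel_clopen_def)
    obtain b where b: "b \<in> p \<inter> B" using p unfolding big_def by blast
    obtain V where V: "clopen V" "b \<in> V" "V \<subseteq> G" using clopen_neighbourhood[OF G(1), of b] b G(2) by blast
    have "\<not> compactin mtopology (p \<inter> B)"
    proof
      assume c: "compactin mtopology (p \<inter> B)"
      have "closedin mtopology (V \<inter> B)" using V(1) B(1) unfolding clopen_def by blast
      moreover have "V \<inter> B \<subseteq> p \<inter> B" using V(3) G(2) B(2) by blast
      ultimately have "compactin mtopology (V \<inter> B)" using closed_compactin[OF c] by blast
      then show False using nlc[OF V(1)] V(2) b by blast
    qed
    moreover have "closedin mtopology (p \<inter> B)" using pc B(1) by blast
    ultimately obtain \<U> where U: "clopen_partition \<U> M" "\<forall>U\<in>\<U>. \<forall>y\<in>U. \<forall>z\<in>U. d y z < \<epsilon>"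
      and inf: "infinite {U \<in> \<U>. U \<inter> (p \<inter> B) \<noteq> {}}" using infinitely_many_small_pieces \<epsilon> by blast
    define \<A> where "\<A> = {U \<in> \<U>. U \<inter> (p \<inter> B) \<noteq> {}}"
    have \<A>: "countable \<A>" "infinite \<A>" "\<And>U. U \<in> \<A> \<Longrightarrow> clopen U"
      using inf U(1) by (auto simp: \<A>_def clopen_partition_def)
    have Adisj: "U \<inter> W = {}" if "U \<in> \<A>" "W \<in> \<A>" "U \<noteq> W" for U W
      using U(1) that by (auto simp: \<A>_def clopen_partition_def pairwise_def disjnt_def)
    have Acover: "p \<inter> B \<subseteq> \<Union>\<A>" using U(1) KM B(2) unfolding \<A>_def clopen_partition_def by blast
    have "\<exists>e. (K = B \<longrightarrow> e = {}) \<and> (K \<noteq> B \<longrightarrow> (\<exists>x\<in>K - B. e = {x} \<and> x \<in> p \<inter> U))" if U': "U \<in> \<A>" for U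
    proof (cases "K = B")
      case False
      have "openin mtopology (G \<inter> U)" using G(1) \<A>(3)[OF U'] unfolding clopen_def by blast
      moreover have "(G \<inter> U) \<inter> B \<noteq> {}" using U' G(2) unfolding \<A>_def by blast
      ultimately have "(G \<inter> U) \<inter> (K - B) \<noteq> {}" using dense False by blast
      then show ?thesis using G(2) False by blast
    qed blast
    then obtain e where e: "\<And>U. U \<in> \<A> \<Longrightarrow> (K = B \<longrightarrow> e U = {}) \<and> (K \<noteq> B \<longrightarrow> (\<exists>x\<in>K - B. e U = {x} \<and> x \<in> p \<inter> U))"
      by metis
    define g where "g U = p \<inter> U - e U" for U
    have eD: "e U \<subseteq> K - B" "e U \<subseteq> U" "e U \<subseteq> p" if "U \<in> \<A>" for U using e[OF that] by auto
    have gb: "big (g U)" if U': "U \<in> \<A>" for U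
    proof -
      have r1: "rel_clopen K (p \<inter> U)" using rel_clopen_Int[OF rp \<A>(3)[OF U']] .
      have "rel_clopen K (p \<inter> U - e U)"
      proof (cases "K = B")
        case True
        then show ?thesis using r1 e[OF U'] by simp
      next
        case False
        then obtain x where x: "x \<in> K - B" "e U = {x}" using e[OF U'] by blast
        obtain H where H: "openin mtopology H" "H \<inter> K = {x}" using iso[OF x(1)] by blast
        have xM: "x \<in> M" using x(1) KM by blast
        have "closedin mtopology (p \<inter> U - H)" using r1 H(1) by (simp add: rel_clopen_def closedin_diff)
        moreover have "p \<inter> U - H = p \<inter> U - {x}" using H(2) rp unfolding rel_clopen_def by blast
        moreover have "openin (subtopology mtopology K) (p \<inter> U - {x})"
        proof -
          obtain G' where G': "openin mtopology G'" "p \<inter> U = G' \<inter> K"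
            using r1 unfolding rel_clopen_def openin_subtopology by blast
          have "openin mtopology (G' - {x})"
            using G'(1) by (rule openin_delete)
          moreover have "p \<inter> U - {x} = (G' - {x}) \<inter> K" using G'(2) by blast
          ultimately show ?thesis unfolding openin_subtopology by blast
        qed
        ultimately show ?thesis using x(2) rp by (auto simp: rel_clopen_def)
      qed
      moreover have "(p \<inter> U - e U) \<inter> B \<noteq> {}" using U' eD[OF U'] unfolding \<A>_def by blast
      ultimately show ?thesis by (simp add: big_def g_def)
    qed
    have gsub: "g U \<subseteq> U" "g U \<subseteq> p" for U by (auto simp: g_def)
    (* The rest misses B, so all its points are isolated; it contains the points removed from the big parts. *)
    define rest where "rest = p - \<Union>(g ` \<A>)"
    have restD: "rest \<subseteq> K - B"
    proof
      fix x assume x: "x \<in> rest"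
      have "x \<in> K" using x rp unfolding rest_def rel_clopen_def by blast
      moreover have "x \<notin> B"
      proof
        assume xB: "x \<in> B"
        then obtain U where "U \<in> \<A>" "x \<in> U" using Acover x unfolding rest_def by blast
        then have "x \<in> g U" using eD(1)[of U] xB x unfolding g_def rest_def by blast
        then show False using x \<open>U \<in> \<A>\<close> unfolding rest_def by blast
      qed
      ultimately show "x \<in> K - B" by blast
    qed
    define \<B> \<S> where "\<B> = g ` \<A>" and "\<S> = (\<lambda>x. {x}) ` rest"
    have ginj: "inj_on g \<A>"
    proof (rule inj_onI, rule ccontr)
      fix U W assume UW: "U \<in> \<A>" "W \<in> \<A>" "g U = g W" "U \<noteq> W"
      then have "g U \<subseteq> U \<inter> W" using gsub by blast
      then show False using Adisj[OF UW(1,2,4)] gb[OF UW(1)] by (auto simp: big_def)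
    qed
    have fp: "fine_partition K p \<epsilon> (\<B> \<union> \<S>)"
      unfolding fine_partition_def
    proof (intro conjI ballI)
      have "\<Union>\<B> \<subseteq> p" using gsub(2) by (auto simp: \<B>_def)
      moreover have "\<Union>\<S> = p - \<Union>\<B>" by (simp add: \<S>_def rest_def \<B>_def)
      ultimately show "\<Union>(\<B> \<union> \<S>) = p" by auto
      have "z \<inter> w = {}" if zw: "z \<in> \<B> \<union> \<S>" "w \<in> \<B> \<union> \<S>" "z \<noteq> w" for z w
      proof -
        have bb: "z \<inter> w = {}" if zw': "z \<in> \<B>" "w \<in> \<B>" "z \<noteq> w" for z w
        proof -
          obtain U W where UW: "U \<in> \<A>" "W \<in> \<A>" "z = g U" "w = g W" using zw'(1,2) unfolding \<B>_def by blast
          then have "U \<inter> W = {}" using Adisj zw'(3) by blast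
          then show ?thesis using gsub(1)[of U] gsub(1)[of W] UW(3,4) by blast
        qed
        have bs: "z \<inter> w = {}" if "z \<in> \<B>" "w \<in> \<S>" for z w
          using that unfolding \<B>_def \<S>_def rest_def by blast
        have ss: "z \<inter> w = {}" if "z \<in> \<S>" "w \<in> \<S>" "z \<noteq> w" for z w using that unfolding \<S>_def by blast
        show ?thesis
        proof (cases "z \<in> \<B>")
          case True
          show ?thesis
          proof (cases "w \<in> \<B>")
            case False
            then show ?thesis using True bs[of z w] zw(2) by simp
          qed (use bb[OF True _ zw(3)] in simp)
        next
          case False
          then have zS: "z \<in> \<S>" using zw(1) by simp
          show ?thesis
          proof (cases "w \<in> \<B>")
            case True
            then show ?thesis using bs[OF True zS] by (simp add: Int_commute)
          next
            case False
            then show ?thesis using ss[OF zS _ zw(3)] zw(2) by simp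
          qed
        qed
      qed
      then show "disjoint (\<B> \<union> \<S>)" by (simp add: pairwise_def disjnt_def)
      fix x assume x: "x \<in> \<B> \<union> \<S>"
      show "rel_clopen K x"
      proof (cases "x \<in> \<B>")
        case True
        then show ?thesis using gb unfolding \<B>_def big_def by blast
      next
        case False
        then obtain y where "y \<in> rest" "x = {y}" using x unfolding \<S>_def by blast
        then show ?thesis using single restD by blast
      qed
      show "x \<noteq> {}" using x gb unfolding \<B>_def \<S>_def big_def by blast
      fix y z assume yz: "y \<in> x" "z \<in> x"
      show "d y z < \<epsilon>"
      proof (cases "x \<in> \<B>")
        case True
        then obtain U where "U \<in> \<A>" "x = g U" unfolding \<B>_def by blast
        then have "U \<in> \<U>" "y \<in> U" "z \<in> U" using gsub(1)[of U] yz unfolding \<A>_def by blast+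
        then show ?thesis using U(2) by blast
      next
        case False
        then obtain w where "w \<in> rest" "x = {w}" using x unfolding \<S>_def by blast
        then have "y = w" "z = w" "w \<in> M" using yz restD KM by blast+
        then show ?thesis using \<epsilon> by simp
      qed
    qed
    have "infinite \<B>" unfolding \<B>_def using ginj \<A>(2) finite_imageD by blast
    moreover have "countable \<B>" unfolding \<B>_def using \<A>(1) by simp
    moreover have "countable \<S>" unfolding \<S>_def using countable_subset[OF restD Dcount] by simp
    moreover have "if K = B then \<S> = {} else infinite \<S>"
    proof (cases "K = B")
      case True
      then show ?thesis using restD by (simp add: \<S>_def)
    next
      case False
      then obtain x where x: "\<And>U. U \<in> \<A> \<Longrightarrow> x U \<in> K - B \<and> e U = {x U} \<and> x U \<in> p \<inter> U" using e by metis
      have "inj_on x \<A>"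
      proof (rule inj_onI, rule ccontr)
        fix U W assume UW: "U \<in> \<A>" "W \<in> \<A>" "x U = x W" "U \<noteq> W"
        then show False using Adisj[OF UW(1,2,4)] x[OF UW(1)] x[OF UW(2)] by auto
      qed
      then have "infinite (x ` \<A>)" using \<A>(2) finite_imageD by blast
      moreover have "x ` \<A> \<subseteq> rest"
      proof
        fix y assume "y \<in> x ` \<A>"
        then obtain U where U': "U \<in> \<A>" "y = x U" by blast
        have "y \<notin> g W" if W: "W \<in> \<A>" for W
        proof (cases "W = U")
          case True
          then show ?thesis using x[OF U'(1)] U'(2) unfolding g_def by simp
        next
          case False
          then show ?thesis using Adisj[OF W U'(1)] x[OF U'(1)] U'(2) gsub(1)[of W] by blast
        qed
        then show "y \<in> rest" using x[OF U'(1)] U'(2) unfolding rest_def by blast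
      qed
      ultimately have "infinite rest" using finite_subset by blast
      then have "infinite \<S>" unfolding \<S>_def by (simp add: finite_image_iff)
      then show ?thesis using False by simp
    qed
    moreover have "\<forall>x\<in>\<B>. big x" using gb unfolding \<B>_def by blast
    moreover have "\<forall>x\<in>\<S>. sing x" using restD unfolding \<S>_def sing_def by blast
    ultimately show ?thesis using fp by (intro exI[of _ \<B>] exI[of _ \<S>]) simp
  qed
  define R where "R p q \<longleftrightarrow> (big p \<and> big q) \<or> (sing p \<and> sing q)" for p q
  have hom: "\<exists>h k. homeomorphic_maps (subtopology mtopology P) (subtopology mtopology Q) h k"
    if PQ: "big P" "big Q" for P Q
  proof (rule homeomorphic_by_matching_partitions[where R = R and S = K])
    show "R P Q" using PQ by (simp add: R_def)
    show "K \<subseteq> M" by fact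
    show "rel_clopen K p \<and> rel_clopen K q \<and> p \<noteq> {} \<and> q \<noteq> {}" if "R p q" for p q
      using that single unfolding R_def big_def sing_def by blast
    fix p q and \<epsilon> :: real assume pq: "R p q" and \<epsilon>: "\<epsilon> > 0"
    show "\<exists>\<P> \<Q> f. fine_partition K p \<epsilon> \<P> \<and> fine_partition K q \<epsilon> \<Q> \<and> bij_betw f \<P> \<Q> \<and> (\<forall>x\<in>\<P>. R x (f x))"
    proof (cases "big p \<and> big q")
      case True
      obtain \<B> \<S> where 1: "fine_partition K p \<epsilon> (\<B> \<union> \<S>)" "\<forall>x\<in>\<B>. big x" "\<forall>x\<in>\<S>. sing x"
        "countable \<B>" "infinite \<B>" "countable \<S>" "if K = B then \<S> = {} else infinite \<S>"
        using split[OF _ \<epsilon>, of p] True by blast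
      obtain \<B>' \<S>' where 2: "fine_partition K q \<epsilon> (\<B>' \<union> \<S>')" "\<forall>x\<in>\<B>'. big x" "\<forall>x\<in>\<S>'. sing x"
        "countable \<B>'" "infinite \<B>'" "countable \<S>'" "if K = B then \<S>' = {} else infinite \<S>'"
        using split[OF _ \<epsilon>, of q] True by blast
      have bij: "\<exists>f. bij_betw f A A'" if "countable A" "infinite A" "countable A'" "infinite A'" for A A' :: "'a set set"
        using bij_betw_trans[OF to_nat_on_infinite[OF that(1,2)] bij_betw_from_nat_into[OF that(3,4)]] by blast
      obtain f where f: "bij_betw f \<B> \<B>'" using bij[OF 1(4,5) 2(4,5)] by blast
      have "\<exists>g. bij_betw g \<S> \<S>'"
      proof (cases "K = B")
        case True
        then have "\<S> = {}" "\<S>' = {}" using 1(7) 2(7) by simp_all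
        then show ?thesis by (simp add: bij_betw_def)
      next
        case False
        then show ?thesis using bij 1(6,7) 2(6,7) by simp
      qed
      then obtain g where g: "bij_betw g \<S> \<S>'" by blast
      have excl: "\<not> (big x \<and> sing x)" for x by (auto simp: big_def sing_def)
      have dj: "\<B> \<inter> \<S> = {}" "\<B>' \<inter> \<S>' = {}" using excl 1(2,3) 2(2,3) by blast+
      define k where "k x = (if x \<in> \<B> then f x else g x)" for x
      have "bij_betw k \<B> \<B>'" using f by (rule bij_betw_cong[THEN iffD2, rotated]) (simp add: k_def)
      moreover have "bij_betw k \<S> \<S>'"
        using g by (rule bij_betw_cong[THEN iffD2, rotated]) (use dj in \<open>auto simp: k_def\<close>)
      ultimately have kb: "bij_betw k (\<B> \<union> \<S>) (\<B>' \<union> \<S>')" using dj(2) by (rule bij_betw_combine)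
      have "R x (k x)" if "x \<in> \<B> \<union> \<S>" for x
      proof (cases "x \<in> \<B>")
        case True
        then have "k x \<in> \<B>'" using f by (simp add: k_def bij_betwE)
        then show ?thesis using 1(2) 2(2) True by (simp add: R_def)
      next
        case False
        then have xS: "x \<in> \<S>" using that by simp
        then have "k x \<in> \<S>'" using g False by (simp add: k_def bij_betwE)
        then show ?thesis using 1(3) 2(3) xS by (simp add: R_def)
      qed
      then show ?thesis using 1(1) 2(1) kb by blast
    next
      case False
      then obtain x y where xy: "x \<in> K - B" "p = {x}" "y \<in> K - B" "q = {y}"
        using pq unfolding R_def sing_def by blast
      have "fine_partition K {z} \<epsilon> {{z}}" if "z \<in> K - B" for z
        using single[OF that] that KM \<epsilon> by (auto simp: fine_partition_def)
      then have "fine_partition K p \<epsilon> {p}" "fine_partition K q \<epsilon> {q}" using xy by simp_all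
      moreover have "bij_betw (\<lambda>_. q) {p} {q}" by (simp add: bij_betw_def)
      ultimately show ?thesis using pq by blast
    qed
  qed
  obtain b where b: "b \<in> B" using B(3) by blast
  have "B \<noteq> {b}"
  proof
    assume "B = {b}"
    then have "M \<inter> B = {b}" using b B(2) KM by blast
    moreover have "compactin mtopology {b}" using b B(2) KM by (simp add: compactin_sing subset_iff)
    ultimately show False using nlc[OF clopen_M] by simp
  qed
  then obtain b' where b': "b' \<in> B" "b' \<noteq> b" using b by blast
  have bM: "b \<in> M" "b' \<in> M" using b b' B(2) KM by blast+
  have "openin mtopology (M - {b'})" by (rule openin_delete) simp
  then obtain V where V: "clopen V" "b \<in> V" "V \<subseteq> M - {b'}"
    using clopen_neighbourhood[of "M - {b'}" b] bM b' by blast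
  have rK: "rel_clopen K K" using K KM by (simp add: rel_clopen_def openin_subtopology_refl)
  have "big K" using rK B(2,3) unfolding big_def by blast
  moreover have "big (K \<inter> V)" using rel_clopen_Int[OF rK V(1)] b V(2) B(2) unfolding big_def by blast
  moreover have "big (K - V)" using rel_clopen_Diff[OF rK V(1)] b' V(3) B(2) unfolding big_def by blast
  ultimately have "squarable (Cp_on mtopology K)"
    by (intro squarable_if_self_similar[OF KM V(1)] hom)
  then show ?thesis by (simp add: good_def)
qed

section \<open>Pieces shrinking to a closed set\<close>

definition hereditarily_good :: "'a set \<Rightarrow> bool" where
  "hereditarily_good W \<longleftrightarrow> clopen W \<and> (\<forall>Z. clopen Z \<longrightarrow> Z \<subseteq> W \<longrightarrow> good Z)"

text \<open>
  This holds if the members become small near each point of \<open>K\<close>, but also if they form a sequence of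
  shells around a compact set \<open>K\<close>, where no member needs to be small.
\<close>

definition shrinks_to :: "'a set set \<Rightarrow> 'a set \<Rightarrow> bool" where
  "shrinks_to \<U> K \<longleftrightarrow> (\<forall>G a. openin mtopology G \<longrightarrow> K \<subseteq> G \<longrightarrow> a \<in> K \<longrightarrow>
     (\<exists>N. openin mtopology N \<and> a \<in> N \<and> (\<forall>U\<in>\<U>. U \<inter> N \<noteq> {} \<longrightarrow> U \<subseteq> G)))"

lemma open_singleton_in_finite:
  assumes "openin mtopology U" "finite U" "x \<in> U"
  shows "openin mtopology {x}"
proof -
  have "closedin mtopology (U - {x})" using assms openM[of U] by (intro closedin_finite_subset) auto
  then have "openin mtopology (U - (U - {x}))" using assms(1) by (rule openin_diff[rotated])
  moreover have "U - (U - {x}) = {x}" using assms(3) by blast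
  ultimately show ?thesis by simp
qed

lemma good_by_shrinking_pieces:
  assumes Z: "closedin mtopology Z" and K: "closedin mtopology K" "K \<subseteq> Z" "good K"
    and part: "disjoint \<U>" "\<Union>\<U> = Z - K" and shr: "shrinks_to \<U> K"
    and U: "\<And>U. U \<in> \<U> \<Longrightarrow> openin mtopology U \<and> squarable (Cp_on mtopology U)"
  shows "good Z"
proof -
  have ZM: "Z \<subseteq> M" using Z closedM by blast
  have sq: "squarable (Cp_vanishing mtopology Z K)"
  proof (rule squarable_Cp_vanishing)
    show "\<exists>N. openin mtopology N \<and> a \<in> N \<and> (\<forall>U\<in>\<U>. U \<inter> N \<noteq> {} \<longrightarrow> U \<subseteq> G)"
      if "openin mtopology G" "K \<subseteq> G" "a \<in> K" for G a using shr that unfolding shrinks_to_def by blast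
  qed (use ZM K part U in auto)
  show ?thesis
  proof (cases "K = {}")
    case True
    then show ?thesis using sq by (simp add: good_def Cp_vanishing_def)
  next
    case False
    show ?thesis
      by (rule good_if_decomposes[OF Z K(3) _ Cp_on_decomposition[OF K(1) False K(2) ZM] sq]) (use K ZM in auto)
  qed
qed

lemma closed_with_exceptional_points:
  assumes Z: "closedin mtopology Z" and B: "B \<subseteq> Z"
    and part: "disjoint \<U>" "\<Union>\<U> = Z - B" and U: "\<And>U. U \<in> \<U> \<Longrightarrow> clopen U"
    and F: "\<And>U. U \<in> \<U> \<Longrightarrow> finite (F U) \<and> F U \<subseteq> U"
  shows "closedin mtopology (B \<union> (\<Union>U\<in>\<U>. F U))"
proof -
  have ZM: "Z \<subseteq> M" using Z closedM by blast
  have sep: "F U \<inter> W = {}" if "U \<in> \<U>" "W \<in> \<U>" "U \<noteq> W" for U W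
    using pairwiseD[OF part(1) that] F[OF that(1)] unfolding disjnt_def by blast
  have cF: "closedin mtopology (F U)" if "U \<in> \<U>" for U
    using F[OF that] clopen_subset[OF U[OF that]] by (intro closedin_finite_subset) auto
  have "openin mtopology ((M - Z) \<union> (\<Union>U\<in>\<U>. U - F U))"
  proof (intro openin_Un openin_Union ballI; (elim imageE)?)
    show "openin mtopology (M - Z)" using Z by (simp add: closedin_def)
    show "openin mtopology S" if "S = U - F U" "U \<in> \<U>" for S U
      using U[OF that(2)] cF[OF that(2)] that(1) by (simp add: clopen_def openin_diff)
  qed
  moreover have "M - (B \<union> (\<Union>U\<in>\<U>. F U)) = (M - Z) \<union> (\<Union>U\<in>\<U>. U - F U)" (is "?L = ?R")
  proof (intro set_eqI iffI)
    fix x assume x: "x \<in> ?L"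
    show "x \<in> ?R"
    proof (cases "x \<in> Z")
      case True
      then have "x \<in> \<Union>\<U>" using x unfolding part(2) by blast
      then show ?thesis using x by blast
    qed (use x in blast)
  next
    fix x assume "x \<in> ?R"
    then consider "x \<in> M - Z" | U where "U \<in> \<U>" "x \<in> U - F U" by blast
    then show "x \<in> ?L"
    proof cases
      case 1
      have "\<Union>\<U> \<subseteq> Z" using part(2) by blast
      then show ?thesis using 1 B F by blast
    next
      case 2
      have "U \<subseteq> Z - B" using 2 part(2) by blast
      moreover have "x \<notin> F W" if "W \<in> \<U>" for W using sep[OF that 2(1)] 2(2) by (cases "W = U") auto
      ultimately show ?thesis using 2 ZM by blast
    qed
  qed
  moreover have "B \<union> (\<Union>U\<in>\<U>. F U) \<subseteq> M"
  proof -
    have "\<Union>\<U> \<subseteq> Z" using part(2) by blast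
    then show ?thesis using B F ZM by blast
  qed
  ultimately show ?thesis by (simp add: closedin_def)
qed

text \<open>
  The isolated points in the sets \<open>F U\<close> are moved to the closed set. The remaining pieces still shrink
  to the enlarged set, since none of them meets the open singleton of an added point.
\<close>

lemma good_with_exceptional_points:
  assumes Z: "closedin mtopology Z" and B: "B \<subseteq> Z"
    and part: "disjoint \<U>" "\<Union>\<U> = Z - B" and shr: "shrinks_to \<U> B"
    and U: "\<And>U. U \<in> \<U> \<Longrightarrow> clopen U"
    and F: "\<And>U. U \<in> \<U> \<Longrightarrow> finite (F U) \<and> F U \<subseteq> U" "\<And>U x. U \<in> \<U> \<Longrightarrow> x \<in> F U \<Longrightarrow> openin mtopology {x}"
    and sq: "\<And>U. U \<in> \<U> \<Longrightarrow> U - F U = {} \<or> squarable (Cp_on mtopology (U - F U))"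
    and K: "good (B \<union> (\<Union>U\<in>\<U>. F U))"
  shows "good Z"
proof -
  define K where "K = B \<union> (\<Union>U\<in>\<U>. F U)"
  define \<V> where "\<V> = (\<lambda>U. U - F U) ` \<U> - {{}}"
  have Kc: "closedin mtopology K"
    unfolding K_def by (rule closed_with_exceptional_points[OF Z B part U F(1)])
  have sub: "U \<subseteq> Z - B" if "U \<in> \<U>" for U using part(2) that by blast
  have sep: "U \<inter> W = {}" if "U \<in> \<U>" "W \<in> \<U>" "U \<noteq> W" for U W
    using pairwiseD[OF part(1) that] unfolding disjnt_def .
  show ?thesis
  proof (rule good_by_shrinking_pieces[OF Z Kc])
    show "K \<subseteq> Z" using B F(1) sub unfolding K_def by blast
    show "good K" using K by (simp add: K_def)
    show "disjoint \<V>"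
    proof (rule pairwiseI)
      fix x y assume "x \<in> \<V>" "y \<in> \<V>" "x \<noteq> y"
      then obtain U W where UW: "U \<in> \<U>" "W \<in> \<U>" "x = U - F U" "y = W - F W" unfolding \<V>_def by blast
      then have "U \<inter> W = {}" using sep \<open>x \<noteq> y\<close> by blast
      then show "disjnt x y" using UW by (auto simp: disjnt_def)
    qed
    show "\<Union>\<V> = Z - K"
    proof (intro set_eqI iffI)
      fix x assume "x \<in> \<Union>\<V>"
      then obtain U where U': "U \<in> \<U>" "x \<in> U - F U" unfolding \<V>_def by blast
      have "x \<notin> F W" if "W \<in> \<U>" for W
      proof (cases "W = U")
        case False
        then show ?thesis using sep[OF that U'(1)] F(1)[OF that] U' by blast
      qed (use U' in simp)
      then show "x \<in> Z - K" using sub[OF U'(1)] U' unfolding K_def by blast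
    next
      fix x assume x: "x \<in> Z - K"
      then have "x \<in> \<Union>\<U>" unfolding part(2) K_def by blast
      then show "x \<in> \<Union>\<V>" using x unfolding \<V>_def K_def by blast
    qed
    show "shrinks_to \<V> K"
      unfolding shrinks_to_def
    proof (intro allI impI)
      fix G a assume G: "openin mtopology G" "K \<subseteq> G" "a \<in> K"
      show "\<exists>N. openin mtopology N \<and> a \<in> N \<and> (\<forall>U\<in>\<V>. U \<inter> N \<noteq> {} \<longrightarrow> U \<subseteq> G)"
      proof (cases "a \<in> B")
        case True
        have "B \<subseteq> G" using G(2) unfolding K_def by blast
        then obtain N where N: "openin mtopology N" "a \<in> N" "\<forall>U\<in>\<U>. U \<inter> N \<noteq> {} \<longrightarrow> U \<subseteq> G"
          using shr[unfolded shrinks_to_def, rule_format, OF G(1) \<open>B \<subseteq> G\<close> True] by blast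
        have "\<forall>U\<in>\<V>. U \<inter> N \<noteq> {} \<longrightarrow> U \<subseteq> G" using N(3) unfolding \<V>_def by blast
        then show ?thesis using N by blast
      next
        case False
        then obtain W where W: "W \<in> \<U>" "a \<in> F W" using G(3) unfolding K_def by blast
        have "a \<notin> U - F U" if "U \<in> \<U>" for U
        proof (cases "U = W")
          case False
          then show ?thesis using sep[OF that W(1)] F(1)[OF W(1)] W by blast
        qed (use W in simp)
        then have "\<forall>U\<in>\<V>. U \<inter> {a} \<noteq> {} \<longrightarrow> U \<subseteq> G" unfolding \<V>_def by blast
        then show ?thesis using F(2)[OF W] by blast
      qed
    qed
    fix x assume "x \<in> \<V>"
    then obtain W where W: "W \<in> \<U>" "x = W - F W" "x \<noteq> {}" unfolding \<V>_def by blast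
    have "closedin mtopology (F W)"
      using F(1)[OF W(1)] clopen_subset[OF U[OF W(1)]] by (intro closedin_finite_subset) auto
    then have "openin mtopology x" using U[OF W(1)] W(2) by (simp add: clopen_def openin_diff)
    then show "openin mtopology x \<and> squarable (Cp_on mtopology x)" using sq[OF W(1)] W by simp
  qed
qed

text \<open>
  The union of the finite members is a discrete clopen set; it plays the role of the closed set.
\<close>

lemma good_disjoint_union:
  assumes Z: "clopen Z" and part: "clopen_partition \<U> Z" and gd: "\<And>U. U \<in> \<U> \<Longrightarrow> good U"
  shows "good Z"
proof -
  define F where "F U = (if finite U then U else {})" for U :: "'a set"
  have U: "\<And>U. U \<in> \<U> \<Longrightarrow> clopen U" "disjoint \<U>" "\<Union>\<U> = Z" using part by (auto simp: clopen_partition_def)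
  have iso: "openin mtopology {x}" if "U \<in> \<U>" "x \<in> F U" for U x
    using open_singleton_in_finite[of U x] that U(1)[OF that(1)] by (auto simp: F_def clopen_def split: if_splits)
  have "(\<Union>U\<in>\<U>. F U) \<subseteq> M" using U(3) clopen_subset[OF Z] by (auto simp: F_def split: if_splits)
  then have "Cp_on mtopology (\<Union>U\<in>\<U>. F U) = coord_space True (\<Union>U\<in>\<U>. F U)"
  proof (intro Cp_on_discrete)
    fix x assume "x \<in> (\<Union>U\<in>\<U>. F U)"
    then show "\<exists>U. openin mtopology U \<and> U \<inter> (\<Union>U\<in>\<U>. F U) = {x}"
      using iso by (intro exI[of _ "{x}"]) blast
  qed simp
  then have gD: "good (\<Union>U\<in>\<U>. F U)" using squarable_coord_space by (auto simp: good_def)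
  show ?thesis
  proof (rule good_with_exceptional_points[where B = "{}" and F = F and \<U> = \<U>])
    show "closedin mtopology Z" using Z by (simp add: clopen_def)
    show "shrinks_to \<U> {}" by (simp add: shrinks_to_def)
    show "U - F U = {} \<or> squarable (Cp_on mtopology (U - F U))" if "U \<in> \<U>" for U
      using gd[OF that] by (cases "finite U") (simp_all add: good_def F_def)
    show "openin mtopology {x}" if "U \<in> \<U>" "x \<in> F U" for U x using iso[OF that] .
  qed (use U gD in \<open>auto simp: F_def\<close>)
qed

definition good_region :: "'a set" where
  "good_region = \<Union>{W. hereditarily_good W}"

lemma good_clopen_in_good_region:
  assumes Z: "clopen Z" "Z \<subseteq> good_region"
  shows "good Z"
proof -
  have "\<exists>\<U>. clopen_partition \<U> Z \<and> (\<forall>U\<in>\<U>. hereditarily_good U)"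
  proof (rule clopen_partition_exists)
    show "openin mtopology Z" using Z by (simp add: clopen_def)
    show "\<exists>V. clopen V \<and> x \<in> V \<and> hereditarily_good V" if "x \<in> Z" for x
    proof -
      obtain V where "x \<in> V" "hereditarily_good V" using Z(2) \<open>x \<in> Z\<close> unfolding good_region_def by blast
      then show ?thesis unfolding hereditarily_good_def by blast
    qed
    show "hereditarily_good W" if "hereditarily_good V" "clopen W" "W \<subseteq> V" for V W
      using that unfolding hereditarily_good_def by (meson subset_trans)
  qed
  then obtain \<U> where U: "clopen_partition \<U> Z" "\<forall>U\<in>\<U>. hereditarily_good U" by blast
  then have "\<And>U. U \<in> \<U> \<Longrightarrow> good U" unfolding hereditarily_good_def by blast
  then show ?thesis using good_disjoint_union[OF Z(1) U(1)] by blast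
qed

lemma openin_good_region: "openin mtopology good_region"
  unfolding good_region_def by (rule openin_Union) (simp add: hereditarily_good_def clopen_def)

section \<open>Compact remainders\<close>

lemma compact_clopen_neighbourhood:
  assumes B: "compactin mtopology B" and G: "openin mtopology G" "B \<subseteq> G"
  obtains V where "clopen V" "B \<subseteq> V" "V \<subseteq> G"
proof -
  define \<V> where "\<V> = {V. clopen V \<and> V \<subseteq> G}"
  have "B \<subseteq> \<Union>\<V>"
  proof
    fix x assume "x \<in> B"
    then obtain V where "clopen V" "x \<in> V" "V \<subseteq> G" using clopen_neighbourhood[OF G(1)] G(2) by blast
    then show "x \<in> \<Union>\<V>" unfolding \<V>_def by blast
  qed
  moreover have "\<And>V. V \<in> \<V> \<Longrightarrow> openin mtopology V" by (simp add: \<V>_def clopen_def)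
  ultimately obtain \<F> where F: "finite \<F>" "\<F> \<subseteq> \<V>" "B \<subseteq> \<Union>\<F>" using B unfolding compactin_def by meson
  show ?thesis
  proof (rule that[of "\<Union>\<F>"])
    show "clopen (\<Union>\<F>)" using F(2) by (intro clopen_finite_Union[OF F(1)]) (auto simp: \<V>_def)
    show "\<Union>\<F> \<subseteq> G" using F(2) unfolding \<V>_def by blast
  qed (use F in blast)
qed

text \<open>
  The sets are found within the metric neighbourhoods of radius \<open>1 / Suc n\<close> and intersected
  successively; by compactness every open set containing \<open>B\<close> contains one of these neighbourhoods.
\<close>

lemma compact_clopen_neighbourhood_base:
  assumes B: "compactin mtopology B" "B \<subseteq> Z" and Z: "clopen Z"
  obtains G :: "nat \<Rightarrow> 'a set" where "\<And>n. clopen (G n)" "\<And>n. B \<subseteq> G n" "G 0 = Z" "\<And>n. G (Suc n) \<subseteq> G n"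
    "\<And>U. openin mtopology U \<Longrightarrow> B \<subseteq> U \<Longrightarrow> \<exists>n. G n \<subseteq> U"
proof -
  have BM: "B \<subseteq> M" using B(2) clopen_subset[OF Z] by blast
  have "\<exists>H. clopen H \<and> B \<subseteq> H \<and> H \<subseteq> (\<Union>a\<in>B. mball a (1 / Suc n))" for n
  proof -
    have "openin mtopology (\<Union>a\<in>B. mball a (1 / Suc n))" by auto
    moreover have "B \<subseteq> (\<Union>a\<in>B. mball a (1 / Suc n))" using BM by force
    ultimately show ?thesis using compact_clopen_neighbourhood[OF B(1)] by metis
  qed
  then obtain H where H: "\<And>n. clopen (H n) \<and> B \<subseteq> H n \<and> H n \<subseteq> (\<Union>a\<in>B. mball a (1 / Suc n))" by metis
  define G where "G = rec_nat Z (\<lambda>n g. g \<inter> H n)"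
  have G0: "G 0 = Z" and GS: "\<And>n. G (Suc n) = G n \<inter> H n" by (simp_all add: G_def)
  show ?thesis
  proof (rule that[of G])
    show "clopen (G n)" for n by (induction n) (use G0 GS Z H clopen_Int in auto)
    show "B \<subseteq> G n" for n by (induction n) (use G0 GS B H in auto)
    fix U assume U: "openin mtopology U" "B \<subseteq> U"
    (* The Lebesgue number of the one-element cover of B by U. *)
    obtain e where e: "e > 0" "\<And>x. x \<in> B \<Longrightarrow> mball x e \<subseteq> U"
      using lebesgue_number[OF B(1), of "{U}"] U by auto
    obtain n where n: "1 / real (Suc n) < e" using e(1) by (rule nat_approx_posE)
    have "G (Suc n) \<subseteq> U"
    proof
      fix x assume "x \<in> G (Suc n)"
      then obtain a where a: "a \<in> B" "x \<in> mball a (1 / Suc n)" using GS H by blast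
      then have "x \<in> mball a e" using n by auto
      then show "x \<in> U" using e(2) a(1) by blast
    qed
    then show "\<exists>n. G n \<subseteq> U" by blast
  qed (use G0 GS in auto)
qed

text \<open>
  If \<open>D\<close> is infinite, the functions vanishing on \<open>B\<close> are the null functions on \<open>D\<close>, which are squarable.
  If \<open>D\<close> is finite, it contributes a finite-dimensional summand, which the infinite-dimensional function
  space absorbs unless \<open>B\<close> is finite as well.
\<close>

lemma good_with_null_sequence:
  assumes K: "closedin mtopology (B \<union> D)" and B: "closedin mtopology B" "good B" and BD: "B \<inter> D = {}"
    and iso: "\<And>x. x \<in> D \<Longrightarrow> openin mtopology {x}"
    and cofin: "\<And>U. openin mtopology U \<Longrightarrow> B \<subseteq> U \<Longrightarrow> finite (D - U)"
  shows "good (B \<union> D)"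
proof (cases "finite D")
  case True
  have KM: "B \<union> D \<subseteq> M" using K closedM by blast
  show ?thesis
  proof (cases "finite B")
    case False
    have dec: "Cp_on mtopology (D \<union> B) \<simeq> Cp_on mtopology D \<oplus> Cp_on mtopology B"
    proof (rule Cp_on_disjoint_union[of D B mtopology D "M - D"])
      have "openin mtopology (\<Union>x\<in>D. {x})" using iso by blast
      then show "openin mtopology D" by simp
      show "openin mtopology (M - D)" using closedin_finite_subset[OF True] KM by (simp add: openin_diff)
    qed (use KM BD in auto)
    have c: "closedin mtopology (D \<union> B)" using K by (simp add: Un_commute)
    have g: "good D" "D \<subseteq> M" "squarable (Cp_on mtopology B)"
      using True KM B(2) False by (auto simp: good_def)
    have "good (D \<union> B)" by (rule good_if_decomposes[OF c g(1,2) dec g(3)])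
    then show ?thesis by (simp add: Un_commute)
  qed (use True in \<open>simp add: good_def\<close>)
next
  case False
  have KM: "B \<union> D \<subseteq> M" using K closedM by blast
  have "B \<noteq> {}" using cofin[of "{}"] False by auto
  have "Cp_vanishing mtopology (B \<union> D) B = coord_space False D"
  proof (rule Cp_vanishing_null_sequence)
    show "t1_space mtopology" by (rule Hausdorff_imp_t1_space[OF Hausdorff_space_mtopology])
    show "\<exists>U. openin mtopology U \<and> U \<inter> (B \<union> D) = {x}" if "x \<in> D" for x
      using iso[OF that] that by (intro exI[of _ "{x}"]) auto
  qed (use KM BD cofin in auto)
  then have "Cp_on mtopology (B \<union> D) \<simeq> Cp_on mtopology B \<oplus> coord_space False D"
    using Cp_on_decomposition[OF B(1) \<open>B \<noteq> {}\<close> _ KM] by simp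
  then show ?thesis using good_if_decomposes[OF K B(2)] squarable_coord_space[OF False] KM by blast
qed

text \<open>
  The pieces are the differences of consecutive members of a neighbourhood base of \<open>B\<close>. The added points
  are those of the finite pieces. Every neighbourhood of \<open>B\<close> contains all but finitely many pieces, hence
  all but finitely many of the added points.
\<close>

lemma good_compact_remainder:
  assumes Z: "clopen Z" and B: "compactin mtopology B" "B \<subseteq> Z" "good B" and rest: "Z - B \<subseteq> good_region"
  shows "good Z"
proof -
  have Zc: "closedin mtopology Z" using Z by (simp add: clopen_def)
  have Bc: "closedin mtopology B" using compactin_imp_closedin[OF Hausdorff_space_mtopology B(1)] .
  have ZM: "Z \<subseteq> M" using clopen_subset[OF Z] .
  obtain G where G: "\<And>n. clopen (G n)" "\<And>n. B \<subseteq> G n" "G 0 = Z" "\<And>n. G (Suc n) \<subseteq> G n"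
    and base: "\<And>U. openin mtopology U \<Longrightarrow> B \<subseteq> U \<Longrightarrow> \<exists>n. G n \<subseteq> U"
    using compact_clopen_neighbourhood_base[OF B(1,2) Z] by blast
  have mono: "G n \<subseteq> G m" if "m \<le> n" for m n using lift_Suc_antimono_le[of G, OF G(4) that] .
  define S where "S n = G n - G (Suc n)" for n
  have Sc: "clopen (S n)" for n unfolding S_def using G(1) clopen_Diff by blast
  have Ssub: "S n \<subseteq> Z - B" for n using mono[of 0 n] G(2,3) unfolding S_def by blast
  have Sdisj: "S m \<inter> S n = {}" if "m < n" for m n using mono[of "Suc m" n] that unfolding S_def by auto
  have Sgood: "good (S n)" for n using good_clopen_in_good_region[OF Sc] Ssub rest by blast
  define F where "F U = (if finite U then U else {})" for U :: "'a set"
  define D where "D = (\<Union>U\<in>range S. F U)"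
  have part: "disjoint (range S)" "\<Union>(range S) = Z - B"
  proof -
    show "disjoint (range S)"
    proof (rule pairwiseI)
      fix x y assume "x \<in> range S" "y \<in> range S" "x \<noteq> y"
      then obtain m n where "x = S m" "y = S n" "m \<noteq> n" by blast
      then show "disjnt x y" using Sdisj[of m n] Sdisj[of n m] by (cases "m < n") (auto simp: disjnt_def)
    qed
    show "\<Union>(range S) = Z - B"
    proof (intro subset_antisym subsetI)
      fix x assume x: "x \<in> Z - B"
      have "openin mtopology (M - {x})" by (rule openin_delete) simp
      moreover have "B \<subseteq> M - {x}" using x B(2) ZM by blast
      ultimately obtain n where "x \<notin> G n" using base by blast
      then have "\<exists>n. x \<notin> G n" by blast
      define k where "k = (LEAST n. x \<notin> G n)"
      have k: "x \<notin> G k" "\<And>j. j < k \<Longrightarrow> x \<in> G j"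
        using LeastI_ex[OF \<open>\<exists>n. x \<notin> G n\<close>] not_less_Least unfolding k_def by blast+
      then obtain j where "k = Suc j" using x G(3) by (cases k) auto
      then show "x \<in> \<Union>(range S)" using k unfolding S_def by blast
    qed (use Ssub in blast)
  qed
  have iso: "openin mtopology {x}" if "U \<in> range S" "x \<in> F U" for U x
    using open_singleton_in_finite[of U x] that Sc by (auto simp: F_def clopen_def split: if_splits)
  have cofin: "finite (D - U)" if U: "openin mtopology U" "B \<subseteq> U" for U
  proof -
    obtain n where n: "G n \<subseteq> U" using base[OF U] by blast
    have "D - U \<subseteq> (\<Union>m\<in>{..<n}. F (S m))"
    proof
      fix x assume x: "x \<in> D - U"
      then obtain m where m: "x \<in> F (S m)" unfolding D_def by blast
      then have "x \<in> G m" unfolding F_def S_def by (auto split: if_splits)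
      then have "m < n" using x n mono[of n m] by (cases "m < n") auto
      then show "x \<in> (\<Union>m\<in>{..<n}. F (S m))" using m by blast
    qed
    moreover have "finite (\<Union>m\<in>{..<n}. F (S m))" by (auto simp: F_def)
    ultimately show ?thesis by (rule finite_subset)
  qed
  have Fsub: "finite (F U) \<and> F U \<subseteq> U" for U by (simp add: F_def)
  have Kc: "closedin mtopology (B \<union> D)"
    unfolding D_def using Sc by (intro closed_with_exceptional_points[OF Zc B(2) part _ Fsub]) auto
  have "B \<inter> D = {}"
  proof -
    have "D \<subseteq> \<Union>(range S)" using Fsub unfolding D_def by blast
    then show ?thesis using part(2) by blast
  qed
  then have "good (B \<union> D)"
    using good_with_null_sequence[OF Kc Bc B(3) _ _ cofin] iso unfolding D_def by blast
  show ?thesis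
  proof (rule good_with_exceptional_points[OF Zc B(2) part])
    show "shrinks_to (range S) B"
      unfolding shrinks_to_def
    proof (intro allI impI)
      fix O' a assume O': "openin mtopology O'" "B \<subseteq> O'" "a \<in> B"
      obtain n where n: "G n \<subseteq> O'" using base[OF O'(1,2)] by blast
      have "S m \<subseteq> O'" if "S m \<inter> G n \<noteq> {}" for m
      proof -
        have "n \<le> m" using that mono[of "Suc m" n] unfolding S_def by (cases "n \<le> m") auto
        then show ?thesis using mono[of n m] n unfolding S_def by blast
      qed
      then have "\<forall>U\<in>range S. U \<inter> G n \<noteq> {} \<longrightarrow> U \<subseteq> O'" by blast
      moreover have "a \<in> G n" "openin mtopology (G n)" using G(1,2) O'(3) unfolding clopen_def by blast+
      ultimately show "\<exists>N. openin mtopology N \<and> a \<in> N \<and> (\<forall>U\<in>range S. U \<inter> N \<noteq> {} \<longrightarrow> U \<subseteq> O')" by blast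
    qed
    show "U - F U = {} \<or> squarable (Cp_on mtopology (U - F U))" if "U \<in> range S" for U
      using Sgood that by (auto simp: F_def good_def)
    show "good (B \<union> (\<Union>U\<in>range S. F U))" using \<open>good (B \<union> D)\<close> by (simp add: D_def)
  qed (use Sc Fsub iso in auto)
qed

section \<open>Nowhere locally compact remainders\<close>

text \<open>
  From each finite piece all points are added to \<open>B\<close>, and from each infinite piece one isolated point, if
  there is any. Under the first alternative nothing is added, and under the second one the added points
  accumulate at every point of \<open>B\<close>.
\<close>

lemma good_nowhere_locally_compact_remainder:
  assumes Z: "clopen Z" and B: "closedin mtopology B" "B \<subseteq> Z" and rest: "Z - B \<subseteq> good_region"
    and iso: "(\<forall>x\<in>Z. \<not> openin mtopology {x}) \<or>
      (\<forall>U. openin mtopology U \<longrightarrow> U \<inter> B \<noteq> {} \<longrightarrow> (\<exists>x\<in>U. openin mtopology {x}))"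
    and nlc: "\<And>V. clopen V \<Longrightarrow> V \<inter> B \<noteq> {} \<Longrightarrow> \<not> compactin mtopology (V \<inter> B)"
  shows "good Z"
proof (cases "B = {}")
  case True
  then show ?thesis using good_clopen_in_good_region[OF Z] rest by simp
next
  case False
  have Zc: "closedin mtopology Z" using Z by (simp add: clopen_def)
  have ZM: "Z \<subseteq> M" using clopen_subset[OF Z] .
  have "\<exists>\<U>. clopen_partition \<U> (Z - B) \<and> relatively_small \<U> B \<and> (\<forall>U\<in>\<U>. True)"
    using Z B clopen_M
    by (intro relatively_small_partition_exists) (auto simp: clopen_def openin_diff subset_iff dest: openM)
  then obtain \<U> where pt: "clopen_partition \<U> (Z - B)" and rel: "relatively_small \<U> B" by blast
  have part: "disjoint \<U>" "\<Union>\<U> = Z - B" and Uc: "\<And>U. U \<in> \<U> \<Longrightarrow> clopen U"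
    using pt by (simp_all add: clopen_partition_def)
  have near: "\<exists>N. openin mtopology N \<and> a \<in> N \<and> (\<forall>U\<in>\<U>. U \<inter> N \<noteq> {} \<longrightarrow> U \<subseteq> G)"
    if "openin mtopology G" "a \<in> B" "a \<in> G" for G a
    using relatively_small_shrink[OF rel clopen_subset[OF Uc] that] by blast
  define F where "F U = (if finite U then U else if \<exists>x\<in>U. openin mtopology {x}
      then {SOME x. x \<in> U \<and> openin mtopology {x}} else {})" for U
  have some: "(SOME x. x \<in> U \<and> openin mtopology {x}) \<in> U \<and> openin mtopology {SOME x. x \<in> U \<and> openin mtopology {x}}"
    if "\<exists>x\<in>U. openin mtopology {x}" for U
    using someI_ex[of "\<lambda>x. x \<in> U \<and> openin mtopology {x}"] that by blast
  have Fsub: "finite (F U) \<and> F U \<subseteq> U" for U using some[of U] by (simp add: F_def)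
  have Fiso: "openin mtopology {x}" if "U \<in> \<U>" "x \<in> F U" for U x
  proof (cases "finite U")
    case True
    then show ?thesis using open_singleton_in_finite[of U x] Uc[OF that(1)] that(2) by (simp add: F_def clopen_def)
  next
    case False
    then show ?thesis using that(2) some[of U] by (auto simp: F_def split: if_splits)
  qed
  have Fne: "F U \<noteq> {}" if "x \<in> U" "openin mtopology {x}" for U x using that by (auto simp: F_def)
  have sq: "U - F U = {} \<or> squarable (Cp_on mtopology (U - F U))" if "U \<in> \<U>" for U
  proof (cases "finite U")
    case True
    then show ?thesis by (simp add: F_def)
  next
    case False
    have "closedin mtopology (F U)"
      using Fsub[of U] clopen_subset[OF Uc[OF that]] by (intro closedin_finite_subset) auto
    moreover have "openin mtopology (F U)"
    proof -
      have "openin mtopology (\<Union>x\<in>F U. {x})" using Fiso[OF that] by blast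
      then show ?thesis by simp
    qed
    ultimately have "clopen (U - F U)" using clopen_Diff[OF Uc[OF that], of "F U"] by (simp add: clopen_def)
    moreover have "U - F U \<subseteq> good_region" using rest part(2) that by blast
    ultimately have "good (U - F U)" by (rule good_clopen_in_good_region)
    moreover have "infinite (U - F U)" using False Fsub[of U] by simp
    ultimately show ?thesis by (simp add: good_def)
  qed
  define D where "D = (\<Union>U\<in>\<U>. F U)"
  have Kc: "closedin mtopology (B \<union> D)"
    unfolding D_def by (rule closed_with_exceptional_points[OF Zc B(2) part Uc Fsub])
  have "D \<subseteq> \<Union>\<U>" using Fsub unfolding D_def by blast
  then have DB: "(B \<union> D) - B = D" and DZ: "D \<subseteq> Z" unfolding part(2) by blast+
  have "good (B \<union> D)"
  proof (rule good_nowhere_locally_compact[OF Kc B(1) _ False])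
    show "\<exists>U. openin mtopology U \<and> U \<inter> (B \<union> D) = {x}" if "x \<in> (B \<union> D) - B" for x
    proof -
      have "x \<in> D" using that by blast
      then have "openin mtopology {x}" using Fiso unfolding D_def by blast
      then show ?thesis using that by (intro exI[of _ "{x}"]) auto
    qed
    show "B \<union> D = B \<or> (\<forall>U. openin mtopology U \<longrightarrow> U \<inter> B \<noteq> {} \<longrightarrow> U \<inter> (B \<union> D - B) \<noteq> {})"
      using iso
    proof
      assume no: "\<forall>x\<in>Z. \<not> openin mtopology {x}"
      have "D = {}"
      proof (rule ccontr)
        assume "D \<noteq> {}"
        then obtain U x where "U \<in> \<U>" "x \<in> F U" unfolding D_def by blast
        then have "openin mtopology {x}" "x \<in> D" using Fiso unfolding D_def by blast+
        then show False using no DZ by blast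
      qed
      then show ?thesis by simp
    next
      assume dn: "\<forall>U. openin mtopology U \<longrightarrow> U \<inter> B \<noteq> {} \<longrightarrow> (\<exists>x\<in>U. openin mtopology {x})"
      have "U \<inter> D \<noteq> {}" if U: "openin mtopology U" "U \<inter> B \<noteq> {}" for U
      proof -
        obtain a where a: "a \<in> B" "a \<in> U" using U(2) by blast
        obtain N where N: "openin mtopology N" "a \<in> N" "\<forall>W\<in>\<U>. W \<inter> N \<noteq> {} \<longrightarrow> W \<subseteq> U"
          using near[OF U(1) a] by blast
        have "openin mtopology (N \<inter> Z)" using N(1) Z by (simp add: clopen_def openin_Int)
        moreover have "N \<inter> Z \<inter> B \<noteq> {}" using a N(2) B(2) by blast
        ultimately obtain x where x: "x \<in> N \<inter> Z" "openin mtopology {x}" using dn by blast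
        have "x \<notin> B"
        proof
          assume "x \<in> B"
          have "clopen {x}" using x ZM closedin_finite_subset[of "{x}"] by (auto simp: clopen_def)
          moreover have "compactin mtopology ({x} \<inter> B)"
            using x ZM \<open>x \<in> B\<close> by (auto simp: compactin_sing)
          ultimately show False using nlc \<open>x \<in> B\<close> by blast
        qed
        then have "x \<in> \<Union>\<U>" unfolding part(2) using x by blast
        then obtain W where W: "W \<in> \<U>" "x \<in> W" by blast
        then have "W \<subseteq> U" using N(3) x(1) by blast
        moreover have "F W \<noteq> {}" using Fne[OF W(2) x(2)] .
        ultimately show ?thesis using Fsub[of W] W(1) unfolding D_def by blast
      qed
      then show ?thesis unfolding DB by blast
    qed
    show "\<not> compactin mtopology (V \<inter> B)" if "clopen V" "V \<inter> B \<noteq> {}" for V using nlc[OF that] .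
  qed blast
  then show ?thesis
  proof (intro good_with_exceptional_points[OF Zc B(2) part _ Uc Fsub Fiso sq])
    show "shrinks_to \<U> B" unfolding shrinks_to_def using near by blast
  qed (simp_all add: D_def)
qed

section \<open>Every zero-dimensional Polish space is good\<close>

text \<open>
  Let \<open>A\<close> be the complement of the good region. In each case a hereditarily good clopen set meeting \<open>A\<close> is
  found, which contradicts the choice of \<open>A\<close>.
\<close>

lemma good_space: "good M"
proof -
  define A where "A = M - good_region"
  have Ac: "closedin mtopology A" using openin_good_region by (auto simp: A_def)
  have AM: "A \<subseteq> M" by (auto simp: A_def)
  have rest: "Z - Z \<inter> A \<subseteq> good_region" if "clopen Z" for Z using clopen_subset[OF that] by (auto simp: A_def)
  have ZA: "closedin mtopology (Z \<inter> A)" if "clopen Z" for Z using that Ac by (auto simp: clopen_def)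
  have contra: "W \<inter> A = {}" if "hereditarily_good W" for W using that by (auto simp: A_def good_region_def)
  have "A = {}"
  proof (rule ccontr)
    assume "A \<noteq> {}"
    show False
    proof (cases "\<exists>W. clopen W \<and> W \<inter> A \<noteq> {} \<and> compactin mtopology (W \<inter> A)")
      case True
      then obtain W where W: "clopen W" "W \<inter> A \<noteq> {}" "compactin mtopology (W \<inter> A)" by blast
      show False
      proof (cases "\<exists>a U. openin mtopology U \<and> U \<inter> A = {a}")
        case True
        then obtain a U where U: "openin mtopology U" "U \<inter> A = {a}" by blast
        then obtain V where V: "clopen V" "a \<in> V" "V \<subseteq> U" using clopen_neighbourhood[OF U(1), of a] by blast
        have "good Z" if Z: "clopen Z" "Z \<subseteq> V" for Z
        proof -
          have "Z \<inter> A \<subseteq> {a}" using Z V U by blast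
          then have fin: "finite (Z \<inter> A)" by (rule finite_subset) simp
          then have "compactin mtopology (Z \<inter> A)" using AM by (intro finite_imp_compactin) auto
          then show ?thesis using good_compact_remainder[OF Z(1) _ _ _ rest[OF Z(1)]] fin by (simp add: good_def)
        qed
        then have "hereditarily_good V" using V by (simp add: hereditarily_good_def)
        then show False using contra V U by blast
      next
        case False
        have "good Z" if Z: "clopen Z" "Z \<subseteq> W" for Z
        proof -
          have "Z \<inter> A \<subseteq> W \<inter> A" using Z by blast
          then have c: "compactin mtopology (Z \<inter> A)" using closed_compactin[OF W(3) _ ZA[OF Z(1)]] by blast
          have "good (Z \<inter> A)"
          proof (rule good_compact_perfect[OF c])
            fix x U assume "openin mtopology U"
            then have "openin mtopology (U \<inter> Z)" using Z(1) by (simp add: clopen_def openin_Int)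
            then show "U \<inter> (Z \<inter> A) \<noteq> {x}" using False by (metis Int_assoc)
          qed
          then show ?thesis using good_compact_remainder[OF Z(1) c _ _ rest[OF Z(1)]] by simp
        qed
        then have "hereditarily_good W" using W by (simp add: hereditarily_good_def)
        then show False using contra W by blast
      qed
    next
      case False
      then have nlc: "\<not> compactin mtopology (V \<inter> (Z \<inter> A))" if "clopen V" "clopen Z" "V \<inter> (Z \<inter> A) \<noteq> {}" for V Z
        using clopen_Int[OF that(1,2)] that(3) by (metis Int_assoc)
      show False
      proof (cases "\<exists>W. clopen W \<and> W \<inter> A \<noteq> {} \<and> (\<forall>x\<in>W. \<not> openin mtopology {x})")
        case True
        then obtain W where W: "clopen W" "W \<inter> A \<noteq> {}" "\<forall>x\<in>W. \<not> openin mtopology {x}" by blast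
        have "good Z" if Z: "clopen Z" "Z \<subseteq> W" for Z
        proof (rule good_nowhere_locally_compact_remainder[OF Z(1) ZA[OF Z(1)] _ rest[OF Z(1)]])
          show "(\<forall>x\<in>Z. \<not> openin mtopology {x}) \<or>
            (\<forall>U. openin mtopology U \<longrightarrow> U \<inter> (Z \<inter> A) \<noteq> {} \<longrightarrow> (\<exists>x\<in>U. openin mtopology {x}))"
            using W(3) Z(2) by blast
        qed (use nlc Z(1) in auto)
        then have "hereditarily_good W" using W by (simp add: hereditarily_good_def)
        then show False using contra W by blast
      next
        (* Isolated points now accumulate at every point of A, so the argument applies to all of M. *)
        case nW: False
        have "good Z" if Z: "clopen Z" for Z
        proof (rule good_nowhere_locally_compact_remainder[OF Z ZA[OF Z] _ rest[OF Z]])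
          have "\<exists>x\<in>U. openin mtopology {x}" if U: "openin mtopology U" "U \<inter> (Z \<inter> A) \<noteq> {}" for U
          proof -
            obtain a where a: "a \<in> U" "a \<in> A" using U(2) by blast
            obtain V where V: "clopen V" "a \<in> V" "V \<subseteq> U" using clopen_neighbourhood[OF U(1) a(1)] by blast
            then have "\<exists>x\<in>V. openin mtopology {x}" using nW a(2) by blast
            then show ?thesis using V(3) by blast
          qed
          then show "(\<forall>x\<in>Z. \<not> openin mtopology {x}) \<or>
            (\<forall>U. openin mtopology U \<longrightarrow> U \<inter> (Z \<inter> A) \<noteq> {} \<longrightarrow> (\<exists>x\<in>U. openin mtopology {x}))" by blast
        qed (use nlc Z in auto)
        then have "hereditarily_good M" using clopen_M by (simp add: hereditarily_good_def)
        then show False using contra[of M] AM \<open>A \<noteq> {}\<close> by blast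
      qed
    qed
  qed
  then show ?thesis using good_clopen_in_good_region[OF clopen_M] by (auto simp: A_def)
qed

end

section \<open>The statement in terms of neighbourhoods and extended norms\<close>

lemma zero_neighbourhood_coordinates:
  fixes E :: "('i \<Rightarrow> real) set"
  assumes "finite I" "\<delta> > 0" "0 \<in> E"
  shows "zero_neighbourhood E {f \<in> E. \<forall>i\<in>I. \<bar>f i\<bar> < \<delta>}"
proof -
  have "open (\<Inter>i\<in>I. {f :: 'i \<Rightarrow> real. \<bar>f i\<bar> < \<delta>})"
    using assms(1) by (intro open_INT ballI open_Collect_less continuous_intros continuous_on_product_coordinates)
  then have "openin (top_of_set E) (E \<inter> (\<Inter>i\<in>I. {f. \<bar>f i\<bar> < \<delta>}))" by (rule openin_open_Int)
  moreover have "E \<inter> (\<Inter>i\<in>I. {f. \<bar>f i\<bar> < \<delta>}) = {f \<in> E. \<forall>i\<in>I. \<bar>f i\<bar> < \<delta>}" by auto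
  ultimately show ?thesis unfolding zero_neighbourhood_def using assms(2,3)
    by (intro conjI exI[of _ "{f \<in> E. \<forall>i\<in>I. \<bar>f i\<bar> < \<delta>}"]) auto
qed

lemma open_contains_coordinate_box:
  fixes T :: "('i \<Rightarrow> real) set"
  assumes "open T" "0 \<in> T"
  shows "\<exists>I \<delta>. finite I \<and> \<delta> > 0 \<and> {f. \<forall>i\<in>I. \<bar>f i\<bar> < \<delta>} \<subseteq> T"
proof -
  have "openin (product_topology (\<lambda>i. euclidean) UNIV) T" using assms(1) by (simp add: open_fun_def)
  from product_topology_open_contains_basis[OF this assms(2)]
  obtain Y where Y: "0 \<in> (\<Pi>\<^sub>E i\<in>UNIV. Y i)" "\<And>i. open (Y i)" "finite {i. Y i \<noteq> UNIV}"
    "(\<Pi>\<^sub>E i\<in>UNIV. Y i) \<subseteq> T" by auto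
  define I where "I = {i. Y i \<noteq> UNIV}"
  have "\<exists>e>0. ball 0 e \<subseteq> Y i" for i using Y(1,2) open_contains_ball[of "Y i"] by (auto simp: PiE_def Pi_def)
  then obtain e where e: "\<And>i. e i > 0" "\<And>i. ball 0 (e i) \<subseteq> Y i" by metis
  define \<delta> where "\<delta> = Min (insert 1 (e ` I))"
  have fin: "finite I" using Y(3) by (simp add: I_def)
  have \<delta>: "\<delta> > 0" "\<And>i. i \<in> I \<Longrightarrow> \<delta> \<le> e i" using fin e(1) by (auto simp: \<delta>_def)
  have "f \<in> T" if f: "\<forall>i\<in>I. \<bar>f i\<bar> < \<delta>" for f
  proof -
    have "f i \<in> Y i" for i
    proof (cases "i \<in> I")
      case True
      then have "\<bar>f i\<bar> < e i" using f \<delta>(2)[OF True] by force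
      then show ?thesis using e(2)[of i] by (auto simp: dist_real_def)
    qed (simp add: I_def)
    then have "f \<in> (\<Pi>\<^sub>E i\<in>UNIV. Y i)" by (simp add: PiE_def Pi_def)
    then show ?thesis using Y(4) by blast
  qed
  then show ?thesis using fin \<delta>(1) by blast
qed

lemma zero_neighbourhood_contains_box:
  fixes E :: "('i \<Rightarrow> real) set"
  assumes "zero_neighbourhood E U"
  shows "\<exists>I \<delta>. finite I \<and> \<delta> > 0 \<and> {f \<in> E. \<forall>i\<in>I. \<bar>f i\<bar> < \<delta>} \<subseteq> U"
proof -
  obtain W T where W: "W \<subseteq> U" "0 \<in> W" "open T" "W = E \<inter> T"
    using assms unfolding zero_neighbourhood_def openin_open by blast
  then obtain I \<delta> where "finite I" "\<delta> > 0" "{f. \<forall>i\<in>I. \<bar>f i\<bar> < \<delta>} \<subseteq> T"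
    using open_contains_coordinate_box[of T] by blast
  then show ?thesis using W by (intro exI[of _ I] exI[of _ \<delta>]) auto
qed

lemma zero_neighbourhood_Times_contains_box:
  fixes E :: "('i \<Rightarrow> real) set" and F :: "('j \<Rightarrow> real) set"
  assumes "zero_neighbourhood (E \<times> F) U"
  shows "\<exists>I J \<delta>. finite I \<and> finite J \<and> \<delta> > 0 \<and>
    {p \<in> E \<times> F. (\<forall>i\<in>I. \<bar>fst p i\<bar> < \<delta>) \<and> (\<forall>j\<in>J. \<bar>snd p j\<bar> < \<delta>)} \<subseteq> U"
proof -
  obtain W where "openin (top_of_set (E \<times> F)) W" "W \<subseteq> U" "0 \<in> W"
    using assms unfolding zero_neighbourhood_def by blast
  moreover then obtain T where "open T" "W = (E \<times> F) \<inter> T" unfolding openin_open by blast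
  ultimately have W: "W \<subseteq> U" "0 \<in> W" "open T" "W = (E \<times> F) \<inter> T" by simp_all
  then have "(0, 0) \<in> T" by (auto simp: zero_prod_def)
  then obtain A B where AB: "open A" "open B" "0 \<in> A" "0 \<in> B" "A \<times> B \<subseteq> T"
    using open_prod_elim[OF W(3), of "(0, 0)"] by (metis mem_Sigma_iff)
  obtain I \<delta> where I: "finite I" "\<delta> > 0" "{f. \<forall>i\<in>I. \<bar>f i\<bar> < \<delta>} \<subseteq> A"
    using open_contains_coordinate_box[OF AB(1,3)] by blast
  obtain J \<eta> where J: "finite J" "\<eta> > 0" "{f. \<forall>i\<in>J. \<bar>f i\<bar> < \<eta>} \<subseteq> B"
    using open_contains_coordinate_box[OF AB(2,4)] by blast
  show ?thesis
  proof (intro exI conjI subsetI)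
    show "min \<delta> \<eta> > 0" using I J by simp
    fix p assume p: "p \<in> {p \<in> E \<times> F. (\<forall>i\<in>I. \<bar>fst p i\<bar> < min \<delta> \<eta>) \<and> (\<forall>j\<in>J. \<bar>snd p j\<bar> < min \<delta> \<eta>)}"
    then have "fst p \<in> A" "snd p \<in> B" using I(3) J(3) by auto
    then have "p \<in> T" using AB(5) by (metis mem_Times_iff subsetD)
    then show "p \<in> U" using p W by blast
  qed (use I J in auto)
qed

lemma zero_neighbourhood_Times_coordinates:
  fixes E :: "('i \<Rightarrow> real) set" and F :: "('j \<Rightarrow> real) set"
  assumes "finite I" "finite J" "\<delta> > 0" "0 \<in> E" "0 \<in> F"
  shows "zero_neighbourhood (E \<times> F) {p \<in> E \<times> F. (\<forall>i\<in>I. \<bar>fst p i\<bar> < \<delta>) \<and> (\<forall>j\<in>J. \<bar>snd p j\<bar> < \<delta>)}"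
proof -
  let ?A = "\<Inter>i\<in>I. {f :: 'i \<Rightarrow> real. \<bar>f i\<bar> < \<delta>}" and ?B = "\<Inter>j\<in>J. {f :: 'j \<Rightarrow> real. \<bar>f j\<bar> < \<delta>}"
  have "open ?A" using assms(1)
    by (intro open_INT ballI open_Collect_less continuous_intros continuous_on_product_coordinates)
  moreover have "open ?B" using assms(2)
    by (intro open_INT ballI open_Collect_less continuous_intros continuous_on_product_coordinates)
  ultimately have "openin (top_of_set (E \<times> F)) ((E \<times> F) \<inter> (?A \<times> ?B))" by (intro openin_open_Int open_Times)
  moreover have "(E \<times> F) \<inter> (?A \<times> ?B) = {p \<in> E \<times> F. (\<forall>i\<in>I. \<bar>fst p i\<bar> < \<delta>) \<and> (\<forall>j\<in>J. \<bar>snd p j\<bar> < \<delta>)}" by auto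
  ultimately show ?thesis unfolding zero_neighbourhood_def using assms(3-5)
    by (intro conjI exI[of _ "{p \<in> E \<times> F. (\<forall>i\<in>I. \<bar>fst p i\<bar> < \<delta>) \<and> (\<forall>j\<in>J. \<bar>snd p j\<bar> < \<delta>)}"])
       (auto simp: zero_prod_def)
qed

lemma sup_norm_le_iff: "s \<ge> 0 \<Longrightarrow> sup_norm X f \<le> ennreal s \<longleftrightarrow> (\<forall>x\<in>topspace X. \<bar>f x\<bar> \<le> s)"
  by (simp add: sup_norm_def SUP_le_iff)

text \<open>
  This converts bounds by real numbers into an inequality between extended norms.
\<close>

lemma ennreal_le_if_real_bounds:
  fixes a b :: ennreal
  assumes "\<And>s. s \<ge> 0 \<Longrightarrow> b \<le> ennreal s \<Longrightarrow> a \<le> ennreal s"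
  shows "a \<le> b"
proof (cases b)
  case (real s)
  then show ?thesis using assms[of s] by simp
qed simp

text \<open>
  The pair \<open>p\<close> as one function on the disjoint sum, multiplied by \<open>c\<close>; \<open>split_scaled c\<close> is the inverse.
\<close>

definition join :: "real \<Rightarrow> ('i \<Rightarrow> real) \<times> ('j \<Rightarrow> real) \<Rightarrow> 'i + 'j \<Rightarrow> real" where
  "join c p = case_sum (\<lambda>i. c * fst p i) (\<lambda>j. c * snd p j)"

definition split_scaled :: "real \<Rightarrow> ('i + 'j \<Rightarrow> real) \<Rightarrow> ('i \<Rightarrow> real) \<times> ('j \<Rightarrow> real)" where
  "split_scaled c h = ((\<lambda>i. h (Inl i) / c), (\<lambda>j. h (Inr j) / c))"

lemma Cp_scale: "f \<in> Cp X \<Longrightarrow> (\<lambda>x. a * f x) \<in> Cp X"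
  by (auto simp: Cp_def continuous_map_real_mult_left)

lemma zero_in_Cp: "0 \<in> Cp X"
  by (auto simp: Cp_def zero_fun_def)

lemma coord_unif_contD:
  assumes "coord_unif_cont E u" "finite J" "\<epsilon> > 0"
  shows "\<exists>I \<delta>. finite I \<and> \<delta> > 0 \<and>
    (\<forall>f\<in>E. \<forall>g\<in>E. (\<forall>i\<in>I. \<bar>f i - g i\<bar> < \<delta>) \<longrightarrow> (\<forall>j\<in>J. \<bar>u f j - u g j\<bar> < \<epsilon>))"
  using assms(2)
proof (induction J)
  case empty
  then show ?case by (intro exI[of _ "{}"] exI[of _ 1]) auto
next
  case (insert j J)
  obtain I \<delta> where I: "finite I" "\<delta> > 0"
    "\<And>f g. f \<in> E \<Longrightarrow> g \<in> E \<Longrightarrow> (\<forall>i\<in>I. \<bar>f i - g i\<bar> < \<delta>) \<Longrightarrow> (\<forall>j\<in>J. \<bar>u f j - u g j\<bar> < \<epsilon>)"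
    using insert.IH by blast
  obtain I' \<delta>' where I': "finite I'" "\<delta>' > 0"
    "\<And>f g. f \<in> E \<Longrightarrow> g \<in> E \<Longrightarrow> (\<forall>i\<in>I'. \<bar>f i - g i\<bar> < \<delta>') \<Longrightarrow> \<bar>u f j - u g j\<bar> < \<epsilon>"
    using assms(1)[unfolded coord_unif_cont_def, rule_format, OF assms(3), of j] by blast
  show ?case
  proof (intro exI[of _ "I \<union> I'"] exI[of _ "min \<delta> \<delta>'"] conjI ballI impI)
    fix f g k assume a: "f \<in> E" "g \<in> E" "\<forall>i\<in>I \<union> I'. \<bar>f i - g i\<bar> < min \<delta> \<delta>'" "k \<in> insert j J"
    then show "\<bar>u f k - u g k\<bar> < \<epsilon>" using I(3)[OF a(1,2)] I'(3)[OF a(1,2)] by auto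
  qed (use I I' in auto)
qed

text \<open>
  A pair of maps with distortion at most \<open>c = sqrt (1 + \<epsilon>)\<close> in both directions is rescaled: dividing the
  values by \<open>c\<close> makes the map norm-decreasing and leaves a loss of at most \<open>c\<^sup>2 = 1 + \<epsilon>\<close>.
\<close>

lemma bumpeq_if_squarable:
  assumes "squarable (Cp X)"
  shows "bumpeq (Cp X) (sup_norm X) (Cp X \<times> Cp X) (prod_ext_norm (sup_norm X) (sup_norm X))"
  unfolding bumpeq_def
proof (intro allI impI)
  fix \<epsilon> :: real assume \<epsilon>: "\<epsilon> > 0"
  let ?E = "Cp X"
  (* The square root leaves room for the factor that is lost by rescaling. *)
  define c where "c = sqrt (1 + \<epsilon>)"
  have c: "c > 1" "c * c = 1 + \<epsilon>" using \<epsilon> by (auto simp: c_def)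
  obtain u v where uv: "tame_pair c ?E (?E \<oplus> ?E) u v"
    using assms c(1) unfolding squarable_def similar_def by blast
  have u: "\<And>f. f \<in> ?E \<Longrightarrow> u f \<in> ?E \<oplus> ?E" "coord_unif_cont ?E u" "sup_bound c ?E u"
    and v: "\<And>h. h \<in> ?E \<oplus> ?E \<Longrightarrow> v h \<in> ?E" "coord_unif_cont (?E \<oplus> ?E) v" "sup_bound c (?E \<oplus> ?E) v"
    and vu: "\<And>f. f \<in> ?E \<Longrightarrow> v (u f) = f" and uv': "\<And>h. h \<in> ?E \<oplus> ?E \<Longrightarrow> u (v h) = h"
    using uv by (auto simp: tame_pair_def tame_def)
  have sub: "subspace ?E" using linear_topological_space_Cp[of X] by (simp add: linear_topological_space_def)
  define w where "w f = split_scaled c (u f)" for f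
  define z where "z p = v (join c p)" for p
  have js: "join c (split_scaled c h) = h" for h :: "'a + 'a \<Rightarrow> real"
    using c by (auto simp: join_def split_scaled_def fun_eq_iff split: sum.split)
  have sj: "split_scaled c (join c p) = p" for p :: "('a \<Rightarrow> real) \<times> ('a \<Rightarrow> real)"
    using c by (auto simp: join_def split_scaled_def prod_eq_iff)
  have jE: "join c p \<in> ?E \<oplus> ?E" if "p \<in> ?E \<times> ?E" for p
    using that Cp_scale[of "fst p" X c] Cp_scale[of "snd p" X c] by (auto simp: join_def dsum_def comp_def)
  have sE: "split_scaled c h \<in> ?E \<times> ?E" if "h \<in> ?E \<oplus> ?E" for h
    using that Cp_scale[of "h \<circ> Inl" X "1 / c"] Cp_scale[of "h \<circ> Inr" X "1 / c"]
    by (auto simp: split_scaled_def dsum_def comp_def)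
  have wE: "w f \<in> ?E \<times> ?E" if "f \<in> ?E" for f using sE[OF u(1)[OF that]] by (simp add: w_def)
  have zE: "z p \<in> ?E" if "p \<in> ?E \<times> ?E" for p using v(1)[OF jE[OF that]] by (simp add: z_def)
  have zw: "z (w f) = f" if "f \<in> ?E" for f using vu[OF that] by (simp add: w_def z_def js)
  have wz: "w (z p) = p" if "p \<in> ?E \<times> ?E" for p using uv'[OF jE[OF that]] by (simp add: w_def z_def sj)
  have bij: "bij_betw w ?E (?E \<times> ?E)"
  proof (rule bij_betw_byWitness[where f' = z])
    show "w ` ?E \<subseteq> ?E \<times> ?E" using wE by blast
    show "z ` (?E \<times> ?E) \<subseteq> ?E" using zE by blast
  qed (use zw wz in blast)+
  have inv: "inv_into ?E w p = z p" if "p \<in> ?E \<times> ?E" for p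
    using bij_betw_imp_inj_on[OF bij] zE[OF that] wz[OF that] by (metis inv_into_f_f)
  have ucw: "uniformly_continuous_lts ?E (?E \<times> ?E) w"
    unfolding uniformly_continuous_lts_def
  proof (intro allI impI)
    fix U :: "(('a \<Rightarrow> real) \<times> ('a \<Rightarrow> real)) set" assume nU: "zero_neighbourhood (?E \<times> ?E) U"
    obtain I J \<delta> where IJ: "finite I" "finite J" "\<delta> > 0"
      and box: "{p \<in> ?E \<times> ?E. (\<forall>i\<in>I. \<bar>fst p i\<bar> < \<delta>) \<and> (\<forall>j\<in>J. \<bar>snd p j\<bar> < \<delta>)} \<subseteq> U"
      using zero_neighbourhood_Times_contains_box[OF nU] by blast
    have IJ': "finite (I <+> J)" "c * \<delta> > 0" using IJ c by auto
    obtain H \<eta> where H: "finite H" "\<eta> > 0"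
      and Hu: "\<And>f g. f \<in> ?E \<Longrightarrow> g \<in> ?E \<Longrightarrow> (\<forall>i\<in>H. \<bar>f i - g i\<bar> < \<eta>) \<Longrightarrow> (\<forall>j\<in>I <+> J. \<bar>u f j - u g j\<bar> < c * \<delta>)"
      using coord_unif_contD[OF u(2) IJ'] by blast
    show "\<exists>V. zero_neighbourhood ?E V \<and> (\<forall>f\<in>?E. \<forall>g\<in>?E. f - g \<in> V \<longrightarrow> w f - w g \<in> U)"
    proof (intro exI conjI ballI impI)
      show "zero_neighbourhood ?E {f \<in> ?E. \<forall>i\<in>H. \<bar>f i\<bar> < \<eta>}"
        by (rule zero_neighbourhood_coordinates[OF H zero_in_Cp])
      fix f g assume fg: "f \<in> ?E" "g \<in> ?E" "f - g \<in> {f \<in> ?E. \<forall>i\<in>H. \<bar>f i\<bar> < \<eta>}"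
      then have "\<forall>i\<in>H. \<bar>f i - g i\<bar> < \<eta>" by simp
      then have *: "\<forall>j\<in>I <+> J. \<bar>u f j - u g j\<bar> < c * \<delta>" using Hu fg by blast
      have "\<bar>u f j / c - u g j / c\<bar> < \<delta>" if "j \<in> I <+> J" for j
      proof -
        have "\<bar>u f j / c - u g j / c\<bar> = \<bar>u f j - u g j\<bar> / c" using c by (simp add: abs_divide flip: diff_divide_distrib)
        then show ?thesis using *[rule_format, OF that] c by (simp add: divide_less_eq mult.commute)
      qed
      then have m1: "(\<forall>i\<in>I. \<bar>fst (w f - w g) i\<bar> < \<delta>) \<and> (\<forall>j\<in>J. \<bar>snd (w f - w g) j\<bar> < \<delta>)"
        by (auto simp: w_def split_scaled_def)
      have m2: "w f - w g \<in> ?E \<times> ?E"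
        by (rule subspace_diff[OF subspace_Times[OF sub sub] wE wE]) fact+
      have "w f - w g \<in> {p \<in> ?E \<times> ?E. (\<forall>i\<in>I. \<bar>fst p i\<bar> < \<delta>) \<and> (\<forall>j\<in>J. \<bar>snd p j\<bar> < \<delta>)}"
        by (rule CollectI, rule conjI[OF m2 m1])
      then show "w f - w g \<in> U" by (rule subsetD[OF box])
    qed
  qed
  have ucz: "uniformly_continuous_lts (?E \<times> ?E) ?E (inv_into ?E w)"
    unfolding uniformly_continuous_lts_def
  proof (intro allI impI)
    fix U :: "('a \<Rightarrow> real) set" assume nU: "zero_neighbourhood ?E U"
    obtain J \<delta> where J: "finite J" "\<delta> > 0" and box: "{f \<in> ?E. \<forall>i\<in>J. \<bar>f i\<bar> < \<delta>} \<subseteq> U"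
      using zero_neighbourhood_contains_box[OF nU] by blast
    obtain H \<eta> where H: "finite H" "\<eta> > 0"
      and Hv: "\<And>f g. f \<in> ?E \<oplus> ?E \<Longrightarrow> g \<in> ?E \<oplus> ?E \<Longrightarrow> (\<forall>i\<in>H. \<bar>f i - g i\<bar> < \<eta>) \<Longrightarrow> (\<forall>j\<in>J. \<bar>v f j - v g j\<bar> < \<delta>)"
      using coord_unif_contD[OF v(2) J] by blast
    let ?V = "{p \<in> ?E \<times> ?E. (\<forall>i\<in>Inl -` H. \<bar>fst p i\<bar> < \<eta> / c) \<and> (\<forall>j\<in>Inr -` H. \<bar>snd p j\<bar> < \<eta> / c)}"
    show "\<exists>V. zero_neighbourhood (?E \<times> ?E) V \<and>
        (\<forall>p\<in>?E \<times> ?E. \<forall>q\<in>?E \<times> ?E. p - q \<in> V \<longrightarrow> inv_into ?E w p - inv_into ?E w q \<in> U)"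
    proof (intro exI[of _ ?V] conjI ballI impI)
      show "zero_neighbourhood (?E \<times> ?E) ?V"
        using H c by (intro zero_neighbourhood_Times_coordinates zero_in_Cp finite_vimageI) auto
      fix p q assume pq: "p \<in> ?E \<times> ?E" "q \<in> ?E \<times> ?E" "p - q \<in> ?V"
      have sc: "\<bar>c * s - c * t\<bar> < \<eta>" if "\<bar>s - t\<bar> < \<eta> / c" for s t :: real
      proof -
        have "\<bar>c * s - c * t\<bar> = c * \<bar>s - t\<bar>" using c by (simp add: abs_mult flip: right_diff_distrib)
        then show ?thesis using that c by (simp add: less_divide_eq mult.commute)
      qed
      have "\<forall>i\<in>H. \<bar>join c p i - join c q i\<bar> < \<eta>"
      proof
        fix i assume "i \<in> H"
        then show "\<bar>join c p i - join c q i\<bar> < \<eta>" using pq(3) sc by (cases i) (auto simp: join_def)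
      qed
      then have "\<forall>j\<in>J. \<bar>z p j - z q j\<bar> < \<delta>" using Hv[OF jE jE] pq unfolding z_def by blast
      moreover have "z p - z q \<in> ?E"
        by (rule subspace_diff[OF sub zE[OF pq(1)] zE[OF pq(2)]])
      ultimately have "z p - z q \<in> {f \<in> ?E. \<forall>i\<in>J. \<bar>f i\<bar> < \<delta>}" by simp
      then have "z p - z q \<in> U" by (rule subsetD[OF box])
      then show "inv_into ?E w p - inv_into ?E w q \<in> U" by (simp only: inv[OF pq(1)] inv[OF pq(2)])
    qed
  qed
  have glob: "(\<forall>x\<in>topspace X. \<bar>f x\<bar> \<le> s) \<longleftrightarrow> (\<forall>x. \<bar>f x\<bar> \<le> s)" if "f \<in> ?E" "s \<ge> 0" for f s
    using that by (auto simp: Cp_def)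
  have Nle: "prod_ext_norm (sup_norm X) (sup_norm X) (w f) \<le> ennreal s \<longleftrightarrow> (\<forall>j. \<bar>u f j\<bar> \<le> c * s)"
    if "f \<in> ?E" "s \<ge> 0" for f s
  proof -
    have sc: "\<bar>t / c\<bar> \<le> s \<longleftrightarrow> \<bar>t\<bar> \<le> c * s" for t using c by (simp add: abs_divide divide_le_eq mult.commute)
    have "prod_ext_norm (sup_norm X) (sup_norm X) (w f) \<le> ennreal s \<longleftrightarrow>
        sup_norm X (fst (w f)) \<le> ennreal s \<and> sup_norm X (snd (w f)) \<le> ennreal s"
      by (simp add: prod_ext_norm_def case_prod_unfold)
    also have "\<dots> \<longleftrightarrow> (\<forall>x. \<bar>fst (w f) x\<bar> \<le> s) \<and> (\<forall>x. \<bar>snd (w f) x\<bar> \<le> s)"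
      using wE[OF that(1)] that(2) by (simp add: sup_norm_le_iff glob mem_Times_iff)
    also have "\<dots> \<longleftrightarrow> (\<forall>j. \<bar>u f j\<bar> \<le> c * s)"
      unfolding w_def split_scaled_def fst_conv snd_conv sc split_sum_all by (rule refl)
    finally show ?thesis .
  qed
  have "prod_ext_norm (sup_norm X) (sup_norm X) (w f) \<le> sup_norm X f" if f: "f \<in> ?E" for f
  proof (rule ennreal_le_if_real_bounds)
    fix s :: real assume s: "s \<ge> 0" "sup_norm X f \<le> ennreal s"
    then have "\<forall>x. \<bar>f x\<bar> \<le> s" using f by (simp add: sup_norm_le_iff glob)
    then have "\<forall>j. \<bar>u f j\<bar> \<le> c * s" using u(3) f unfolding sup_bound_def by blast
    then show "prod_ext_norm (sup_norm X) (sup_norm X) (w f) \<le> ennreal s" using Nle[OF f s(1)] by simp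
  qed
  moreover have "ennreal (inverse (1 + \<epsilon>)) * sup_norm X f \<le> prod_ext_norm (sup_norm X) (sup_norm X) (w f)"
    if f: "f \<in> ?E" for f
  proof (rule ennreal_le_if_real_bounds)
    fix s :: real assume s: "s \<ge> 0" "prod_ext_norm (sup_norm X) (sup_norm X) (w f) \<le> ennreal s"
    then have "\<forall>j. \<bar>u f j\<bar> \<le> c * s" using Nle[OF f s(1)] by simp
    then have "\<forall>x. \<bar>v (u f) x\<bar> \<le> c * (c * s)" using v(3) u(1)[OF f] unfolding sup_bound_def by blast
    then have "\<forall>x. \<bar>f x\<bar> \<le> (1 + \<epsilon>) * s" using vu[OF f] c(2) by (simp add: mult.assoc[symmetric])
    then have "sup_norm X f \<le> ennreal ((1 + \<epsilon>) * s)" using s(1) \<epsilon> by (simp add: sup_norm_le_iff)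
    then have "ennreal (inverse (1 + \<epsilon>)) * sup_norm X f \<le> ennreal (inverse (1 + \<epsilon>)) * ennreal ((1 + \<epsilon>) * s)"
      by (rule mult_left_mono) simp
    also have "\<dots> = ennreal s" using \<epsilon> s(1) by (simp add: ennreal_mult[symmetric] mult.assoc[symmetric])
    finally show "ennreal (inverse (1 + \<epsilon>)) * sup_norm X f \<le> ennreal s" .
  qed
  ultimately show "\<exists>u. uniform_homeomorphism ?E (?E \<times> ?E) u \<and>
      (\<forall>f\<in>?E. ennreal (inverse (1 + \<epsilon>)) * sup_norm X f \<le> prod_ext_norm (sup_norm X) (sup_norm X) (u f) \<and>
        prod_ext_norm (sup_norm X) (sup_norm X) (u f) \<le> sup_norm X f)"
    using bij ucw ucz unfolding uniform_homeomorphism_def by (intro exI[of _ w]) auto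
qed

theorem theorem6p1:
  fixes X :: "'a topology"
  assumes "infinite (topspace X)"
    and "Polish_space X"
    and "zero_dimensional_space X"
  shows "bumpeq (Cp X) (sup_norm X) (Cp X \<times> Cp X) (prod_ext_norm (sup_norm X) (sup_norm X))
       \<and> uniformly_homeomorphic (Cp X) (Cp X \<times> Cp X)"
proof -
  have "completely_metrizable_space X" "separable_space X" using assms(2) by (auto simp: Polish_space_def)
  then obtain M d where M: "Metric_space M d" "Metric_space.mcomplete M d" "X = Metric_space.mtopology M d"
    unfolding completely_metrizable_space_def by blast
  interpret Metric_space M d by (rule M(1))
  interpret zero_dimensional_polish M d
    by unfold_locales (use M assms(3) \<open>separable_space X\<close> in auto)
  have "topspace X = M" using M(3) by simp
  then have "squarable (Cp X)" using good_space assms(1) M(3) by (simp add: good_def)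
  then have b: "bumpeq (Cp X) (sup_norm X) (Cp X \<times> Cp X) (prod_ext_norm (sup_norm X) (sup_norm X))"
    by (rule bumpeq_if_squarable)
  then have "uniformly_homeomorphic (Cp X) (Cp X \<times> Cp X)"
    unfolding bumpeq_def uniformly_homeomorphic_def by (metis zero_less_one)
  with b show ?thesis by blast
qed

end
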